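(* Let $\rho\in(0,1]$, $T>0$, $\varphi\in H$, $\psi\in D(A)$, $g\in C[0,T]$ real-valued with $g(t)\neq 0$ for all $t\in[0,T]$. Then there exists a unique solution $\{u(t),f\}$ of the inverse problem $$D_t^\rho u(t)+Au(t)=g(t)f,\quad t\in(0,T],\qquad u(0)=\varphi,\qquad \int_0^T u(t)\,dt=\psi,$$ and it is given by $$f=\sum_{k=1}^\infty \frac{1}{p_{k,\rho}(T)}\left[\psi_k-\varphi_k\,T\,E_{\rho,2}(-\lambda_kT^\rho)\right]v_k,$$ $$u(t)=\sum_{k=1}^\infty\left[\varphi_kE_{\rho,1}(-\lambda_kt^\rho)+\frac{q_{k,\rho}(t)}{p_{k,\rho}(T)}\left[\psi_k-\varphi_k\,T\,E_{\rho,2}(-\lambda_kT^\rho)\right]\right]v_k.$$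
   Context: $H$ is a separable Hilbert space with scalar product $(\cdot,\cdot)$. $A$ is an operator in $H$ with domain $D(A)$ such that $A=A^*$ and $(Ah,h)\ge C(h,h)$ for all $h\in D(A)$, for some constant $C>0$. $A$ has a complete orthonormal system of eigenfunctions $\{v_k\}_{k\ge1}$ in $H$ with corresponding positive eigenvalues $0<\lambda_1\le\lambda_2\le\cdots\to+\infty$. For $h\in H$, $h_k=(h,v_k)$ denotes its Fourier coefficients (so $\varphi_k=(\varphi,v_k)$, $\psi_k=(\psi,v_k)$), and $D(A)=\{h\in H:\sum_{k}\lambda_k^2|h_k|^2<\infty\}$. The Caputo derivative of order $\rho\in(0,1)$ is $D_t^\rho y(t)=\frac{1}{\Gamma(1-\rho)}\int_0^t\frac{\frac{d}{d\xi}y(\xi)}{(t-\xi)^\rho}\,d\xi$, $t>0$; for $\rho=1$, $D_t^1y=\frac{d}{dt}y$. A pair $\{u(t),f\}$ is called a solution of the inverse problem if $D_t^\rho u(t),\,Au(t)\in C((0,T];H)$, $u(t)\in C([0,T];H)$, $f\in H$, and the three relations of the inverse problem hold; the unknowns are both $u$ and $f$, while $g,\varphi,\psi$ are given. The two-parameter Mittag-Leffler function is $E_{\rho,\mu}(z)=\sum_{n=0}^\infty\frac{z^n}{\Gamma(\rho n+\mu)}$. Notation: $p_{k,\rho}(T)=\int_0^Tg(\eta)(T-\eta)^\rho E_{\rho,\rho+1}(-\lambda_k(T-\eta)^\rho)\,d\eta$, and $q_{k,\rho}(t)=\int_0^t(t-\eta)^{\rho-1}E_{\rho,\rho}(-\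lambda_k(t-\eta)^\rho)g(\eta)\,d\eta$.
   Formalization: For ρ<1 the Caputo derivative is taken in the regularised form d/dt of the fractional integral of order 1−ρ of y−y(0), since for merely continuous g the solution u may be differentiable nowhere and the formula with dy/dξ is then undefined. *)

theory Defs
  imports "HOL-Analysis.Analysis"
begin

text \<open>
  The scalar field of the Hilbert space is a type of sort
  \<open>{real_normed_field, euclidean_space}\<close>: a commutative finite-dimensional real division algebra
  with multiplicative norm, i.e. the reals or the complex numbers.  The real part of \<open>z\<close>
  is \<open>z \<bullet> 1\<close>, so conjugation is \<open>z \<mapsto> 2 Re z - z\<close>.
\<close>

definition scalar_cnj :: "'k::{real_normed_field, euclidean_space} \<Rightarrow> 'k" where
  "scalar_cnj z = of_real (2 * (z \<bullet> 1)) - z"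

lemma scalar_cnj_real: "scalar_cnj (x :: real) = x"
  by (simp add: scalar_cnj_def)

lemma scalar_cnj_complex: "scalar_cnj (z :: complex) = cnj z"
  by (simp add: scalar_cnj_def complex_eq_iff inner_complex_def)

text \<open>
  A separable Hilbert space over \<open>'k\<close> is a separable real Hilbert space with a compatible
  multiplication by scalars from \<open>'k\<close> and a scalar product, linear in the first argument, whose real
  part is the real inner product of the type.  As \<open>ip x x\<close> is self-conjugate, it equals
  \<open>norm x ^ 2\<close>.
\<close>

locale hilbert_space = vector_space smul
  for smul :: "'k::{real_normed_field, euclidean_space} \<Rightarrow>
    'h::{real_inner, banach, second_countable_topology} \<Rightarrow> 'h" +
  fixes ip :: "'h \<Rightarrow> 'h \<Rightarrow> 'k"
  assumes smul_of_real: "smul (of_real r) x = r *\<^sub>R x"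
    and ip_add_left: "ip (x + y) z = ip x z + ip y z"
    and ip_smul_left: "ip (smul c x) y = c * ip x y"
    and ip_cnj: "ip y x = scalar_cnj (ip x y)"
    and inner_eq_Re_ip: "x \<bullet> y = ip x y \<bullet> 1"

lemma hilbert_space_real:
  "hilbert_space (scaleR :: real \<Rightarrow> 'h \<Rightarrow> 'h::{real_inner, banach, second_countable_topology}) inner"
  by unfold_locales (auto simp: scalar_cnj_real algebra_simps inner_simps inner_commute)

lemma hilbert_space_complex:
  "hilbert_space ((*) :: complex \<Rightarrow> complex \<Rightarrow> complex) (\<lambda>x y. x * cnj y)"
  by unfold_locales
    (auto simp: scalar_cnj_complex algebra_simps scaleR_conv_of_real inner_complex_def)

text \<open>
  An unbounded operator is a domain \<open>D\<close> together with a function \<open>A\<close>; the values of \<open>A\<close> outside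
  \<open>D\<close> are irrelevant.  The equation \<open>A = A\<^sup>*\<close>, domains included, is equality of graphs.
\<close>

definition adjoint_graph ::
  "('h \<Rightarrow> 'h \<Rightarrow> 'k) \<Rightarrow> 'h set \<Rightarrow> ('h \<Rightarrow> 'h) \<Rightarrow> ('h \<times> 'h) set" where
  "adjoint_graph ip D A = {(y, z). \<forall>x\<in>D. ip (A x) y = ip x z}"

definition self_adjoint ::
  "('k::comm_ring_1 \<Rightarrow> 'h \<Rightarrow> 'h) \<Rightarrow> ('h \<Rightarrow> 'h \<Rightarrow> 'k) \<Rightarrow> 'h::{ab_group_add, topological_space} set \<Rightarrow>
    ('h \<Rightarrow> 'h) \<Rightarrow> bool" where
  "self_adjoint smul ip D A \<longleftrightarrow>
     module.subspace smul D \<and>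
     (\<forall>x\<in>D. \<forall>y\<in>D. A (x + y) = A x + A y) \<and>
     (\<forall>c. \<forall>x\<in>D. A (smul c x) = smul c (A x)) \<and>
     closure D = UNIV \<and>
     (\<lambda>x. (x, A x)) ` D = adjoint_graph ip D A"

definition complete_orthonormal ::
  "('h::zero \<Rightarrow> 'h \<Rightarrow> 'k::zero_neq_one) \<Rightarrow> (nat \<Rightarrow> 'h) \<Rightarrow> bool" where
  "complete_orthonormal ip v \<longleftrightarrow>
     (\<forall>j k. ip (v j) (v k) = (if j = k then 1 else 0)) \<and>
     (\<forall>h. (\<forall>k. ip h (v k) = 0) \<longrightarrow> h = 0)"

definition mittag_leffler :: "real \<Rightarrow> real \<Rightarrow> real \<Rightarrow> real" where
  "mittag_leffler \<rho> \<mu> z = (\<Sum>n. z ^ n / Gamma (\<rho> * real n + \<mu>))"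

definition frac_integral :: "real \<Rightarrow> (real \<Rightarrow> 'h) \<Rightarrow> real \<Rightarrow> 'h::{banach, second_countable_topology}" where
  "frac_integral \<alpha> y t =
     (1 / Gamma \<alpha>) *\<^sub>R (LBINT \<xi>:{0..t}. (t - \<xi>) powr (\<alpha> - 1) *\<^sub>R y \<xi>)"

text \<open>
  The Caputo derivative of order \<open>\<rho> < 1\<close> is \<open>frac_integral (1 - \<rho>) y'\<close>.  For a right-hand side
  that is merely continuous in time, solutions of fractional equations need not be differentiable
  at any point, so that \<open>y'\<close> has to be understood in the generalized sense.  For continuous \<open>y\<close>
  the formula then reads \<open>(d/dt) frac_integral (1 - \<rho>) (y - y 0)\<close>.  The lemma
  \<open>has_caputo_deriv_classical\<close> below shows that this agrees with \<open>frac_integral (1 - \<rho>) y'\<close>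
  whenever \<open>y'\<close> exists pointwise, the integral converges and the result is continuous.
  The derivative is taken within \<open>{0..T}\<close>, that is, one-sided at \<open>T\<close>.
\<close>

definition has_caputo_deriv ::
  "real \<Rightarrow> real \<Rightarrow> (real \<Rightarrow> 'h) \<Rightarrow> 'h::{banach, second_countable_topology} \<Rightarrow> real \<Rightarrow> bool" where
  "has_caputo_deriv \<rho> T y d t \<longleftrightarrow>
     (if \<rho> = 1 then (y has_vector_derivative d) (at t within {0..T})
      else ((\<lambda>s. frac_integral (1 - \<rho>) (\<lambda>\<xi>. y \<xi> - y 0) s) has_vector_derivative d)
             (at t within {0..T}))"

context
begin

private lemma kernel_integral:
  fixes a b r :: real
  assumes "a \<le> b" "r < 1"
  shows "integrable lborel (\<lambda>x. indicator {a..b} x * (x - a) powr (-r))"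
    and "(LBINT x. indicator {a..b} x * (x - a) powr (-r)) = (b - a) powr (1 - r) / (1 - r)"
    and "integrable lborel (\<lambda>x. indicator {a..b} x * (b - x) powr (-r))"
    and "(LBINT x. indicator {a..b} x * (b - x) powr (-r)) = (b - a) powr (1 - r) / (1 - r)"
proof -
  have gen: "integrable lborel (\<lambda>x. indicator {a..b} x * f x) \<and>
      (LBINT x. indicator {a..b} x * f x) = I"
    if "(f has_integral I) {a..b}" "f \<in> borel_measurable borel" "\<And>x. f x \<ge> 0" for f :: "real \<Rightarrow> real" and I
  proof -
    have "f absolutely_integrable_on {a..b}"
      using that by (intro nonnegative_absolutely_integrable_1) (auto simp: integrable_on_def)
    then have i: "set_integrable lborel {a..b} f"
      using that(2) unfolding set_integrable_def
      by (subst (asm) integrable_completion) auto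
    show ?thesis using set_borel_integral_eq_integral[OF i] i that(1)
      by (auto simp: set_integrable_def set_lebesgue_integral_def integral_unique)
  qed
  have "((\<lambda>x. (x - a) powr (-r)) has_integral
      ((b - a) powr (1 - r) / (1 - r) - (a - a) powr (1 - r) / (1 - r))) {a..b}"
  proof (rule fundamental_theorem_of_calculus_interior[OF assms(1)])
    show "continuous_on {a..b} (\<lambda>x. (x - a) powr (1 - r) / (1 - r))"
      using assms by (intro continuous_intros continuous_on_powr') auto
    fix x assume "x \<in> {a<..<b}"
    then show "((\<lambda>x. (x - a) powr (1 - r) / (1 - r)) has_vector_derivative (x - a) powr (-r)) (at x)"
      unfolding has_real_derivative_iff_has_vector_derivative[symmetric]
      using assms by (auto intro!: derivative_eq_intros)
  qed
  then have "((\<lambda>x. (x - a) powr (-r)) has_integral (b - a) powr (1 - r) / (1 - r)) {a..b}"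
    using assms by simp
  from gen[OF this] show "integrable lborel (\<lambda>x. indicator {a..b} x * (x - a) powr (-r))"
    and "(LBINT x. indicator {a..b} x * (x - a) powr (-r)) = (b - a) powr (1 - r) / (1 - r)"
    by auto
  have "((\<lambda>x. (b - x) powr (-r)) has_integral
      (- ((b - b) powr (1 - r) / (1 - r)) - (- ((b - a) powr (1 - r) / (1 - r))))) {a..b}"
  proof (rule fundamental_theorem_of_calculus_interior[OF assms(1)])
    show "continuous_on {a..b} (\<lambda>x. - ((b - x) powr (1 - r) / (1 - r)))"
      using assms by (intro continuous_intros continuous_on_powr') auto
    fix x assume "x \<in> {a<..<b}"
    then show "((\<lambda>x. - ((b - x) powr (1 - r) / (1 - r))) has_vector_derivative (b - x) powr (-r)) (at x)"
      unfolding has_real_derivative_iff_has_vector_derivative[symmetric]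
      using assms by (auto intro!: derivative_eq_intros)
  qed
  then have "((\<lambda>x. (b - x) powr (-r)) has_integral (b - a) powr (1 - r) / (1 - r)) {a..b}"
    using assms by simp
  from gen[OF this] show "integrable lborel (\<lambda>x. indicator {a..b} x * (b - x) powr (-r))"
    and "(LBINT x. indicator {a..b} x * (b - x) powr (-r)) = (b - a) powr (1 - r) / (1 - r)"
    by auto
qed

private lemma kernel_Fubini:
  fixes k :: "real \<Rightarrow> real \<Rightarrow> real" and z :: "real \<Rightarrow> 'h::{banach, second_countable_topology}"
  assumes meas: "(\<lambda>(x, y). k x y) \<in> borel_measurable (borel \<Otimes>\<^sub>M borel)"
    and nn: "\<And>x y. k x y \<ge> 0"
    and int: "\<And>y. integrable lborel (\<lambda>x. k x y)"
    and val: "\<And>y. (LBINT x. k x y) = b y"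
    and bound: "\<And>y. b y \<le> B"
    and z: "integrable lborel z"
  shows "integrable lborel (\<lambda>x. LBINT y. k x y *\<^sub>R z y)"
    and "(LBINT x. LBINT y. k x y *\<^sub>R z y) = (LBINT y. b y *\<^sub>R z y)"
proof -
  have zm [measurable]: "z \<in> borel_measurable borel" using z by auto
  have km [measurable]: "(\<lambda>p. k (snd p) (fst p)) \<in> borel_measurable (borel \<Otimes>\<^sub>M borel)"
    using measurable_compose[OF measurable_pair_swap' meas] by (simp add: split_beta)
  have km' [measurable]: "(\<lambda>p. k (fst p) (snd p)) \<in> borel_measurable (borel \<Otimes>\<^sub>M borel)"
    using meas by (simp add: split_beta)
  have b0: "b y \<ge> 0" for y using nn by (simp flip: val)
  have bm [measurable]: "b \<in> borel_measurable borel"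
  proof -
    have "(\<lambda>y. LBINT x. k x y) \<in> borel_measurable lborel"
      by (rule lborel.borel_measurable_lebesgue_integral) (simp add: split_beta)
    then show ?thesis by (simp add: val)
  qed
  have I: "integrable (lborel \<Otimes>\<^sub>M lborel) (\<lambda>(y, x). k x y *\<^sub>R z y)"
  proof (rule lborel_pair.Fubini_integrable)
    show "(\<lambda>(y, x). k x y *\<^sub>R z y) \<in> borel_measurable (lborel \<Otimes>\<^sub>M lborel)"
      by (simp add: split_beta)
    have "integrable lborel (\<lambda>y. b y * norm (z y))"
    proof (rule Bochner_Integration.integrable_bound)
      show "integrable lborel (\<lambda>y. B * norm (z y))" using z by auto
      show "AE y in lborel. norm (b y * norm (z y)) \<le> norm (B * norm (z y))"
        using b0 bound by (auto simp: abs_mult intro!: mult_right_mono AE_I2 intro: order_trans[OF _ abs_ge_self])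
    qed simp
    moreover have "(LBINT x. norm (case (y, x) of (y, x) \<Rightarrow> k x y *\<^sub>R z y)) = b y * norm (z y)" for y
      using nn by (simp add: val abs_of_nonneg)
    ultimately show "integrable lborel (\<lambda>y. LBINT x. norm (case (y, x) of (y, x) \<Rightarrow> k x y *\<^sub>R z y))"
      by (simp only:)
    show "AE y in lborel. integrable lborel (\<lambda>x. case (y, x) of (y, x) \<Rightarrow> k x y *\<^sub>R z y)"
      using int by auto
  qed
  from lborel_pair.integrable_snd[OF I] show "integrable lborel (\<lambda>x. LBINT y. k x y *\<^sub>R z y)" by simp
  have "(LBINT x. LBINT y. k x y *\<^sub>R z y) = (LBINT y. LBINT x. k x y *\<^sub>R z y)"
    using lborel_pair.Fubini_integral[OF I] by simp
  also have "\<dots> = (LBINT y. b y *\<^sub>R z y)"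
    using int by (simp add: val)
  finally show "(LBINT x. LBINT y. k x y *\<^sub>R z y) = (LBINT y. b y *\<^sub>R z y)" .
qed

private lemma deriv_of_integral:
  fixes f :: "real \<Rightarrow> 'h::{banach, second_countable_topology}"
  assumes f: "set_integrable lborel {0..T} f" and c: "continuous_on {0<..T} f" and t: "t \<in> {0<..T}"
  shows "((\<lambda>s. LBINT x:{0..s}. f x) has_vector_derivative f t) (at t within {0..T})"
  unfolding has_vector_derivative_def has_derivative_within_alt
proof (intro conjI allI impI)
  show "bounded_linear (\<lambda>h. h *\<^sub>R f t)" by (rule bounded_linear_scaleR_left)
  fix e :: real assume e: "e > 0"
  from c t e obtain d where d: "d > 0" "\<And>x. x \<in> {0<..T} \<Longrightarrow> dist x t < d \<Longrightarrow> dist (f x) (f t) < e"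
    unfolding continuous_on_iff by blast
  define d' where "d' = min d t"
  have "d' > 0" using d t by (simp add: d'_def)
  moreover have "norm ((LBINT x:{0..s}. f x) - (LBINT x:{0..t}. f x) - (s - t) *\<^sub>R f t) \<le> e * norm (s - t)"
    if s: "s \<in> {0..T}" "norm (s - t) < d'" for s
  proof -
    have s0: "s > 0" using s by (auto simp: d'_def)
    have key: "norm ((LBINT x:{0..q}. f x) - (LBINT x:{0..p}. f x) - (q - p) *\<^sub>R f t) \<le> e * (q - p)"
      if pq: "0 < p" "p \<le> q" "q \<le> T" "\<And>x. x \<in> {p<..q} \<Longrightarrow> dist x t < d" for p q
    proof -
      have i1: "set_integrable lborel {0..p} f" and i2: "set_integrable lborel {p<..q} f"
        by (rule set_integrable_subset[OF f]; use pq in auto)+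
      have "{0..q} = {0..p} \<union> {p<..q}" using pq by auto
      then have 1: "(LBINT x:{0..q}. f x) = (LBINT x:{0..p}. f x) + (LBINT x:{p<..q}. f x)"
        using set_integral_Un[OF _ i1 i2] by (simp add: disjoint_iff)
      have 2: "set_integrable lborel {p<..q} (\<lambda>x. f t)"
        unfolding set_integrable_def by (rule integrable_scaleR_left) (simp add: pq)
      have 3: "(LBINT x:{p<..q}. f t) = (q - p) *\<^sub>R f t"
        using pq by (simp add: set_lebesgue_integral_def)
      have "(LBINT x:{0..q}. f x) - (LBINT x:{0..p}. f x) - (q - p) *\<^sub>R f t
          = (LBINT x:{p<..q}. f x - f t)"
        using 1 3 set_integral_diff(2)[OF i2 2] by simp
      also have "norm \<dots> \<le> (LBINT x:{p<..q}. norm (f x - f t))"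
        using set_integral_diff(1)[OF i2 2] by (rule set_integral_norm_bound)
      also have "\<dots> \<le> (LBINT x:{p<..q}. e)"
      proof (rule set_integral_mono)
        show "set_integrable lborel {p<..q} (\<lambda>x. norm (f x - f t))"
          by (rule set_integrable_norm[OF set_integral_diff(1)[OF i2 2]])
        show "set_integrable lborel {p<..q} (\<lambda>x. e)"
          unfolding set_integrable_def by (rule integrable_scaleR_left) (simp add: pq)
        fix x assume "x \<in> {p<..q}"
        then show "norm (f x - f t) \<le> e"
          using d(2)[of x] pq by (auto simp: dist_norm intro!: less_imp_le)
      qed
      also have "\<dots> = e * (q - p)" using pq by (simp add: set_lebesgue_integral_def)
      finally show ?thesis .
    qed
    show ?thesis
    proof (cases "t \<le> s")
      case True
      show ?thesis using key[of t s] True s t by (auto simp: d'_def dist_norm)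
    next
      case False
      have "norm ((LBINT x:{0..t}. f x) - (LBINT x:{0..s}. f x) - (t - s) *\<^sub>R f t) \<le> e * (t - s)"
        using key[of s t] False s t s0 by (auto simp: d'_def dist_norm)
      moreover have "(LBINT x:{0..s}. f x) - (LBINT x:{0..t}. f x) - (s - t) *\<^sub>R f t =
          - ((LBINT x:{0..t}. f x) - (LBINT x:{0..s}. f x) - (t - s) *\<^sub>R f t)"
        by (simp add: algebra_simps)
      ultimately show ?thesis using False by (simp only: norm_minus_cancel) simp
    qed
  qed
  ultimately show "\<exists>d>0. \<forall>y\<in>{0..T}. norm (y - t) < d \<longrightarrow>
      norm ((LBINT x:{0..y}. f x) - (LBINT x:{0..t}. f x) - (y - t) *\<^sub>R f t) \<le> e * norm (y - t)"
    by blast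
qed

lemma has_caputo_deriv_classical:
  fixes y :: "real \<Rightarrow> 'h::{real_inner, banach, second_countable_topology}"
  assumes \<rho>: "0 < \<rho>" "\<rho> < 1"
    and y: "continuous_on {0..T} y"
    and y': "\<And>\<xi>. \<xi> \<in> {0<..<T} \<Longrightarrow> (y has_vector_derivative y' \<xi>) (at \<xi>)"
    and int: "\<And>t. t \<in> {0<..T} \<Longrightarrow> set_integrable lborel {0..t} (\<lambda>\<xi>. (t - \<xi>) powr (-\<rho>) *\<^sub>R y' \<xi>)"
    and cont: "continuous_on {0<..T} (frac_integral (1 - \<rho>) y')"
    and t: "t \<in> {0<..T}"
  shows "has_caputo_deriv \<rho> T y (frac_integral (1 - \<rho>) y' t) t"
proof -
  define z where "z \<xi> = indicator {0<..<T} \<xi> *\<^sub>R y' \<xi>" for \<xi>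
  have T: "0 < T" using t by auto
  have z: "integrable lborel z"
  proof -
    let ?h = "\<lambda>\<xi>. indicator {0..T} \<xi> *\<^sub>R ((T - \<xi>) powr (-\<rho>) *\<^sub>R y' \<xi>)"
    have h: "integrable lborel ?h" using int[of T] T by (simp add: set_integrable_def)
    have eq: "z = (\<lambda>\<xi>. (indicator {0<..<T} \<xi> * (T - \<xi>) powr \<rho>) *\<^sub>R ?h \<xi>)"
      by (auto simp: z_def fun_eq_iff indicator_def powr_minus field_simps)
    show ?thesis
    proof (rule Bochner_Integration.integrable_bound)
      show "integrable lborel (\<lambda>\<xi>. T powr \<rho> *\<^sub>R ?h \<xi>)" using h by (rule integrable_scaleR_right)
      show "z \<in> borel_measurable lborel" unfolding eq using h by measurable
      show "AE \<xi> in lborel. norm (z \<xi>) \<le> norm (T powr \<rho> *\<^sub>R ?h \<xi>)"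
      proof (rule AE_I2)
        fix \<xi>
        have "norm (z \<xi>) = (indicator {0<..<T} \<xi> * (T - \<xi>) powr \<rho>) * norm (?h \<xi>)"
          by (subst eq) (simp add: abs_mult)
        also have "\<dots> \<le> T powr \<rho> * norm (?h \<xi>)"
          using \<rho> T by (intro mult_right_mono) (auto simp: indicator_def powr_mono2)
        finally show "norm (z \<xi>) \<le> norm (T powr \<rho> *\<^sub>R ?h \<xi>)" by simp
      qed
    qed
  qed
  have zm [measurable]: "z \<in> borel_measurable borel" using z by auto
  have ae: "AE \<xi> in lborel. \<xi> \<noteq> (0::real)" "AE \<xi> in lborel. \<xi> \<noteq> T"
    using AE_lborel_singleton by auto
  have F: "(LBINT \<xi>:{0..s}. (s - \<xi>) powr (-\<rho>) *\<^sub>R y' \<xi>) =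
      (LBINT \<eta>. (indicator {0..s} \<eta> * (s - \<eta>) powr (-\<rho>)) *\<^sub>R z \<eta>)" if s: "s \<in> {0<..T}" for s
    unfolding set_lebesgue_integral_def
  proof (rule integral_cong_AE)
    show "(\<lambda>\<xi>. indicator {0..s} \<xi> *\<^sub>R (s - \<xi>) powr (-\<rho>) *\<^sub>R y' \<xi>) \<in> borel_measurable lborel"
      using int[OF s] by (auto simp: set_integrable_def)
    show "AE \<xi> in lborel. indicator {0..s} \<xi> *\<^sub>R (s - \<xi>) powr (-\<rho>) *\<^sub>R y' \<xi> =
        (indicator {0..s} \<xi> * (s - \<xi>) powr (-\<rho>)) *\<^sub>R z \<xi>"
      using ae by eventually_elim (use s in \<open>auto simp: z_def indicator_def\<close>)
  qed simp
  have Y: "y \<xi> - y 0 = (LBINT \<eta>. indicator {0..\<xi>} \<eta> *\<^sub>R z \<eta>)" if \<xi>: "\<xi> \<in> {0..T}" for \<xi>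
  proof (rule vector_eq_rdot[THEN iffD1, rule_format])
    fix a :: 'h
    have iz: "integrable lborel (\<lambda>\<eta>. indicator {0..\<xi>} \<eta> *\<^sub>R z \<eta>)"
      using integrable_mult_indicator[OF _ z] by simp
    have "((\<lambda>\<eta>. z \<eta> \<bullet> a) has_integral (y \<xi> \<bullet> a - y 0 \<bullet> a)) {0..\<xi>}"
    proof (rule fundamental_theorem_of_calculus_interior)
      show "continuous_on {0..\<xi>} (\<lambda>x. y x \<bullet> a)"
        by (intro continuous_intros continuous_on_subset[OF y]) (use \<xi> in auto)
      fix x assume x: "x \<in> {0<..<\<xi>}"
      then have "(y has_vector_derivative z x) (at x)" using y'[of x] \<xi> by (simp add: z_def)
      then show "((\<lambda>x. y x \<bullet> a) has_vector_derivative z x \<bullet> a) (at x)"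
        by (rule bounded_linear.has_vector_derivative[OF bounded_linear_inner_left])
    qed (use \<xi> in auto)
    moreover have "set_integrable lborel {0..\<xi>} (\<lambda>\<eta>. z \<eta> \<bullet> a)"
      using integrable_inner_left[OF iz, of a] by (simp add: set_integrable_def)
    ultimately have "(LBINT \<eta>:{0..\<xi>}. z \<eta> \<bullet> a) = y \<xi> \<bullet> a - y 0 \<bullet> a"
      by (simp add: set_borel_integral_eq_integral integral_unique)
    moreover have "(LBINT \<eta>. indicator {0..\<xi>} \<eta> *\<^sub>R z \<eta>) \<bullet> a = (LBINT \<eta>:{0..\<xi>}. z \<eta> \<bullet> a)"
      using integral_inner_left[of a lborel "\<lambda>\<eta>. indicator {0..\<xi>} \<eta> *\<^sub>R z \<eta>"] iz
      by (simp add: set_lebesgue_integral_def)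
    ultimately show "(y \<xi> - y 0) \<bullet> a = (LBINT \<eta>. indicator {0..\<xi>} \<eta> *\<^sub>R z \<eta>) \<bullet> a"
      by (simp add: inner_diff_left)
  qed
  define b where "b s \<eta> = indicator {0..s} \<eta> * ((s - \<eta>) powr (1 - \<rho>) / (1 - \<rho>))" for s \<eta> :: real
  have bB: "b s \<eta> \<le> s powr (1 - \<rho>) / (1 - \<rho>)" for s \<eta>
    using \<rho> by (auto simp: b_def indicator_def intro!: divide_right_mono powr_mono2)
  define k1 where "k1 s \<xi> \<eta> =
    indicator {0..s} \<eta> * (indicator {\<eta>..s} \<xi> * (s - \<xi>) powr (-\<rho>))" for s \<xi> \<eta> :: real
  define k2 where "k2 s \<xi> \<eta> =
    indicator {0..s} \<eta> * (indicator {\<eta>..s} \<xi> * (\<xi> - \<eta>) powr (-\<rho>))" for s \<xi> \<eta> :: real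
  have ind: "(indicator {\<eta>..s} \<xi> :: real) = (if \<eta> \<le> \<xi> \<and> \<xi> \<le> s then 1 else 0)" for \<xi> \<eta> s :: real
    by (auto simp: indicator_def)
  have k1: "integrable lborel (\<lambda>\<xi>. k1 s \<xi> \<eta>)" "(LBINT \<xi>. k1 s \<xi> \<eta>) = b s \<eta>"
    and k2: "integrable lborel (\<lambda>\<xi>. k2 s \<xi> \<eta>)" "(LBINT \<xi>. k2 s \<xi> \<eta>) = b s \<eta>" for s \<eta>
    using kernel_integral[of \<eta> s \<rho>] \<rho> by (cases "\<eta> \<in> {0..s}"; simp add: k1_def k2_def b_def)+
  have m1: "(\<lambda>(\<xi>, \<eta>). k1 s \<xi> \<eta>) \<in> borel_measurable (borel \<Otimes>\<^sub>M borel)"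
    and m2: "(\<lambda>(\<xi>, \<eta>). k2 s \<xi> \<eta>) \<in> borel_measurable (borel \<Otimes>\<^sub>M borel)" for s
    unfolding k1_def k2_def ind by measurable
  have n1: "k1 s \<xi> \<eta> \<ge> 0" and n2: "k2 s \<xi> \<eta> \<ge> 0" for s \<xi> \<eta>
    by (auto simp: k1_def k2_def)
  note f1 = kernel_Fubini[OF m1 n1 k1 bB z] and f2 = kernel_Fubini[OF m2 n2 k2 bB z]
  let ?F = "\<lambda>s. LBINT \<xi>:{0..s}. (s - \<xi>) powr (-\<rho>) *\<^sub>R y' \<xi>"
  have w: "frac_integral (1 - \<rho>) y' s = (1 / Gamma (1 - \<rho>)) *\<^sub>R ?F s" for s
    by (simp add: frac_integral_def)
  have G: "(LBINT \<eta>. k2 s \<xi> \<eta> *\<^sub>R z \<eta>) = indicator {0<..s} \<xi> *\<^sub>R ?F \<xi>" if s: "s \<in> {0..T}" for s \<xi>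
  proof (cases "\<xi> \<in> {0<..s}")
    case True
    then have "(LBINT \<eta>. k2 s \<xi> \<eta> *\<^sub>R z \<eta>) =
        (LBINT \<eta>. (indicator {0..\<xi>} \<eta> * (\<xi> - \<eta>) powr (-\<rho>)) *\<^sub>R z \<eta>)"
      by (intro Bochner_Integration.integral_cong) (auto simp: k2_def indicator_def)
    then show ?thesis using F[of \<xi>] True s by simp
  next
    case False
    then have "k2 s \<xi> \<eta> *\<^sub>R z \<eta> = 0" for \<eta> by (auto simp: k2_def z_def indicator_def)
    then have "(LBINT \<eta>. k2 s \<xi> \<eta> *\<^sub>R z \<eta>) = (LBINT \<eta>::real. 0)" by (simp only:)
    then show ?thesis using False by simp
  qed
  have si0: "set_integrable lborel {0<..T} ?F"
    using f2(1)[of T] G[of T] T by (simp add: set_integrable_def)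
  have Fz: "?F 0 = 0"
  proof -
    have "(\<lambda>\<xi>. indicator {0..0} \<xi> *\<^sub>R (0 - \<xi>) powr (-\<rho>) *\<^sub>R y' \<xi>) = (\<lambda>\<xi>. 0)"
      by (auto simp: indicator_def)
    then show ?thesis by (simp add: set_lebesgue_integral_def)
  qed
  have sub: "indicator {0<..s} \<xi> *\<^sub>R ?F \<xi> = indicator {0..s} \<xi> *\<^sub>R ?F \<xi>" for s \<xi>
    using Fz by (cases "\<xi> = 0") (auto simp: indicator_def)
  have si: "set_integrable lborel {0..T} ?F"
    using si0 unfolding set_integrable_def sub .
  have J: "(LBINT \<xi>:{0..s}. (s - \<xi>) powr (-\<rho>) *\<^sub>R (y \<xi> - y 0)) = (LBINT \<xi>:{0..s}. ?F \<xi>)"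
    if s: "s \<in> {0..T}" for s
  proof -
    have "(LBINT \<eta>. k1 s \<xi> \<eta> *\<^sub>R z \<eta>) = indicator {0..s} \<xi> *\<^sub>R (s - \<xi>) powr (-\<rho>) *\<^sub>R (y \<xi> - y 0)" for \<xi>
    proof (cases "\<xi> \<in> {0..s}")
      case True
      then have "(LBINT \<eta>. k1 s \<xi> \<eta> *\<^sub>R z \<eta>) =
          (LBINT \<eta>. (s - \<xi>) powr (-\<rho>) *\<^sub>R (indicator {0..\<xi>} \<eta> *\<^sub>R z \<eta>))"
        by (intro Bochner_Integration.integral_cong) (auto simp: k1_def indicator_def)
      also have "\<dots> = (s - \<xi>) powr (-\<rho>) *\<^sub>R (y \<xi> - y 0)"
        using Y[of \<xi>] True s by (simp only: integral_scaleR_right) auto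
      finally show ?thesis using True by simp
    next
      case False
      then have "k1 s \<xi> \<eta> *\<^sub>R z \<eta> = 0" for \<eta> by (auto simp: k1_def indicator_def)
      then have "(LBINT \<eta>. k1 s \<xi> \<eta> *\<^sub>R z \<eta>) = (LBINT \<eta>::real. 0)" by (simp only:)
      then show ?thesis using False by simp
    qed
    then have "(LBINT \<xi>:{0..s}. (s - \<xi>) powr (-\<rho>) *\<^sub>R (y \<xi> - y 0)) = (LBINT \<eta>. b s \<eta> *\<^sub>R z \<eta>)"
      using f1(2)[of s] by (simp add: set_lebesgue_integral_def)
    also have "\<dots> = (LBINT \<xi>:{0..s}. ?F \<xi>)"
      using f2(2)[of s] unfolding G[OF s] sub
      by (simp only: set_lebesgue_integral_def[of lborel "{0..s}" ?F])
    finally show ?thesis .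
  qed
  have gi: "set_integrable lborel {0..T} (frac_integral (1 - \<rho>) y')"
    unfolding w using si by simp
  have "((\<lambda>s. frac_integral (1 - \<rho>) (\<lambda>\<xi>. y \<xi> - y 0) s) has_vector_derivative
      frac_integral (1 - \<rho>) y' t) (at t within {0..T})"
  proof (rule has_vector_derivative_transform[OF _ _ deriv_of_integral[OF gi cont t]])
    show "t \<in> {0..T}" using t by auto
    fix s assume "s \<in> {0..T}"
    then show "frac_integral (1 - \<rho>) (\<lambda>\<xi>. y \<xi> - y 0) s = (LBINT x:{0..s}. frac_integral (1 - \<rho>) y' x)"
      unfolding w using J[of s] by (simp add: frac_integral_def)
  qed
  then show ?thesis using \<rho> by (simp add: has_caputo_deriv_def)
qed

end

definition p_coeff :: "real \<Rightarrow> (real \<Rightarrow> real) \<Rightarrow> real \<Rightarrow> real \<Rightarrow> real" where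
  "p_coeff \<rho> g l T =
     (LBINT \<eta>:{0..T}. g \<eta> * (T - \<eta>) powr \<rho> * mittag_leffler \<rho> (\<rho> + 1) (- l * (T - \<eta>) powr \<rho>))"

definition q_coeff :: "real \<Rightarrow> (real \<Rightarrow> real) \<Rightarrow> real \<Rightarrow> real \<Rightarrow> real" where
  "q_coeff \<rho> g l t =
     (LBINT \<eta>:{0..t}. (t - \<eta>) powr (\<rho> - 1) * mittag_leffler \<rho> \<rho> (- l * (t - \<eta>) powr \<rho>) * g \<eta>)"

text \<open>\<open>w\<close> is the Caputo derivative of \<open>u\<close>; only the values of \<open>u\<close> on \<open>{0..T}\<close> matter.\<close>

definition inverse_problem_solution ::
  "'h set \<Rightarrow> ('h \<Rightarrow> 'h) \<Rightarrow> real \<Rightarrow> real \<Rightarrow> (real \<Rightarrow> real) \<Rightarrow> 'h \<Rightarrow> 'h \<Rightarrow>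
     (real \<Rightarrow> 'h::{banach, second_countable_topology}) \<Rightarrow> 'h \<Rightarrow> bool" where
  "inverse_problem_solution D A \<rho> T g \<phi> \<psi> u f \<longleftrightarrow>
     continuous_on {0..T} u \<and>
     (\<forall>t\<in>{0<..T}. u t \<in> D) \<and>
     continuous_on {0<..T} (\<lambda>t. A (u t)) \<and>
     (\<exists>w. continuous_on {0<..T} w \<and>
        (\<forall>t\<in>{0<..T}. has_caputo_deriv \<rho> T u (w t) t \<and> w t + A (u t) = g t *\<^sub>R f)) \<and>
     u 0 = \<phi> \<and>
     (LBINT t:{0..T}. u t) = \<psi>"

end

theory Submission
  imports Defs
begin

text \<open>
  Expanding in the eigenbasis turns the inverse problem into one scalar problem for every \<open>k\<close>: with
  \<open>l = lam k\<close>, the Fourier coefficient \<open>y\<close> of \<open>u\<close> satisfies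
  \<open>D\<^sup>\<rho> y + l y = g b\<close>, \<open>y 0 = a\<close>, where \<open>a\<close> and \<open>b\<close> are the coefficients of \<open>\<phi>\<close> and \<open>f\<close>.
  Three ingredients settle it.

  \<^bold>\<open>Scalar equation.\<close> Let \<open>k\<^sub>\<alpha>(t) = t\<^sup>\<alpha>\<^sup>-\<^sup>1 / \<Gamma>(\<alpha>)\<close> and
  \<open>e\<^sub>\<mu>(t) = t\<^sup>\<mu>\<^sup>-\<^sup>1 E\<^sub>\<rho>\<^sub>,\<^sub>\<mu>(- l t\<^sup>\<rho>)\<close>. Termwise Beta integrals give \<open>k\<^sub>\<alpha> * e\<^sub>\<mu> = e\<^sub>\<alpha>\<^sub>+\<^sub>\<mu>\<close>
  (\<open>conv_powr_kernel_ml_kernel\<close>). Together with \<open>e\<^sub>1 = 1 - l (1 * e\<^sub>\<rho>)\<close> and associativity of convolution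
  this identity proves both that \<open>y - a = e\<^sub>\<rho> * (g b - l a)\<close> solves the equation (\<open>frac_compl_duhamel\<close>)
  and that nothing else does: convolving the integrated equation with \<open>e\<^sub>\<rho>\<close> makes the unknown cancel except in
  its primitive, which is then differentiated (\<open>frac_compl_duhamel_unique\<close>). So
  \<open>y = a E\<^sub>\<rho>\<^sub>,\<^sub>1(- l t\<^sup>\<rho>) + b q(t)\<close>, and integrating over \<open>[0, T]\<close> gives
  \<open>\<psi>\<^sub>k = a T E\<^sub>\<rho>\<^sub>,\<^sub>2(- l T\<^sup>\<rho>) + b p\<close>. As soon as \<open>p \<noteq> 0\<close> this determines \<open>b\<close>, hence \<open>f\<close> and \<open>u\<close>.

  \<^bold>\<open>Bounds uniform in the eigenvalue.\<close> All of them rest on \<open>E\<^sub>\<rho>\<^sub>,\<^sub>\<rho>(- x) > 0\<close> for \<open>x \<ge> 0\<close>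
  (\<open>mittag_leffler_pos\<close>), which is proved by a maximum-principle argument at a first zero. Positivity makes \<open>E\<^sub>\<rho>\<^sub>,\<^sub>1(- x)\<close> decrease from \<open>1\<close> and stay nonnegative, whence
  \<open>l \<bar>q\<bar> \<le> sup \<bar>g\<bar>\<close>, \<open>l E\<^sub>\<rho>\<^sub>,\<^sub>1(- l t\<^sup>\<rho>) = O(t\<^sup>-\<^sup>\<rho>)\<close> and \<open>l T E\<^sub>\<rho>\<^sub>,\<^sub>2(- l T\<^sup>\<rho>) = O(1)\<close>. Since \<open>g\<close>
  has a constant sign, \<open>l \<bar>p\<bar>\<close> is also bounded away from \<open>0\<close> (\<open>p_coeff_lower_bound\<close>).

  \<^bold>\<open>Convergence.\<close> The lower bound on \<open>l \<bar>p\<bar>\<close> costs one power of the eigenvalue, which \<open>\<psi> \<in> D(A)\<close> pays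
  for, so \<open>f \<in> H\<close>. The other bounds give square-summable majorants, uniform in \<open>t \<in> [0, T]\<close> for the series of
  \<open>u\<close> and in \<open>t \<in> [\<epsilon>, T]\<close> for that of \<open>A u\<close>. The Fourier coefficients commute with all integrals
  involved, so the vector equation follows from its coefficients (\<open>mode_series_solves\<close>), and conversely every solution has
  the coefficients computed above (\<open>solution_coefs\<close>).
\<close>

section \<open>Convolution on the half-line\<close>

text \<open>
  Convolution on the half-line. The lemmas ask only for integrability of the kernel, so that weakly singular kernels
  such as \<open>t\<^sup>\<rho>\<^sup>-\<^sup>1\<close> are covered; the other factor takes values in the Hilbert space or in its scalar field.
\<close>

definition conv :: "(real \<Rightarrow> real) \<Rightarrow> (real \<Rightarrow> 'b) \<Rightarrow> real \<Rightarrow> 'b::{banach, second_countable_topology}" where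
  "conv a y t = (LBINT s:{0..t}. a (t - s) *\<^sub>R y s)"

lemma conv_0 [simp]: "conv a y 0 = 0"
proof -
  have "conv a y 0 = (LBINT s. indicator {0::real} s *\<^sub>R (a 0 *\<^sub>R y 0))"
    unfolding conv_def set_lebesgue_integral_def
    by (rule Bochner_Integration.integral_cong) (auto simp: indicator_def)
  then show ?thesis by simp
qed

lemma conv_cong_AE:
  assumes "set_borel_measurable lborel {0..t} (\<lambda>s. a (t - s) *\<^sub>R y s)"
    and "set_borel_measurable lborel {0..t} (\<lambda>s. b (t - s) *\<^sub>R z s)"
    and "\<And>s. 0 < s \<Longrightarrow> s < t \<Longrightarrow> a s = b s"
    and "\<And>s. 0 < s \<Longrightarrow> s < t \<Longrightarrow> y s = z s"
  shows "conv a y t = conv b z t"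
  unfolding conv_def set_lebesgue_integral_def
proof (rule integral_cong_AE)
  have "AE s in lborel. s \<noteq> (0::real)" "AE s in lborel. s \<noteq> t"
    using AE_lborel_singleton by auto
  then show "AE s in lborel. indicator {0..t} s *\<^sub>R (a (t - s) *\<^sub>R y s) = indicator {0..t} s *\<^sub>R (b (t - s) *\<^sub>R z s)"
    by eventually_elim (auto simp: indicator_def assms(3,4))
qed (use assms(1,2) in \<open>auto simp: set_borel_measurable_def\<close>)

lemma integrable_reflect_shift:
  fixes a :: "real \<Rightarrow> 'b::{banach, second_countable_topology}"
  assumes "integrable lborel a"
  shows "integrable lborel (\<lambda>s. a (t - s))" "(LBINT s. a (t - s)) = (LBINT s. a s)"
  using lborel_integrable_real_affine[OF assms, of "-1" t] lborel_integral_real_affine[of "-1" a t]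
  by auto

lemma continuous_cutoff:
  fixes y :: "real \<Rightarrow> 'b::{banach, second_countable_topology}"
  assumes "continuous_on {0..T} y"
  obtains B where "B \<ge> 0" "\<And>s. norm (indicator {0..T} s *\<^sub>R y s) \<le> B"
    "(\<lambda>s. indicator {0..T} s *\<^sub>R y s) \<in> borel_measurable borel"
proof -
  have "bounded (y ` {0..T})"
    using assms compact_Icc compact_continuous_image compact_imp_bounded by blast
  then obtain B where B: "B > 0" "\<And>s. s \<in> {0..T} \<Longrightarrow> norm (y s) \<le> B"
    unfolding bounded_pos by auto
  show thesis
  proof (rule that[of B])
    show "(\<lambda>s. indicator {0..T} s *\<^sub>R y s) \<in> borel_measurable borel"
      by (rule borel_measurable_continuous_on_indicator[OF _ assms]) simp
  qed (use B in \<open>auto simp: indicator_def\<close>)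
qed

lemma integrable_kernel_times_bounded:
  fixes y :: "real \<Rightarrow> 'b::{banach, second_countable_topology}"
  assumes a: "integrable lborel a" and y: "y \<in> borel_measurable borel" "\<And>s. norm (y s) \<le> B"
  shows "integrable lborel (\<lambda>s. a (t - s) *\<^sub>R y s)" "integrable lborel (\<lambda>s. a s *\<^sub>R y (t - s))"
proof -
  note [measurable] = y(1) borel_measurable_integrable[OF a]
  have a': "integrable lborel (\<lambda>s. a (t - s))" using integrable_reflect_shift[OF a] by simp
  have "norm (c *\<^sub>R y s) \<le> norm (B * c)" for c s
    using mult_left_mono[OF y(2)[of s], of "\<bar>c\<bar>"] y(2)[of s] norm_ge_zero[of "y s"]
    by (simp add: abs_mult mult.commute del: norm_ge_zero)
  then show "integrable lborel (\<lambda>s. a (t - s) *\<^sub>R y s)" "integrable lborel (\<lambda>s. a s *\<^sub>R y (t - s))"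
    by (intro Bochner_Integration.integrable_bound[OF integrable_mult_right[OF a', of B]]
      Bochner_Integration.integrable_bound[OF integrable_mult_right[OF a, of B]]; simp)+
qed

text \<open>
  Cutting both factors off outside \<open>{0..T}\<close> does not change the convolution at times up to \<open>T\<close>, and
  produces a convolution over the whole line, where translations and Fubini apply without bookkeeping of the limits.
\<close>

lemma conv_cutoff:
  assumes "t \<le> T"
  shows "conv a y t = (LBINT s. (indicator {0..T} (t - s) * a (t - s)) *\<^sub>R (indicator {0..T} s *\<^sub>R y s))"
  unfolding conv_def set_lebesgue_integral_def
  by (rule Bochner_Integration.integral_cong) (use assms in \<open>auto simp: indicator_def\<close>)

lemma conv_commuted:
  assumes "t \<le> T"
  shows "conv a y t = (LBINT s. (indicator {0..T} s * a s) *\<^sub>R (indicator {0..T} (t - s) *\<^sub>R y (t - s)))"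
  unfolding conv_cutoff[OF assms]
  by (subst lborel_integral_real_affine[of "-1" _ t]) auto

lemma conv_commute:
  fixes a b :: "real \<Rightarrow> real"
  shows "conv a b t = conv b a t"
  using conv_cutoff[OF order_refl, of a b t] conv_commuted[OF order_refl, of b a t] by (simp add: mult.commute)

lemma conv_integrable:
  fixes y :: "real \<Rightarrow> 'b::{banach, second_countable_topology}"
  assumes a: "set_integrable lborel {0..T} a" and y: "continuous_on {0..T} y" and t: "t \<le> T"
  shows "set_integrable lborel {0..t} (\<lambda>s. a (t - s) *\<^sub>R y s)"
proof -
  obtain B where "\<And>s. norm (indicator {0..T} s *\<^sub>R y s) \<le> B"
    "(\<lambda>s. indicator {0..T} s *\<^sub>R y s) \<in> borel_measurable borel"
    using continuous_cutoff[OF y] by metis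
  then have "integrable lborel (\<lambda>s. (indicator {0..T} (t - s) *\<^sub>R a (t - s)) *\<^sub>R (indicator {0..T} s *\<^sub>R y s))"
    using integrable_kernel_times_bounded(1)[OF a[unfolded set_integrable_def]] by blast
  also have "(\<lambda>s. (indicator {0..T} (t - s) *\<^sub>R a (t - s)) *\<^sub>R (indicator {0..T} s *\<^sub>R y s)) =
      (\<lambda>s. indicator {0..t} s *\<^sub>R a (t - s) *\<^sub>R y s)"
    using t by (auto simp: indicator_def)
  finally show ?thesis by (simp add: set_integrable_def)
qed

lemma conv_cong:
  assumes "\<And>s. 0 \<le> s \<Longrightarrow> s \<le> t \<Longrightarrow> y s = z s"
  shows "conv a y t = conv a z t"
  unfolding conv_def by (intro set_lebesgue_integral_cong) (use assms in auto)

lemma conv_cong_kernel: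
  assumes "\<And>s. 0 \<le> s \<Longrightarrow> s \<le> t \<Longrightarrow> a s = b s"
  shows "conv a y t = conv b y t"
  unfolding conv_def by (intro set_lebesgue_integral_cong) (use assms in auto)

lemma conv_add:
  fixes y z :: "real \<Rightarrow> 'b::{banach, second_countable_topology}"
  assumes "set_integrable lborel {0..T} a" "continuous_on {0..T} y" "continuous_on {0..T} z" "t \<le> T"
  shows "conv a (\<lambda>s. y s + z s) t = conv a y t + conv a z t"
  using set_integral_add(2)[OF conv_integrable[OF assms(1,2,4)] conv_integrable[OF assms(1,3,4)]]
  by (simp add: conv_def scaleR_add_right)

lemma conv_scaleR:
  fixes y :: "real \<Rightarrow> 'b::{banach, second_countable_topology}"
  shows "conv a (\<lambda>s. c *\<^sub>R y s) t = c *\<^sub>R conv a y t"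
  unfolding conv_def set_lebesgue_integral_def
  by (subst integral_scaleR_right[symmetric]) (simp add: mult_ac)

lemma conv_bounded_linear:
  fixes y :: "real \<Rightarrow> 'b::{banach, second_countable_topology}"
    and L :: "'b \<Rightarrow> 'c::{banach, second_countable_topology}"
  assumes L: "bounded_linear L"
    and "set_integrable lborel {0..T} a" "continuous_on {0..T} y" "t \<le> T"
  shows "L (conv a y t) = conv a (\<lambda>s. L (y s)) t"
  using integral_bounded_linear[OF L conv_integrable[OF assms(2-4), unfolded set_integrable_def]]
  by (simp add: conv_def set_lebesgue_integral_def linear_simps[OF L])

text \<open>
  With the roles of the factors exchanged, the time \<open>t\<close> only enters through the bounded factor \<open>y (t - s)\<close>,
  which depends continuously on \<open>t\<close> except at the jump \<open>s = t\<close> of the cutoff; dominated convergence does the rest.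
\<close>

lemma conv_continuous:
  fixes y :: "real \<Rightarrow> 'b::{banach, second_countable_topology}"
  assumes a: "set_integrable lborel {0..T} a" and y: "continuous_on {0..T} y"
  shows "continuous_on {0..T} (conv a y)"
proof -
  define ya where "ya s = indicator {0..T} s *\<^sub>R y s" for s
  define aa where "aa s = indicator {0..T} s * a s" for s
  obtain B where B: "\<And>s. norm (ya s) \<le> B" and ym: "ya \<in> borel_measurable borel"
    using continuous_cutoff[OF y] unfolding ya_def by metis
  have ai: "integrable lborel aa" using a by (simp add: aa_def[abs_def] set_integrable_def)
  note [measurable] = ym borel_measurable_integrable[OF ai]
  have eq: "conv a y t = (LBINT s. aa s *\<^sub>R ya (t - s))" if "t \<in> {0..T}" for t
    using conv_commuted[of t T a y] that by (simp add: aa_def ya_def)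
  have "(\<lambda>n. LBINT s. aa s *\<^sub>R ya (x n - s)) \<longlonglongrightarrow> (LBINT s. aa s *\<^sub>R ya (t - s))"
    if t: "t \<in> {0..T}" and x: "\<And>n. x n \<in> {0..T}" "x \<longlonglongrightarrow> t" for x t
  proof (rule integral_dominated_convergence)
    show "integrable lborel (\<lambda>s. norm (aa s) * B)" using ai by auto
    show "AE s in lborel. norm (aa s *\<^sub>R ya (x n - s)) \<le> norm (aa s) * B" for n
      by (simp add: B mult_left_mono)
    have "AE s in lborel. s \<noteq> (0::real)" "AE s in lborel. s \<noteq> t" using AE_lborel_singleton by auto
    then show "AE s in lborel. (\<lambda>n. aa s *\<^sub>R ya (x n - s)) \<longlonglongrightarrow> aa s *\<^sub>R ya (t - s)"
    proof eventually_elim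
      case (elim s)
      consider "s < 0" | "0 < s" "s < t" | "t < s" using elim by linarith
      then show ?case
      proof cases
        case 1 then show ?thesis by (simp add: aa_def)
      next
        case 2
        have "eventually (\<lambda>n. x n > s) sequentially" using x(2) 2 by (simp add: order_tendstoD)
        then have ev: "eventually (\<lambda>n. ya (x n - s) = y (x n - s)) sequentially"
          by eventually_elim (use 2 x(1) t in \<open>auto simp: ya_def indicator_def, smt (verit)\<close>)
        have "t - s \<in> {0<..<T}" using 2 t by auto
        then have "isCont y (t - s)" using y by (simp add: continuous_on_interior)
        then have "(\<lambda>n. y (x n - s)) \<longlonglongrightarrow> y (t - s)"
          by (rule isCont_tendsto_compose) (intro tendsto_intros x)
        then have "(\<lambda>n. ya (x n - s)) \<longlonglongrightarrow> y (t - s)"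
          using ev by (simp add: tendsto_cong)
        moreover have "ya (t - s) = y (t - s)" using 2 t by (simp add: ya_def)
        ultimately show ?thesis by (intro tendsto_intros) simp
      next
        case 3
        have "eventually (\<lambda>n. x n < s) sequentially" using x(2) 3 by (simp add: order_tendstoD)
        then have ev: "eventually (\<lambda>n. ya (x n - s) = 0) sequentially"
          by eventually_elim (auto simp: ya_def indicator_def)
        have "ya (t - s) = 0" using 3 by (simp add: ya_def)
        then show ?thesis using ev by (intro tendsto_intros) (simp add: tendsto_eventually)
      qed
    qed
  qed auto
  then show ?thesis
    unfolding continuous_on_sequentially by (auto simp: eq o_def)
qed

text \<open>
  The integration in \<open>r\<close> has to come first here: the other inner integral, of
  \<open>a (t - s) * b (s - r)\<close> over \<open>s\<close>, need not converge for every \<open>r\<close> when both kernels are singular.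
\<close>

lemma conv_assoc_integrable:
  fixes y :: "real \<Rightarrow> 'b::{banach, second_countable_topology}"
  assumes a: "integrable lborel a" and b: "integrable lborel b"
    and y: "y \<in> borel_measurable borel" "\<And>s. norm (y s) \<le> B"
  shows "integrable (lborel \<Otimes>\<^sub>M lborel) (\<lambda>(s, r). (a (t - s) * b (s - r)) *\<^sub>R y r)"
proof (rule lborel_pair.Fubini_integrable)
  note [measurable] = y(1) borel_measurable_integrable[OF a] borel_measurable_integrable[OF b]
  have B0: "B \<ge> 0" using y(2)[of 0] norm_ge_zero[of "y 0"] by linarith
  show "(\<lambda>(s, r). (a (t - s) * b (s - r)) *\<^sub>R y r) \<in> borel_measurable (lborel \<Otimes>\<^sub>M lborel)"
    by measurable
  have i: "integrable lborel (\<lambda>r. b (s - r) *\<^sub>R y r)" for s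
    by (rule integrable_kernel_times_bounded[OF b y])
  have i': "integrable lborel (\<lambda>r. (a (t - s) * b (s - r)) *\<^sub>R y r)" for s
    using integrable_scaleR_right[OF i[of s], of "a (t - s)"] by simp
  then show "AE s in lborel. integrable lborel (\<lambda>r. case (s, r) of (s, r) \<Rightarrow> (a (t - s) * b (s - r)) *\<^sub>R y r)"
    by simp
  let ?N = "LBINT r. norm (b r)"
  have bd: "(LBINT r. norm ((a (t - s) * b (s - r)) *\<^sub>R y r)) \<le> norm (a (t - s)) * (?N * B)" for s
  proof -
    have "(LBINT r. norm ((a (t - s) * b (s - r)) *\<^sub>R y r)) \<le> (LBINT r. norm (a (t - s)) * (norm (b (s - r)) * B))"
    proof (rule integral_mono)
      show "integrable lborel (\<lambda>r. norm (a (t - s)) * (norm (b (s - r)) * B))"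
        using integrable_reflect_shift(1)[OF b, of s] by auto
      show "norm ((a (t - s) * b (s - r)) *\<^sub>R y r) \<le> norm (a (t - s)) * (norm (b (s - r)) * B)" for r
        using y(2)[of r] by (simp add: abs_mult mult.assoc mult_left_mono)
    qed (rule integrable_norm[OF i'])
    also have "\<dots> = norm (a (t - s)) * (?N * B)"
      using integrable_reflect_shift(2)[OF integrable_norm[OF b], of s] by simp
    finally show ?thesis .
  qed
  show "integrable lborel (\<lambda>s. LBINT r. norm (case (s, r) of (s, r) \<Rightarrow> (a (t - s) * b (s - r)) *\<^sub>R y r))"
  proof (rule Bochner_Integration.integrable_bound)
    show "integrable lborel (\<lambda>s. norm (a (t - s)) * (?N * B))"
      using integrable_reflect_shift(1)[OF a, of t] by auto
    show "AE s in lborel. norm (LBINT r. norm (case (s, r) of (s, r) \<Rightarrow> (a (t - s) * b (s - r)) *\<^sub>R y r))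
        \<le> norm (norm (a (t - s)) * (?N * B))"
      using bd B0 by (auto simp: abs_mult intro: order_trans)
  qed measurable
qed

lemma conv_assoc:
  fixes y :: "real \<Rightarrow> 'b::{banach, second_countable_topology}"
  assumes a: "set_integrable lborel {0..T} a" and b: "set_integrable lborel {0..T} b"
    and y: "continuous_on {0..T} y" and t: "t \<in> {0..T}"
  shows "conv a (conv b y) t = conv (conv a b) y t"
proof -
  define ya where "ya s = indicator {0..T} s *\<^sub>R y s" for s
  define aa where "aa s = indicator {0..T} s * a s" for s
  define ba where "ba s = indicator {0..T} s * b s" for s
  obtain B where B: "\<And>s. norm (ya s) \<le> B" and ym: "ya \<in> borel_measurable borel"
    using continuous_cutoff[OF y] unfolding ya_def by metis
  have ai: "integrable lborel aa" using a by (simp add: aa_def[abs_def] set_integrable_def)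
  have bi: "integrable lborel ba" using b by (simp add: ba_def[abs_def] set_integrable_def)
  note [measurable] = ym borel_measurable_integrable[OF ai] borel_measurable_integrable[OF bi]
  have I: "integrable (lborel \<Otimes>\<^sub>M lborel) (\<lambda>(s, r). (aa (t - s) * ba (s - r)) *\<^sub>R ya r)"
    by (rule conv_assoc_integrable[OF ai bi ym B])
  \<comment> \<open>The scalar instance provides integrability of the product of kernels for almost every \<open>r\<close>,
    which is needed to move the factor \<open>y r\<close> out of the integral.\<close>
  have "integrable (lborel \<Otimes>\<^sub>M lborel) (\<lambda>(s, r). (aa (t - s) * ba (s - r)) *\<^sub>R (indicator {0..T} r :: real))"
    by (rule conv_assoc_integrable[OF ai bi, where B=1]) (auto simp: indicator_def)
  from lborel_pair.AE_integrable_snd[OF this]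
  have AE: "AE r in lborel. integrable lborel (\<lambda>s. (aa (t - s) * ba (s - r)) * indicator {0..T} r)"
    by simp
  have "conv a (conv b y) t = (LBINT s. aa (t - s) *\<^sub>R (LBINT r. ba (s - r) *\<^sub>R ya r))"
  proof -
    have "aa (t - s) *\<^sub>R (indicator {0..T} s *\<^sub>R conv b y s) = aa (t - s) *\<^sub>R (LBINT r. ba (s - r) *\<^sub>R ya r)" for s
    proof (cases "0 \<le> s \<and> s \<le> T")
      case True
      then show ?thesis using conv_cutoff[of s T b y] by (simp add: ya_def ba_def)
    next
      case False
      then consider "s < 0" | "s > T" by linarith
      then show ?thesis
      proof cases
        case 1
        have "(\<lambda>r. ba (s - r) *\<^sub>R ya r) = (\<lambda>r. 0)"
          using 1 by (auto simp: ba_def ya_def indicator_def)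
        then show ?thesis using False by simp
      next
        case 2 then show ?thesis using t by (simp add: aa_def)
      qed
    qed
    then show ?thesis using conv_cutoff[of t T a "conv b y"] t by (simp add: aa_def[symmetric])
  qed
  also have "\<dots> = (LBINT s. LBINT r. (aa (t - s) * ba (s - r)) *\<^sub>R ya r)"
    by (simp flip: integral_scaleR_right)
  also have "\<dots> = (LBINT r. LBINT s. (aa (t - s) * ba (s - r)) *\<^sub>R ya r)"
    using lborel_pair.Fubini_integral[OF I] by simp
  also have "\<dots> = (LBINT r. (indicator {0..T} (t - r) * conv a b (t - r)) *\<^sub>R ya r)"
  proof (rule integral_cong_AE)
    show "(\<lambda>r. LBINT s. (aa (t - s) * ba (s - r)) *\<^sub>R ya r) \<in> borel_measurable lborel"
      by measurable
    have "(\<lambda>r. LBINT s. (indicator {0..T} (t - r) * (aa (t - r - s) * ba s))) \<in> borel_measurable lborel"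
      by measurable
    moreover have "(LBINT s. (indicator {0..T} (t - r) * (aa (t - r - s) * ba s))) = indicator {0..T} (t - r) * conv a b (t - r)" for r
      using conv_cutoff[of "t - r" T a b] by (auto simp: aa_def ba_def indicator_def)
    ultimately have [measurable]: "(\<lambda>r. indicator {0..T} (t - r) * conv a b (t - r)) \<in> borel_measurable lborel"
      by (simp only:)
    show "(\<lambda>r. (indicator {0..T} (t - r) * conv a b (t - r)) *\<^sub>R ya r) \<in> borel_measurable lborel"
      by measurable
    show "AE r in lborel. (LBINT s. (aa (t - s) * ba (s - r)) *\<^sub>R ya r) = (indicator {0..T} (t - r) * conv a b (t - r)) *\<^sub>R ya r"
      using AE
    proof eventually_elim
      case (elim r)
      show ?case
      proof (cases "r \<in> {0..T}")
        case True
        then have "(LBINT s. (aa (t - s) * ba (s - r)) *\<^sub>R ya r) = (LBINT s. aa (t - s) * ba (s - r)) *\<^sub>R ya r"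
          using elim by (intro integral_scaleR_left) simp
        also have "(LBINT s. aa (t - s) * ba (s - r)) = (LBINT s. aa (t - r - s) * ba s)"
          by (subst lborel_integral_real_affine[of 1 _ r]) (auto simp: algebra_simps)
        also have "\<dots> = indicator {0..T} (t - r) * conv a b (t - r)"
        proof (cases "t - r \<in> {0..T}")
          case True
          then show ?thesis using conv_cutoff[of "t - r" T a b] by (simp add: aa_def ba_def)
        next
          case F: False
          then have "t - r < 0" using t True by auto
          then have "(\<lambda>s. aa (t - r - s) * ba s) = (\<lambda>s. 0)"
            by (auto simp: aa_def ba_def indicator_def)
          then show ?thesis using F by simp
        qed
        finally show ?thesis .
      qed (simp add: ya_def)
    qed
  qed
  also have "\<dots> = conv (conv a b) y t"
    using conv_cutoff[of t T "conv a b" y] t by (simp add: ya_def)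
  finally show ?thesis .
qed

section \<open>Mittag-Leffler functions and their kernels\<close>

text \<open>
  By log-convexity, \<open>ln \<Gamma>\<close> has a larger slope on \<open>[x, x + \<rho>]\<close> than on \<open>[x - 1, x]\<close>, where the slope is
  \<open>ln (x - 1)\<close>. This is the growth that makes the Mittag-Leffler series converge everywhere.
\<close>

lemma powr_mult_le_Gamma_add:
  assumes "x > 1" "\<rho> > 0"
  shows "(x - 1) powr \<rho> * Gamma x \<le> Gamma (x + \<rho> :: real)"
proof -
  let ?f = "ln \<circ> Gamma :: real \<Rightarrow> real"
  have G: "Gamma (x - 1) > 0" "Gamma x > 0" "Gamma (x + \<rho>) > 0"
    using assms by (auto intro!: Gamma_real_pos)
  have 1: "(?f (x - 1) - ?f x) / (x - 1 - x) \<le> (?f (x - 1) - ?f (x + \<rho>)) / (x - 1 - (x + \<rho>))"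
    using assms by (intro convex_on_slope_le(1)[OF log_convex_Gamma_real]) auto
  have 2: "Gamma x = (x - 1) * Gamma (x - 1)"
  proof -
    have "x - 1 \<notin> \<int>\<^sub>\<le>\<^sub>0" using assms by (auto elim!: nonpos_Ints_cases)
    from Gamma_plus1[OF this] show ?thesis by (simp only: diff_add_cancel)
  qed
  have 3: "ln (Gamma x) = ln (x - 1) + ln (Gamma (x - 1))"
    unfolding 2 using assms less_imp_neq[OF G(1)] by (subst ln_mult) (auto simp del: Gamma_eq_zero_iff)
  have "(1 + \<rho>) * ln (x - 1) \<le> ln (Gamma (x + \<rho>)) - ln (Gamma (x - 1))"
    using 1 3 assms by (simp add: field_simps)
  then have "\<rho> * ln (x - 1) + ln (Gamma x) \<le> ln (Gamma (x + \<rho>))"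
    using 3 by (simp add: algebra_simps)
  then have "ln ((x - 1) powr \<rho> * Gamma x) \<le> ln (Gamma (x + \<rho>))"
    using assms less_imp_neq[OF G(2)] by (subst ln_mult) (auto simp del: Gamma_eq_zero_iff)
  then show ?thesis
    by (rule ln_le_cancel_iff[THEN iffD1, rotated 2]) (use assms G in auto)
qed

lemma mittag_leffler_summable:
  fixes z :: real
  assumes "\<rho> > 0" "\<mu> > 0"
  shows "summable (\<lambda>n. norm (z ^ n / Gamma (\<rho> * real n + \<mu>)))"
proof -
  let ?R = "(2 * \<bar>z\<bar>) powr (1 / \<rho>)"
  obtain N where N: "real N \<ge> (?R + 1) / \<rho>" using real_arch_simple by blast
  show ?thesis
  proof (rule summable_ratio_test[of "1/2" N])
    fix n assume n: "N \<le> n"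
    let ?x = "\<rho> * real n + \<mu>"
    have "(?R + 1) / \<rho> \<le> real n" using N n by linarith
    then have x: "?x - 1 > ?R" using assms by (simp add: field_simps)
    moreover have "?R \<ge> 0" by simp
    ultimately have x1: "?x > 1" by linarith
    have G: "Gamma ?x > 0" "Gamma (?x + \<rho>) > 0" using x1 assms by (auto intro!: Gamma_real_pos)
    have "2 * \<bar>z\<bar> = ?R powr \<rho>" using assms by (simp add: powr_powr)
    also have "\<dots> \<le> (?x - 1) powr \<rho>" using x assms by (intro powr_mono2) auto
    finally have "2 * \<bar>z\<bar> * Gamma ?x \<le> (?x - 1) powr \<rho> * Gamma ?x"
      using G by (intro mult_right_mono) auto
    also have "\<dots> \<le> Gamma (?x + \<rho>)" by (rule powr_mult_le_Gamma_add[OF x1 assms(1)])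
    finally have "\<bar>z\<bar> / Gamma (?x + \<rho>) \<le> 1/2 / Gamma ?x" using G by (simp add: field_simps)
    then have "\<bar>z\<bar> ^ n * (\<bar>z\<bar> / Gamma (?x + \<rho>)) \<le> \<bar>z\<bar> ^ n * (1/2 / Gamma ?x)"
      by (rule mult_left_mono) simp
    moreover have eq: "\<rho> * real (Suc n) + \<mu> = ?x + \<rho>" by (simp add: algebra_simps)
    ultimately show "norm (norm (z ^ Suc n / Gamma (\<rho> * real (Suc n) + \<mu>))) \<le> 1/2 * norm (norm (z ^ n / Gamma ?x))"
      unfolding eq using G by (simp add: abs_mult power_abs mult_ac)
  qed simp
qed

lemma mittag_leffler_sums:
  assumes "\<rho> > 0" "\<mu> > 0"
  shows "(\<lambda>n. z ^ n / Gamma (\<rho> * real n + \<mu>)) sums mittag_leffler \<rho> \<mu> z"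
  unfolding mittag_leffler_def
  by (rule summable_sums[OF summable_norm_cancel[OF mittag_leffler_summable[OF assms]]])

lemma mittag_leffler_has_derivative_diffs:
  assumes "\<rho> > 0" "\<mu> > 0"
  shows "(mittag_leffler \<rho> \<mu> has_real_derivative
    (\<Sum>n. diffs (\<lambda>n. 1 / Gamma (\<rho> * real n + \<mu>)) n * z ^ n)) (at z)"
proof -
  have "summable (\<lambda>n. 1 / Gamma (\<rho> * real n + \<mu>) * y ^ n)" for y
    using summable_norm_cancel[OF mittag_leffler_summable[OF assms, of y]] by simp
  from termdiffs_strong_converges_everywhere[OF this] show ?thesis
    by (simp add: mittag_leffler_def[abs_def])
qed

lemma mittag_leffler_has_derivative:
  assumes "\<rho> > 0"
  shows "(mittag_leffler \<rho> 1 has_real_derivative mittag_leffler \<rho> \<rho> z / \<rho>) (at z)"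
proof -
  have "diffs (\<lambda>n. 1 / Gamma (\<rho> * real n + 1)) n * z ^ n = (z ^ n / Gamma (\<rho> * real n + \<rho>)) / \<rho>" for n
  proof -
    have "\<rho> * real n + \<rho> > 0" using assms by (simp add: add_nonneg_pos)
    then have "Gamma (\<rho> * real n + \<rho> + 1) = (\<rho> * real n + \<rho>) * Gamma (\<rho> * real n + \<rho>)"
      by (intro Gamma_plus1) (auto elim!: nonpos_Ints_cases)
    moreover have "\<rho> * real (Suc n) + 1 = \<rho> * real n + \<rho> + 1" by (simp add: algebra_simps)
    moreover have "\<rho> * real n + \<rho> = \<rho> * real (Suc n)" by (simp add: algebra_simps)
    ultimately show ?thesis using assms by (simp add: diffs_def)
  qed
  moreover have "(\<Sum>n. (z ^ n / Gamma (\<rho> * real n + \<rho>)) / \<rho>) = mittag_leffler \<rho> \<rho> z / \<rho>"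
    using sums_divide[OF mittag_leffler_sums[OF assms assms, of z], of \<rho>] by (simp add: sums_iff)
  ultimately show ?thesis
    using mittag_leffler_has_derivative_diffs[OF assms zero_less_one, of z] by simp
qed

lemma continuous_on_mittag_leffler [continuous_intros]:
  assumes "\<rho> > 0" "\<mu> > 0" "continuous_on S f"
  shows "continuous_on S (\<lambda>x. mittag_leffler \<rho> \<mu> (f x))"
proof -
  have "continuous_on UNIV (mittag_leffler \<rho> \<mu>)"
    using DERIV_isCont[OF mittag_leffler_has_derivative_diffs[OF assms(1,2)]]
    by (simp add: continuous_on_eq_continuous_at)
  then show ?thesis using assms(3) by (rule continuous_on_compose2) auto
qed

lemma mittag_leffler_0: "mittag_leffler \<rho> \<mu> 0 = 1 / Gamma \<mu>"
proof -
  have "(\<lambda>n. 0 ^ n / Gamma (\<rho> * real n + \<mu>)) = (\<lambda>n. if n = 0 then 1 / Gamma \<mu> else 0)"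
    by (auto simp: fun_eq_iff)
  then show ?thesis using sums_single[of 0 "\<lambda>n. 1 / Gamma \<mu>"] by (simp add: mittag_leffler_def sums_iff)
qed

lemma mittag_leffler_1_eq_exp: "mittag_leffler 1 1 z = exp z"
proof -
  have "Gamma (real n + 1) = fact n" for n
    using Gamma_fact[of n, where 'a=real] by (simp add: add.commute)
  then show ?thesis by (simp add: mittag_leffler_def exp_def scaleR_conv_of_real divide_inverse mult.commute)
qed

lemma mittag_leffler_recurrence:
  assumes "\<rho> > 0"
  shows "mittag_leffler \<rho> 1 z = 1 + z * mittag_leffler \<rho> (\<rho> + 1) z"
proof -
  have "(\<lambda>n. z ^ Suc n / Gamma (\<rho> * real (Suc n) + 1)) sums (mittag_leffler \<rho> 1 z - 1)"
    using mittag_leffler_sums[OF assms zero_less_one, of z]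
    by (subst sums_Suc_iff) simp
  moreover have "(\<lambda>n. z * (z ^ n / Gamma (\<rho> * real n + (\<rho> + 1)))) sums (z * mittag_leffler \<rho> (\<rho> + 1) z)"
    using assms by (intro sums_mult mittag_leffler_sums) auto
  moreover have "z ^ Suc n / Gamma (\<rho> * real (Suc n) + 1) = z * (z ^ n / Gamma (\<rho> * real n + (\<rho> + 1)))" for n
  proof -
    have "\<rho> * real (Suc n) + 1 = \<rho> * real n + (\<rho> + 1)" by (simp add: algebra_simps)
    then show ?thesis by (simp only: power_Suc times_divide_eq_right)
  qed
  ultimately have "mittag_leffler \<rho> 1 z - 1 = z * mittag_leffler \<rho> (\<rho> + 1) z"
    using sums_unique2 by (metis (no_types, lifting) ext)
  then show ?thesis by simp
qed

text \<open>
  The substitution \<open>s = t x\<close> in Euler's Beta integral.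
\<close>

lemma beta_integral:
  fixes \<alpha> \<beta> t :: real
  assumes "\<alpha> > 0" "\<beta> > 0" "t > 0"
  shows "integrable lborel (\<lambda>s. indicator {0..t} s * ((t - s) powr (\<alpha> - 1) * s powr (\<beta> - 1)))" (is ?A)
    and "(LBINT s. indicator {0..t} s * ((t - s) powr (\<alpha> - 1) * s powr (\<beta> - 1))) =
      Gamma \<alpha> * Gamma \<beta> / Gamma (\<alpha> + \<beta>) * t powr (\<alpha> + \<beta> - 1)" (is ?B)
proof -
  define f where "f x = indicator {0..1} x * (x powr (\<beta> - 1) * (1 - x) powr (\<alpha> - 1))" for x :: real
  have hi: "((\<lambda>x. x powr (\<beta> - 1) * (1 - x) powr (\<alpha> - 1)) has_integral Beta \<beta> \<alpha>) {0..1}"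
    using assms by (intro has_integral_Beta_real)
  then have "(\<lambda>x. x powr (\<beta> - 1) * (1 - x) powr (\<alpha> - 1)) absolutely_integrable_on {0..1}"
    by (intro nonnegative_absolutely_integrable_1) (auto simp: integrable_on_def)
  then have si: "set_integrable lborel {0..1} (\<lambda>x. x powr (\<beta> - 1) * (1 - x) powr (\<alpha> - 1))"
    unfolding set_integrable_def by (subst (asm) integrable_completion) auto
  then have i: "integrable lborel f" by (simp add: f_def[abs_def] set_integrable_def)
  have v: "(LBINT x. f x) = Beta \<beta> \<alpha>"
    using set_borel_integral_eq_integral(2)[OF si] hi
    by (simp add: f_def set_lebesgue_integral_def integral_unique)
  have eq: "indicator {0..t} s * ((t - s) powr (\<alpha> - 1) * s powr (\<beta> - 1)) =
    t powr (\<alpha> + \<beta> - 2) * f (0 + (1 / t) * s)" for s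
  proof (cases "0 \<le> s \<and> s \<le> t")
    case True
    have "t - s = t * (1 - s / t)" using assms by (simp add: field_simps)
    then have "(t - s) powr (\<alpha> - 1) = (t * (1 - s / t)) powr (\<alpha> - 1)" by (rule arg_cong)
    also have "\<dots> = t powr (\<alpha> - 1) * (1 - s / t) powr (\<alpha> - 1)"
      using assms True by (intro powr_mult)
    finally have 1: "(t - s) powr (\<alpha> - 1) = t powr (\<alpha> - 1) * (1 - s / t) powr (\<alpha> - 1)" .
    have "s powr (\<beta> - 1) = (t * (s / t)) powr (\<beta> - 1)"
      using assms by simp
    also have "\<dots> = t powr (\<beta> - 1) * (s / t) powr (\<beta> - 1)"
      using assms True by (intro powr_mult)
    finally have 2: "s powr (\<beta> - 1) = t powr (\<beta> - 1) * (s / t) powr (\<beta> - 1)" .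
    have 3: "t powr (\<alpha> + \<beta> - 2) = t powr (\<alpha> - 1) * t powr (\<beta> - 1)"
      by (simp flip: powr_add)
    show ?thesis unfolding f_def 1 2 3 using True assms by (simp add: field_simps)
  next
    case False
    then show ?thesis using assms by (auto simp: f_def indicator_def field_simps)
  qed
  show ?A unfolding eq using i assms by (intro integrable_mult_right lborel_integrable_real_affine) auto
  have "(LBINT x. f x) = (1 / t) * (LBINT s. f (0 + (1 / t) * s))"
    using lborel_integral_real_affine[of "1 / t" f 0] assms by simp
  then have "(LBINT s. f (0 + (1 / t) * s)) = t * Beta \<beta> \<alpha>" using v assms by (simp add: field_simps)
  then have "(LBINT s. indicator {0..t} s * ((t - s) powr (\<alpha> - 1) * s powr (\<beta> - 1))) =
      t powr (\<alpha> + \<beta> - 2) * (t * Beta \<beta> \<alpha>)" unfolding eq by simp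
  also have "\<dots> = Beta \<beta> \<alpha> * (t powr 1 * t powr (\<alpha> + \<beta> - 2))" using assms by simp
  also have "t powr 1 * t powr (\<alpha> + \<beta> - 2) = t powr (\<alpha> + \<beta> - 1)"
    by (subst powr_add[symmetric]) simp
  finally show ?B by (simp add: Beta_def mult_ac add.commute)
qed

lemma set_integrable_powr:
  fixes \<alpha> :: real
  assumes "\<alpha> > 0"
  shows "set_integrable lborel {0..T} (\<lambda>s. s powr (\<alpha> - 1))"
proof (cases "T > 0")
  case True
  have "integrable lborel (\<lambda>s. indicator {0..T} s * ((T - s) powr (1 - 1) * s powr (\<alpha> - 1)))"
    using beta_integral(1)[of 1 \<alpha> T] assms True by simp
  then show ?thesis
    unfolding set_integrable_def
  proof (rule integrable_cong_AE_imp)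
    have "AE s in lborel. s \<noteq> T" using AE_lborel_singleton by auto
    then show "AE s in lborel. indicator {0..T} s * ((T - s) powr (1 - 1) * s powr (\<alpha> - 1)) =
       indicator {0..T} s *\<^sub>R s powr (\<alpha> - 1)"
      by eventually_elim simp
  qed simp
next
  case False
  then have "(\<lambda>s. indicator {0..T} s *\<^sub>R s powr (\<alpha> - 1)) = (\<lambda>s. 0)" by (auto simp: indicator_def)
  then show ?thesis by (simp add: set_integrable_def)
qed

lemma set_integrable_mult_continuous:
  fixes a y :: "real \<Rightarrow> real"
  assumes a: "set_integrable lborel {0..T} a" and y: "continuous_on {0..T} y"
  shows "set_integrable lborel {0..T} (\<lambda>s. a s * y s)"
proof -
  obtain B where B: "B \<ge> 0" "\<And>s. norm (indicator {0..T} s *\<^sub>R y s) \<le> B"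
    and [measurable]: "(\<lambda>s. indicator {0..T} s *\<^sub>R y s) \<in> borel_measurable borel"
    using continuous_cutoff[OF y] by metis
  note a' = a[unfolded set_integrable_def]
  note [measurable] = borel_measurable_integrable[OF a']
  have "integrable lborel (\<lambda>s. (indicator {0..T} s *\<^sub>R a s) * (indicator {0..T} s *\<^sub>R y s))"
  proof (rule Bochner_Integration.integrable_bound)
    show "integrable lborel (\<lambda>s. B * (indicator {0..T} s *\<^sub>R a s))" using a' by (rule integrable_mult_right)
    have "norm (c * (indicator {0..T} s *\<^sub>R y s)) \<le> norm (B * c)" for c s
      using mult_right_mono[OF B(2)[of s], of "\<bar>c\<bar>"] B(1) by (simp add: abs_mult mult_ac)
    then show "AE s in lborel. norm ((indicator {0..T} s *\<^sub>R a s) * (indicator {0..T} s *\<^sub>R y s))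
        \<le> norm (B * (indicator {0..T} s *\<^sub>R a s))" by blast
  qed measurable
  also have "(\<lambda>s. (indicator {0..T} s *\<^sub>R a s) * (indicator {0..T} s *\<^sub>R y s)) =
     (\<lambda>s. indicator {0..T} s *\<^sub>R (a s * y s))" by (auto simp: indicator_def)
  finally show ?thesis by (simp add: set_integrable_def)
qed

text \<open>
  With \<open>c = - l\<close> this is the kernel \<open>e\<^sub>\<mu>\<close>. Because \<open>0 powr a = 0\<close>, it vanishes at \<open>0\<close> even for \<open>\<mu> = 1\<close>, where
  \<open>E\<^sub>\<rho>\<^sub>,\<^sub>1\<close> itself takes the value \<open>1\<close>; for the integrals this is immaterial, and it lets the convolution identities
  hold at \<open>t = 0\<close> too.
\<close>

definition ml_kernel :: "real \<Rightarrow> real \<Rightarrow> real \<Rightarrow> real \<Rightarrow> real" where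
  "ml_kernel \<rho> \<mu> c s = s powr (\<mu> - 1) * mittag_leffler \<rho> \<mu> (c * s powr \<rho>)"

text \<open>
  The kernel \<open>k\<^sub>\<alpha>\<close> of the Riemann-Liouville integral of order \<open>\<alpha>\<close>.
\<close>

definition powr_kernel :: "real \<Rightarrow> real \<Rightarrow> real" where
  "powr_kernel \<alpha> s = s powr (\<alpha> - 1) / Gamma \<alpha>"

lemma set_integrable_powr_kernel:
  assumes "\<alpha> > 0"
  shows "set_integrable lborel {0..T} (powr_kernel \<alpha>)"
  unfolding powr_kernel_def by (rule set_integrable_divide) (use assms in \<open>auto intro: set_integrable_powr\<close>)

lemma set_integrable_ml_kernel:
  assumes "\<rho> > 0" "\<mu> > 0"
  shows "set_integrable lborel {0..T} (ml_kernel \<rho> \<mu> c)"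
  unfolding ml_kernel_def[abs_def] using assms
  by (intro set_integrable_mult_continuous set_integrable_powr continuous_intros continuous_on_powr') auto

text \<open>
  Fractional integration raises the second index of a Mittag-Leffler kernel: every term of the series is a power,
  and convolving powers is a Beta integral. Sum and integral may be exchanged because the series of absolute values
  integrates to the same expression with \<open>\<bar>c\<bar>\<close> in place of \<open>c\<close>.
\<close>

lemma conv_powr_kernel_ml_kernel:
  assumes "\<rho> > 0" "\<mu> > 0" "\<alpha> > 0" "t > 0"
  shows "conv (powr_kernel \<alpha>) (ml_kernel \<rho> \<mu> c) t = ml_kernel \<rho> (\<alpha> + \<mu>) c t"
proof -
  define f where "f n s = (c ^ n / (Gamma \<alpha> * Gamma (\<rho> * real n + \<mu>))) *
     (indicator {0..t} s * ((t - s) powr (\<alpha> - 1) * s powr (\<rho> * real n + \<mu> - 1)))" for n s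
  define I where "I d n = t powr (\<alpha> + \<mu> - 1) * ((d * t powr \<rho>) ^ n / Gamma (\<rho> * real n + (\<alpha> + \<mu>)))" for d n
  have pos: "\<rho> * real n + \<mu> > 0" for n using assms by (simp add: add_nonneg_pos)
  have G: "Gamma \<alpha> > 0 \<and> Gamma (\<rho> * real n + \<mu>) > 0" for n
    using assms pos by (auto intro: Gamma_real_pos)
  have fi: "integrable lborel (f n)" for n
    unfolding f_def by (intro integrable_mult_right beta_integral assms pos)
  have split: "s powr (\<rho> * real n + b) = s powr b * (s powr \<rho>) ^ n" if "s > 0" for s b n
    using that by (simp add: powr_add powr_powr flip: powr_realpow)
  have val: "d ^ n / (Gamma \<alpha> * Gamma (\<rho> * real n + \<mu>)) *
      (LBINT s. indicator {0..t} s * ((t - s) powr (\<alpha> - 1) * s powr (\<rho> * real n + \<mu> - 1))) = I d n" for d n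
  proof -
    have "d ^ n / (Gamma \<alpha> * Gamma (\<rho> * real n + \<mu>)) *
      (LBINT s. indicator {0..t} s * ((t - s) powr (\<alpha> - 1) * s powr (\<rho> * real n + \<mu> - 1)))
      = d ^ n / Gamma (\<rho> * real n + (\<alpha> + \<mu>)) * t powr (\<rho> * real n + (\<alpha> + \<mu> - 1))"
      using G[of n] by (subst beta_integral(2)[OF assms(3) pos assms(4)]) (simp add: algebra_simps)
    then show ?thesis by (simp add: split[OF assms(4)] I_def power_mult_distrib)
  qed
  have "(\<lambda>n. integral\<^sup>L lborel (f n)) sums (LBINT s. \<Sum>n. f n s)"
  proof (rule sums_integral[OF fi])
    have nf: "norm (f n s) = (\<bar>c\<bar> ^ n / (Gamma \<alpha> * Gamma (\<rho> * real n + \<mu>))) *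
     (indicator {0..t} s * ((t - s) powr (\<alpha> - 1) * s powr (\<rho> * real n + \<mu> - 1)))" for n s
      using G[of n] by (simp add: f_def abs_mult power_abs indicator_def)
    have "(LBINT s. norm (f n s)) = I \<bar>c\<bar> n" for n
      unfolding nf using val[of "\<bar>c\<bar>" n] by simp
    moreover have "summable (I \<bar>c\<bar>)"
      unfolding I_def using assms
      by (intro summable_mult summable_norm_cancel[OF mittag_leffler_summable]) auto
    ultimately show "summable (\<lambda>n. LBINT s. norm (f n s))" by simp
    show "AE s in lborel. summable (\<lambda>n. norm (f n s))"
    proof (rule AE_I2)
      fix s :: real
      show "summable (\<lambda>n. norm (f n s))"
      proof (cases "0 < s \<and> s \<le> t")
        case True
        have "summable (\<lambda>n. (t - s) powr (\<alpha> - 1) * s powr (\<mu> - 1) / Gamma \<alpha> *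
           norm ((\<bar>c\<bar> * s powr \<rho>) ^ n / Gamma (\<rho> * real n + \<mu>)))"
          using assms by (intro summable_mult mittag_leffler_summable) auto
        moreover have "norm (f n s) = (t - s) powr (\<alpha> - 1) * s powr (\<mu> - 1) / Gamma \<alpha> *
           norm ((\<bar>c\<bar> * s powr \<rho>) ^ n / Gamma (\<rho> * real n + \<mu>))" for n
          unfolding nf using True G[of n] split[of s n "\<mu> - 1"]
          by (simp add: abs_mult power_mult_distrib power_abs add_diff_eq)
        ultimately show ?thesis by simp
      next
        case False
        then have "f n s = 0" for n by (auto simp: f_def indicator_def)
        then show ?thesis by simp
      qed
    qed
  qed
  moreover have "integral\<^sup>L lborel (f n) = I c n" for n
    using val[of c n] by (simp add: f_def[abs_def])
  moreover have "I c sums ml_kernel \<rho> (\<alpha> + \<mu>) c t"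
    unfolding I_def ml_kernel_def using assms by (intro sums_mult mittag_leffler_sums) auto
  ultimately have "(LBINT s. \<Sum>n. f n s) = ml_kernel \<rho> (\<alpha> + \<mu>) c t"
    using sums_unique2 by force
  moreover have "(\<Sum>n. f n s) = indicator {0..t} s *\<^sub>R (powr_kernel \<alpha> (t - s) *\<^sub>R ml_kernel \<rho> \<mu> c s)" for s
  proof (cases "0 < s \<and> s \<le> t")
    case True
    have "(\<lambda>n. (t - s) powr (\<alpha> - 1) * s powr (\<mu> - 1) / Gamma \<alpha> *
           ((c * s powr \<rho>) ^ n / Gamma (\<rho> * real n + \<mu>))) sums
       ((t - s) powr (\<alpha> - 1) * s powr (\<mu> - 1) / Gamma \<alpha> * mittag_leffler \<rho> \<mu> (c * s powr \<rho>))"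
      using assms by (intro sums_mult mittag_leffler_sums) auto
    moreover have "f n s = (t - s) powr (\<alpha> - 1) * s powr (\<mu> - 1) / Gamma \<alpha> *
           ((c * s powr \<rho>) ^ n / Gamma (\<rho> * real n + \<mu>))" for n
      using True split[of s n "\<mu> - 1"]
      by (simp add: f_def power_mult_distrib add_diff_eq)
    ultimately show ?thesis using True by (simp add: sums_iff powr_kernel_def ml_kernel_def)
  next
    case False
    then have "f n s = 0" for n by (auto simp: f_def indicator_def)
    then show ?thesis using False by (auto simp: indicator_def ml_kernel_def)
  qed
  ultimately show ?thesis by (simp add: conv_def set_lebesgue_integral_def)
qed

section \<open>Positivity of the Mittag-Leffler kernel\<close>

lemma ml_kernel_1: "t > 0 \<Longrightarrow> ml_kernel \<rho> 1 c t = mittag_leffler \<rho> 1 (c * t powr \<rho>)"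
  by (simp add: ml_kernel_def)

lemma powr_decrease:
  fixes a h t \<rho> :: real
  assumes "0 < h" "h < a" "a \<le> t" "0 < \<rho>"
  shows "a powr (-\<rho>) - (a - h) powr (-\<rho>) \<le> - (\<rho> * h * t powr (-\<rho> - 1))"
proof -
  have "\<exists>z>a - h. z < a \<and> a powr (-\<rho>) - (a - h) powr (-\<rho>) = (a - (a - h)) * (-\<rho> * z powr (-\<rho> - 1))"
  proof (rule MVT2)
    fix x assume "a - h \<le> x"
    then show "((\<lambda>x. x powr (-\<rho>)) has_real_derivative -\<rho> * x powr (-\<rho> - 1)) (at x)"
      using assms by (auto intro!: derivative_eq_intros)
  qed (use assms in auto)
  then obtain z where z: "a - h < z" "z < a"
    "a powr (-\<rho>) - (a - h) powr (-\<rho>) = (a - (a - h)) * (-\<rho> * z powr (-\<rho> - 1))" by blast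
  have "t powr (-\<rho> - 1) \<le> z powr (-\<rho> - 1)" using z assms by (intro powr_mono2') auto
  then have "\<rho> * h * t powr (-\<rho> - 1) \<le> \<rho> * h * z powr (-\<rho> - 1)"
    using assms by (intro mult_left_mono) auto
  then show ?thesis using z(3) by (simp add: mult_ac)
qed

lemma integrable_beta_ml_kernel:
  assumes "\<rho> > 0" "\<mu> > 0" "\<alpha> > 0" "t > 0"
  shows "integrable lborel (\<lambda>s. indicator {0..t} s * ((t - s) powr (\<alpha> - 1) * ml_kernel \<rho> \<mu> c s))"
proof -
  have "set_integrable lborel {0..t} (\<lambda>s. ((t - s) powr (\<alpha> - 1) * s powr (\<mu> - 1)) * mittag_leffler \<rho> \<mu> (c * s powr \<rho>))"
  proof (rule set_integrable_mult_continuous)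
    show "set_integrable lborel {0..t} (\<lambda>s. (t - s) powr (\<alpha> - 1) * s powr (\<mu> - 1))"
      using beta_integral(1)[OF assms(3,2,4)] by (simp add: set_integrable_def)
    show "continuous_on {0..t} (\<lambda>s. mittag_leffler \<rho> \<mu> (c * s powr \<rho>))"
      using assms by (intro continuous_intros continuous_on_powr') auto
  qed
  then show ?thesis by (simp add: set_integrable_def ml_kernel_def mult_ac)
qed

lemma ml_kernel_differentiable:
  assumes "\<rho> > 0" "\<mu> > 0" "t > 0"
  obtains d where "(ml_kernel \<rho> \<mu> c has_real_derivative d) (at t)"
proof -
  have 1: "((\<lambda>s. s powr a) has_real_derivative (a * t powr (a - 1))) (at t)" for a
    using assms by (auto intro!: derivative_eq_intros)
  note 2 = DERIV_chain2[OF mittag_leffler_has_derivative_diffs[OF assms(1,2)] DERIV_cmult[OF 1]]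
  show thesis
    using DERIV_mult[OF 1[of "\<mu> - 1"] 2[of c \<rho>]] that
    unfolding ml_kernel_def[abs_def] by blast
qed

lemma relaxation_has_derivative:
  assumes "\<rho> > 0" "t > 0"
  shows "((\<lambda>t. mittag_leffler \<rho> 1 (c * t powr \<rho>)) has_real_derivative c * ml_kernel \<rho> \<rho> c t) (at t)"
proof -
  have "((\<lambda>t. c * t powr \<rho>) has_real_derivative c * (\<rho> * t powr (\<rho> - 1))) (at t)"
    using assms by (auto intro!: derivative_eq_intros)
  from DERIV_chain2[OF mittag_leffler_has_derivative[OF assms(1)] this]
  show ?thesis using assms by (simp add: ml_kernel_def mult_ac)
qed

text \<open>
  For \<open>\<rho> < 1\<close> the relaxation function \<open>E\<^sub>\<rho>\<^sub>,\<^sub>1\<close> is the fractional integral of order \<open>1 - \<rho>\<close> of \<open>e\<^sub>\<rho>\<close>, while its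
  derivative is \<open>c e\<^sub>\<rho>\<close>. The tension between these two facts drives the positivity proof.
\<close>

lemma relaxation_eq_conv:
  assumes "0 < \<rho>" "\<rho> < 1" "t > 0"
  shows "mittag_leffler \<rho> 1 (c * t powr \<rho>) = conv (powr_kernel (1 - \<rho>)) (ml_kernel \<rho> \<rho> c) t"
  using conv_powr_kernel_ml_kernel[of \<rho> \<rho> "1 - \<rho>" t c] assms by (simp add: ml_kernel_1)

text \<open>
  Let \<open>r = e\<^sub>\<rho>\<close> for \<open>l = 1\<close> be positive before \<open>t0\<close> and zero at \<open>t0\<close>. On the one hand
  \<open>e = E\<^sub>\<rho>\<^sub>,\<^sub>1(- t\<^sup>\<rho>)\<close> has derivative \<open>- r(t0) = 0\<close> at \<open>t0\<close>. On the other hand \<open>\<Gamma>(1 - \<rho>) e(t)\<close> is the integral of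
  \<open>(t - s)\<^sup>-\<^sup>\<rho> r(s)\<close> over \<open>[0, t]\<close>. Passing from \<open>t0 - h\<close> to \<open>t0\<close> lowers the weight of the past values of \<open>r\<close>, a loss
  of order \<open>h\<close>, while the new piece \<open>[t0 - h, t0]\<close> contributes only \<open>O(h\<^sup>2\<^sup>-\<^sup>\<rho>)\<close>, as \<open>r\<close> vanishes at
  least linearly at \<open>t0\<close>. So the left derivative of \<open>e\<close> at \<open>t0\<close> would be negative.
\<close>

lemma ml_kernel_no_first_zero:
  assumes \<rho>: "0 < \<rho>" "\<rho> < 1" and t0: "t0 > 0"
    and pos: "\<And>s. 0 < s \<Longrightarrow> s < t0 \<Longrightarrow> ml_kernel \<rho> \<rho> (-1) s > 0"
  shows "ml_kernel \<rho> \<rho> (-1) t0 \<noteq> 0"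
proof
  define r where "r = ml_kernel \<rho> \<rho> (-1)"
  define e where "e t = mittag_leffler \<rho> 1 (- 1 * t powr \<rho>)" for t
  assume "ml_kernel \<rho> \<rho> (-1) t0 = 0"
  then have r0: "r t0 = 0" by (simp add: r_def)
  have rp: "r s > 0" if "0 < s" "s < t0" for s using pos that by (simp add: r_def)
  define G where "G = Gamma (1 - \<rho>)"
  have G: "G > 0" using \<rho> by (auto simp: G_def intro: Gamma_real_pos)
  have r_diff: "\<exists>d. (r has_real_derivative d) (at t)" if "t > 0" for t
    using ml_kernel_differentiable[of \<rho> \<rho> t "-1"] \<rho> that unfolding r_def by blast
  have N: "G * e t = (LBINT s. indicator {0..t} s * ((t - s) powr (-\<rho>) * r s))" (is ?P)
    and Ni: "integrable lborel (\<lambda>s. indicator {0..t} s * ((t - s) powr (-\<rho>) * r s))" (is ?Q)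
    if "t > 0" for t
  proof -
    show ?Q using integrable_beta_ml_kernel[of \<rho> \<rho> "1 - \<rho>" t "-1"] \<rho> that by (simp add: r_def)
    have "e t = (LBINT s. indicator {0..t} s * ((t - s) powr (-\<rho>) * r s) / G)"
      using relaxation_eq_conv[OF \<rho> that, of "-1"]
      by (simp add: e_def r_def conv_def powr_kernel_def set_lebesgue_integral_def G_def mult_ac)
    then show ?P using G by simp
  qed
  have "continuous_on {t0/4..t0/2} r"
    using r_diff t0 by (intro continuous_at_imp_continuous_on ballI) (meson DERIV_isCont atLeastAtMost_iff divide_pos_pos less_le_trans zero_less_numeral)
  then obtain s0 where s0: "s0 \<in> {t0/4..t0/2}" "\<And>s. s \<in> {t0/4..t0/2} \<Longrightarrow> r s0 \<le> r s"
    using continuous_attains_inf[of "{t0/4..t0/2}" r] t0 by auto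
  define m where "m = r s0"
  have m: "m > 0" "\<And>s. s \<in> {t0/4..t0/2} \<Longrightarrow> m \<le> r s" using s0 rp t0 by (auto simp: m_def)
  obtain r' where "(r has_real_derivative r') (at t0)" using r_diff[OF t0] by blast
  then obtain d1 where d1: "d1 > 0" "\<And>y. norm (y - t0) < d1 \<Longrightarrow> norm (r y - r t0 - r' * (y - t0)) \<le> 1 * norm (y - t0)"
    unfolding has_field_derivative_def has_derivative_at_alt by (meson zero_less_one)
  define L where "L = \<bar>r'\<bar> + 1"
  have L0: "L > 0" by (simp add: L_def)
  have L: "r s \<le> L * (t0 - s)" if "t0 - d1 < s" "s \<le> t0" for s
  proof -
    have "\<bar>r s - r' * (s - t0)\<bar> \<le> \<bar>s - t0\<bar>" using d1(2)[of s] that r0 by auto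
    then have "\<bar>r s\<bar> \<le> \<bar>r' * (s - t0)\<bar> + \<bar>s - t0\<bar>" by linarith
    moreover have "\<bar>r' * (s - t0)\<bar> = \<bar>r'\<bar> * (t0 - s)" using that by (simp add: abs_mult)
    ultimately have "r s \<le> \<bar>r'\<bar> * (t0 - s) + (t0 - s)" using that by linarith
    then show ?thesis by (simp add: L_def algebra_simps)
  qed
  \<comment> \<open>The loss is only counted on \<open>[t0/4, t0/2]\<close>, where \<open>r \<ge> m\<close>; it amounts to at least \<open>c * h\<close>.\<close>
  define c where "c = \<rho> * t0 powr (-\<rho> - 1) * m * (t0 / 4)"
  have c: "c > 0" using \<rho> t0 m by (simp add: c_def)
  have bound: "G * (e t0 - e (t0 - h)) \<le> h * (L * h powr (1 - \<rho>) - c)"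
    if h: "0 < h" "h < d1" "h < t0 / 4" for h
  proof -
    have th: "t0 - h > 0" using h by simp
    let ?b = "\<rho> * h * t0 powr (-\<rho> - 1) * m"
    have b0: "?b \<ge> 0" using \<rho> h m by simp
    have pw: "indicator {0..t0} s * ((t0 - s) powr (-\<rho>) * r s)
        - indicator {0..t0 - h} s * ((t0 - h - s) powr (-\<rho>) * r s)
      \<le> indicator {t0 - h..t0} s * (L * h powr (1 - \<rho>)) - indicator {t0/4..t0/2} s * ?b" for s
    proof -
      consider "s < 0 \<or> s > t0" | "s = 0" | "0 < s" "s < t0 - h" | "t0 - h \<le> s" "s \<le> t0" by linarith
      then show ?thesis
      proof cases
        case 1 then show ?thesis using h t0 by (auto simp: indicator_def)
      next
        case 2 then show ?thesis using h t0 by (auto simp: indicator_def r_def ml_kernel_def)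
      next
        case 3
        have "(t0 - s) powr (-\<rho>) - (t0 - s - h) powr (-\<rho>) \<le> - (\<rho> * h * t0 powr (-\<rho> - 1))"
          using 3 h \<rho> by (intro powr_decrease) auto
        then have "r s * ((t0 - s) powr (-\<rho>) - (t0 - s - h) powr (-\<rho>)) \<le> r s * (- (\<rho> * h * t0 powr (-\<rho> - 1)))"
          using rp[of s] 3 h by (intro mult_left_mono) auto
        also have "\<dots> \<le> - indicator {t0/4..t0/2} s * ?b"
        proof (cases "s \<in> {t0/4..t0/2}")
          case True
          have "(\<rho> * h * t0 powr (-\<rho> - 1)) * m \<le> (\<rho> * h * t0 powr (-\<rho> - 1)) * r s"
            using m(2)[OF True] \<rho> h by (intro mult_left_mono) auto
          then show ?thesis using True by (simp add: mult_ac)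
        next
          case False
          then show ?thesis using rp[of s] 3 h \<rho> by simp
        qed
        finally show ?thesis using 3 h by (simp add: algebra_simps)
      next
        case 4
        have "(t0 - s) powr (-\<rho>) * r s \<le> L * h powr (1 - \<rho>)"
        proof (cases "s = t0")
          case True then show ?thesis using r0 L0 by simp
        next
          case False
          have "(t0 - s) powr (-\<rho>) * r s \<le> (t0 - s) powr (-\<rho>) * (L * (t0 - s))"
            using L[of s] 4 h by (intro mult_left_mono) auto
          also have "\<dots> = L * ((t0 - s) powr (-\<rho>) * (t0 - s) powr 1)" using 4 by simp
          also have "\<dots> = L * (t0 - s) powr (1 - \<rho>)" by (subst powr_add[symmetric]) simp
          also have "\<dots> \<le> L * h powr (1 - \<rho>)"
            using 4 \<rho> L0 by (intro mult_left_mono powr_mono2) auto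
          finally show ?thesis .
        qed
        moreover have "indicator {0..t0 - h} s * ((t0 - h - s) powr (-\<rho>) * r s) = 0"
          using 4 by (auto simp: indicator_def)
        ultimately show ?thesis using 4 h by (auto simp: indicator_def)
      qed
    qed
    have "G * (e t0 - e (t0 - h)) = (LBINT s. indicator {0..t0} s * ((t0 - s) powr (-\<rho>) * r s)
        - indicator {0..t0 - h} s * ((t0 - h - s) powr (-\<rho>) * r s))"
      using Ni[OF t0] Ni[OF th] N[OF t0] N[OF th] by (simp add: algebra_simps)
    also have "\<dots> \<le> (LBINT s. indicator {t0 - h..t0} s * (L * h powr (1 - \<rho>)) - indicator {t0/4..t0/2} s * ?b)"
      using pw Ni[OF t0] Ni[OF th]
      by (intro integral_mono Bochner_Integration.integrable_diff integrable_mult_left integrable_real_indicator)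
        (auto simp: emeasure_lborel_Icc_eq)
    also have "\<dots> = h * (L * h powr (1 - \<rho>)) - t0 / 4 * ?b"
      using h t0 by (subst Bochner_Integration.integral_diff) auto
    also have "\<dots> = h * (L * h powr (1 - \<rho>) - c)" by (simp add: c_def algebra_simps)
    finally show ?thesis .
  qed
  have "(e has_real_derivative 0) (at t0)"
    using relaxation_has_derivative[of \<rho> t0 "-1"] \<rho> t0 r0 unfolding e_def[abs_def] r_def by simp
  moreover have "c / (4 * G) > 0" using c G by simp
  ultimately obtain d2 where d2: "d2 > 0" "\<And>y. norm (y - t0) < d2 \<Longrightarrow> norm (e y - e t0 - 0 * (y - t0)) \<le> c / (4 * G) * norm (y - t0)"
    unfolding has_field_derivative_def has_derivative_at_alt by meson
  \<comment> \<open>The last entry makes \<open>L * h powr (1 - \<rho>) \<le> c / 4\<close>, so that the gain is at most a quarter of the loss.\<close>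
  define h where "h = min (min (d1/2) (d2/2)) (min (t0/8) ((c / (4 * L)) powr (1 / (1 - \<rho>))))"
  have h: "0 < h" "h < d1" "h < t0 / 4" "h < d2" "h \<le> (c / (4 * L)) powr (1 / (1 - \<rho>))"
    using d1 d2 t0 c L0 by (auto simp: h_def)
  have "h powr (1 - \<rho>) \<le> ((c / (4 * L)) powr (1 / (1 - \<rho>))) powr (1 - \<rho>)"
    using h \<rho> by (intro powr_mono2) auto
  also have "\<dots> = c / (4 * L)" using \<rho> c L0 by (simp add: powr_powr)
  finally have "L * h powr (1 - \<rho>) \<le> c / 4" using L0 by (simp add: field_simps)
  then have "h * (L * h powr (1 - \<rho>) - c) \<le> h * (c / 4 - c)" using h by (intro mult_left_mono) auto
  then have "G * (e t0 - e (t0 - h)) \<le> h * (c / 4 - c)" using bound[of h] h by simp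
  moreover have "\<bar>e (t0 - h) - e t0\<bar> \<le> c / (4 * G) * h" using d2(2)[of "t0 - h"] h by simp
  then have "G * \<bar>e (t0 - h) - e t0\<bar> \<le> G * (c / (4 * G) * h)" using G by (intro mult_left_mono) auto
  then have "G * \<bar>e (t0 - h) - e t0\<bar> \<le> c / 4 * h" using G by simp
  then have "- (c / 4 * h) \<le> G * (e t0 - e (t0 - h))"
    using G by (smt (verit) mult_minus_right mult_left_mono)
  moreover have "c * h > 0" using c h by simp
  ultimately show False by (simp add: algebra_simps)
qed

text \<open>
  A nonpositive value would produce, by the intermediate value theorem and compactness, a smallest zero on the half-line.
  The change of variable \<open>x = t\<^sup>\<rho>\<close> turns it into a first zero of \<open>e\<^sub>\<rho>\<close>. For \<open>\<rho> = 1\<close> the function is the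
  exponential.
\<close>

theorem mittag_leffler_pos:
  assumes \<rho>: "0 < \<rho>" "\<rho> \<le> 1" and x: "x \<ge> 0"
  shows "mittag_leffler \<rho> \<rho> (- x) > 0"
proof (cases "\<rho> = 1")
  case True
  then show ?thesis by (simp add: mittag_leffler_1_eq_exp)
next
  case False
  with \<rho> have \<rho>1: "\<rho> < 1" by simp
  define F where "F y = mittag_leffler \<rho> \<rho> (- y)" for y
  have Fc: "continuous_on S F" for S
    unfolding F_def using \<rho> by (intro continuous_intros) auto
  have F0: "F 0 > 0" using \<rho> by (simp add: F_def mittag_leffler_0)
  show ?thesis
  proof (rule ccontr)
    assume "\<not> ?thesis"
    then have "F x \<le> 0" by (simp add: F_def)
    then have "\<exists>y\<ge>0. y \<le> x \<and> F y = 0" using IVT2'[of F x 0 0] F0 x Fc by auto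
    then have ne: "{0..x} \<inter> F -` {0} \<noteq> {}" by auto
    have "compact ({0..x} \<inter> F -` {0})"
      using continuous_closed_preimage[OF Fc[of "{0..x}"], of "{0}"]
      by (simp add: compact_eq_bounded_closed bounded_Int)
    from compact_attains_inf[OF this ne] obtain y where
      y: "y \<in> {0..x}" "F y = 0" "\<And>z. z \<in> {0..x} \<Longrightarrow> F z = 0 \<Longrightarrow> y \<le> z" by auto
    have y0: "y > 0" using y F0 by (cases "y = 0") auto
    have Fpos: "F z > 0" if z: "0 \<le> z" "z < y" for z
    proof (rule ccontr)
      assume "\<not> F z > 0"
      then obtain w where "0 \<le> w" "w \<le> z" "F w = 0"
        using IVT2'[of F z 0 0] F0 z Fc by auto
      then show False using y(3)[of w] y(1) z by auto
    qed
    define t0 where "t0 = y powr (1 / \<rho>)"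
    have t0: "t0 > 0" "t0 powr \<rho> = y" using y0 \<rho> by (auto simp: t0_def powr_powr)
    have "ml_kernel \<rho> \<rho> (-1) t0 \<noteq> 0"
    proof (rule ml_kernel_no_first_zero[OF \<rho>(1) \<rho>1 t0(1)])
      fix s assume s: "0 < s" "s < t0"
      then have "s powr \<rho> < t0 powr \<rho>" using \<rho> by (intro powr_less_mono2) auto
      then show "ml_kernel \<rho> \<rho> (-1) s > 0"
        using Fpos[of "s powr \<rho>"] s t0 by (simp add: ml_kernel_def F_def)
    qed
    then show False using y(2) t0 by (simp add: ml_kernel_def F_def)
  qed
qed

lemma ml_kernel_nonneg:
  assumes "0 < \<rho>" "\<rho> \<le> 1" "c \<le> 0"
  shows "ml_kernel \<rho> \<rho> c t \<ge> 0"
  using mittag_leffler_pos[OF assms(1,2), of "- c * t powr \<rho>"] assms(3)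
  by (simp add: ml_kernel_def mult_nonpos_nonneg)

text \<open>
  The derivative of \<open>E\<^sub>\<rho>\<^sub>,\<^sub>1(- x)\<close> is \<open>- E\<^sub>\<rho>\<^sub>,\<^sub>\<rho>(- x) / \<rho>\<close>.
\<close>

lemma relaxation_strict_decreasing:
  assumes "0 < \<rho>" "\<rho> \<le> 1" "0 \<le> x" "x < y"
  shows "mittag_leffler \<rho> 1 (- y) < mittag_leffler \<rho> 1 (- x)"
proof (rule DERIV_neg_imp_decreasing[OF assms(4)])
  fix z assume z: "x \<le> z" "z \<le> y"
  have "((\<lambda>x. mittag_leffler \<rho> 1 (- x)) has_real_derivative mittag_leffler \<rho> \<rho> (- z) / \<rho> * (- 1)) (at z)"
    by (intro DERIV_chain2[OF mittag_leffler_has_derivative[OF assms(1)]] derivative_eq_intros) auto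
  moreover have "mittag_leffler \<rho> \<rho> (- z) / \<rho> * (- 1) < 0"
    using mittag_leffler_pos[of \<rho> z] assms z by simp
  ultimately show "\<exists>d. ((\<lambda>x. mittag_leffler \<rho> 1 (- x)) has_real_derivative d) (at z) \<and> d < 0" by blast
qed

lemma relaxation_decreasing:
  assumes "0 < \<rho>" "\<rho> \<le> 1" "0 \<le> x" "x \<le> y"
  shows "mittag_leffler \<rho> 1 (- y) \<le> mittag_leffler \<rho> 1 (- x)"
  using relaxation_strict_decreasing[of \<rho> x y] assms by (cases "x = y") auto

lemma relaxation_le_1:
  assumes "0 < \<rho>" "\<rho> \<le> 1" "0 \<le> x"
  shows "mittag_leffler \<rho> 1 (- x) \<le> 1"
  using relaxation_decreasing[of \<rho> 0 x] assms by (simp add: mittag_leffler_0)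

text \<open>
  For \<open>\<rho> < 1\<close> the relaxation function is a fractional integral of the nonnegative function \<open>e\<^sub>\<rho>\<close>.
\<close>

lemma relaxation_nonneg:
  assumes "0 < \<rho>" "\<rho> \<le> 1" "0 \<le> x"
  shows "mittag_leffler \<rho> 1 (- x) \<ge> 0"
proof -
  consider "\<rho> = 1" | "x = 0" | "\<rho> < 1" "x > 0" using assms by linarith
  then show ?thesis
  proof cases
    case 1 then show ?thesis by (simp add: mittag_leffler_1_eq_exp)
  next
    case 2 then show ?thesis by (simp add: mittag_leffler_0)
  next
    case 3
    have "mittag_leffler \<rho> 1 (- x * 1 powr \<rho>) = conv (powr_kernel (1 - \<rho>)) (ml_kernel \<rho> \<rho> (- x)) 1"
      by (rule relaxation_eq_conv) (use 3 assms in auto)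
    moreover have "\<dots> \<ge> 0"
      unfolding conv_def set_lebesgue_integral_def
      using assms 3 by (intro integral_nonneg_AE AE_I2) (auto simp: ml_kernel_nonneg powr_kernel_def indicator_def intro!: mult_nonneg_nonneg Gamma_real_nonneg less_imp_le[OF Gamma_real_pos])
    ultimately show ?thesis by simp
  qed
qed

section \<open>The scalar fractional relaxation equation\<close>

lemma conv_powr_kernel_1:
  assumes "set_borel_measurable lborel {0..t} y"
  shows "conv (powr_kernel 1) y t = (LBINT s:{0..t}. y s)"
proof -
  have m: "set_borel_measurable lborel {0..t} (\<lambda>s. powr_kernel 1 (t - s) *\<^sub>R y s)"
  proof -
    have "(\<lambda>s. powr_kernel 1 (t - s) *\<^sub>R (indicator {0..t} s *\<^sub>R y s)) \<in> borel_measurable lborel"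
      using assms unfolding set_borel_measurable_def powr_kernel_def by measurable
    then show ?thesis by (simp add: set_borel_measurable_def mult.commute)
  qed
  have "conv (powr_kernel 1) y t = conv (\<lambda>_. 1) y t"
    by (rule conv_cong_AE[OF m]) (use assms in \<open>auto simp: powr_kernel_def\<close>)
  then show ?thesis by (simp add: conv_def)
qed

lemma set_borel_measurable_continuous_on:
  fixes y :: "real \<Rightarrow> 'b::{banach, second_countable_topology}"
  assumes "continuous_on {0..T} y" "t \<le> T"
  shows "set_borel_measurable lborel {0..t} y"
  using borel_measurable_continuous_on_indicator[OF _ continuous_on_subset[OF assms(1)], of "{0..t}"] assms(2)
  by (auto simp: set_borel_measurable_def)

lemma conv_powr_kernel_1_eq_integral:
  fixes y :: "real \<Rightarrow> 'b::euclidean_space"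
  assumes "continuous_on {0..T} y" "t \<le> T"
  shows "conv (powr_kernel 1) y t = integral {0..t} y"
proof -
  have "set_integrable lborel {0..t} y"
    unfolding set_integrable_def using assms
    by (intro borel_integrable_compact continuous_on_subset[OF assms(1)]) auto
  from set_borel_integral_eq_integral(2)[OF this] show ?thesis
    using conv_powr_kernel_1[OF set_borel_measurable_continuous_on[OF assms]] by simp
qed

lemma conv_ml_kernel:
  assumes "\<rho> > 0" "\<mu> > 0" "\<alpha> > 0" "t \<ge> 0"
  shows "conv (powr_kernel \<alpha>) (ml_kernel \<rho> \<mu> c) t = ml_kernel \<rho> (\<alpha> + \<mu>) c t"
  using conv_powr_kernel_ml_kernel[OF assms(1-3)] assms(4)
  by (cases "t = 0") (auto simp: ml_kernel_def)

text \<open>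
  Integrated form of the differential equation: \<open>e\<^sub>1 = 1 + c (1 * e\<^sub>\<rho>)\<close>, the primitive of \<open>e\<^sub>\<rho>\<close> being
  \<open>e\<^sub>1\<^sub>+\<^sub>\<rho>\<close>.
\<close>

lemma ml_kernel_recurrence:
  assumes "\<rho> > 0"
  shows "ml_kernel \<rho> 1 c t = powr_kernel 1 t + c * ml_kernel \<rho> (1 + \<rho>) c t"
proof (cases "t = 0")
  case False
  then show ?thesis
    using mittag_leffler_recurrence[OF assms, of "c * t powr \<rho>"]
    by (simp add: ml_kernel_def powr_kernel_def algebra_simps)
qed (simp add: ml_kernel_def powr_kernel_def)

lemma relaxation_recurrence:
  assumes "\<rho> > 0" "t \<ge> 0"
  shows "mittag_leffler \<rho> 1 (c * t powr \<rho>) = 1 + c * ml_kernel \<rho> (1 + \<rho>) c t"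
  using mittag_leffler_recurrence[OF assms(1), of "c * t powr \<rho>"]
  by (simp add: ml_kernel_def algebra_simps)

lemma set_borel_measurable_ml_kernel:
  assumes "\<rho> > 0" "\<mu> > 0"
  shows "set_borel_measurable lborel {0..T} (ml_kernel \<rho> \<mu> c)"
  using borel_measurable_integrable[OF set_integrable_ml_kernel[OF assms, of T c, unfolded set_integrable_def]]
  by (simp add: set_borel_measurable_def)

lemma conv_ml_kernel_const:
  fixes x :: "'b::{banach, second_countable_topology}"
  assumes "\<rho> > 0" "\<mu> > 0" "t \<ge> 0"
  shows "conv (ml_kernel \<rho> \<mu> c) (\<lambda>_. x) t = ml_kernel \<rho> (1 + \<mu>) c t *\<^sub>R x"
proof -
  have i: "set_integrable lborel {0..t} (\<lambda>s. ml_kernel \<rho> \<mu> c (t - s))"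
    using conv_integrable[OF set_integrable_ml_kernel[OF assms(1,2)], of t "\<lambda>_. 1::real" t c] by simp
  have "conv (ml_kernel \<rho> \<mu> c) (\<lambda>_. x) t = conv (ml_kernel \<rho> \<mu> c) (\<lambda>_. 1::real) t *\<^sub>R x"
    using integral_scaleR_left[of x lborel "\<lambda>s. indicator {0..t} s *\<^sub>R ml_kernel \<rho> \<mu> c (t - s)"] i
    by (simp add: conv_def set_lebesgue_integral_def set_integrable_def)
  also have "conv (ml_kernel \<rho> \<mu> c) (\<lambda>_. 1) t = conv (\<lambda>_. 1) (ml_kernel \<rho> \<mu> c) t"
    by (rule conv_commute)
  also have "\<dots> = conv (powr_kernel 1) (ml_kernel \<rho> \<mu> c) t"
    using conv_powr_kernel_1[OF set_borel_measurable_ml_kernel[OF assms(1,2)]]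
    by (simp add: conv_def[of "\<lambda>_. 1"])
  also have "\<dots> = ml_kernel \<rho> (1 + \<mu>) c t" using conv_ml_kernel[of \<rho> \<mu> 1 t c] assms by simp
  finally show ?thesis .
qed

text \<open>
  The fractional integral of the complementary order \<open>1 - \<rho>\<close>, which is the identity for \<open>\<rho> = 1\<close>. With this
  convention the Caputo derivative is the ordinary derivative of \<open>frac_compl \<rho> (y - y 0)\<close> for all \<open>\<rho>\<close>, so that the cases
  \<open>\<rho> < 1\<close> and \<open>\<rho> = 1\<close> can be treated together.
\<close>

definition frac_compl :: "real \<Rightarrow> (real \<Rightarrow> 'b) \<Rightarrow> real \<Rightarrow> 'b::{banach, second_countable_topology}" where
  "frac_compl \<rho> z t = (if \<rho> = 1 then z t else frac_integral (1 - \<rho>) z t)"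

lemma frac_compl_1 [simp]: "frac_compl 1 z t = z t"
  by (simp add: frac_compl_def)

lemma frac_compl_eq_conv: "\<rho> < 1 \<Longrightarrow> frac_compl \<rho> z t = conv (powr_kernel (1 - \<rho>)) z t"
  unfolding frac_compl_def frac_integral_def conv_def powr_kernel_def
  by (simp flip: set_integral_scaleR_right)

lemma has_caputo_deriv_iff:
  "has_caputo_deriv \<rho> T y d t \<longleftrightarrow>
    ((\<lambda>s. frac_compl \<rho> (\<lambda>\<xi>. y \<xi> - y 0) s) has_vector_derivative d) (at t within {0..T})"
proof (cases "\<rho> = 1")
  case True
  have "((\<lambda>s. y s - y 0) has_vector_derivative d) (at t within {0..T})
      \<longleftrightarrow> (y has_vector_derivative d) (at t within {0..T})"
  proof
    assume "((\<lambda>s. y s - y 0) has_vector_derivative d) (at t within {0..T})"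
    from has_vector_derivative_add[OF this has_vector_derivative_const[of "y 0"]]
    show "(y has_vector_derivative d) (at t within {0..T})" by simp
  next
    assume "(y has_vector_derivative d) (at t within {0..T})"
    from has_vector_derivative_diff[OF this has_vector_derivative_const[of "y 0"]]
    show "((\<lambda>s. y s - y 0) has_vector_derivative d) (at t within {0..T})" by simp
  qed
  then show ?thesis using True by (simp add: has_caputo_deriv_def)
qed (simp add: has_caputo_deriv_def frac_compl_def)

lemma frac_compl_continuous:
  fixes z :: "real \<Rightarrow> 'b::{banach, second_countable_topology}"
  assumes "\<rho> \<le> 1" "continuous_on {0..T} z"
  shows "continuous_on {0..T} (frac_compl \<rho> z)"
proof (cases "\<rho> = 1")
  case True
  then have "frac_compl \<rho> z = z" by auto
  then show ?thesis using assms by simp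
next
  case False
  then have "frac_compl \<rho> z = conv (powr_kernel (1 - \<rho>)) z" using assms by (auto simp: frac_compl_eq_conv)
  then show ?thesis
    using conv_continuous[OF set_integrable_powr_kernel[of "1 - \<rho>" T] assms(2)] False assms(1) by simp
qed

lemma frac_compl_bounded_linear:
  fixes z :: "real \<Rightarrow> 'b::{banach, second_countable_topology}"
    and L :: "'b \<Rightarrow> 'c::{banach, second_countable_topology}"
  assumes "\<rho> \<le> 1" "continuous_on {0..T} z" "t \<le> T" "bounded_linear L"
  shows "L (frac_compl \<rho> z t) = frac_compl \<rho> (\<lambda>s. L (z s)) t"
proof (cases "\<rho> = 1")
  case False
  then show ?thesis
    using conv_bounded_linear[OF assms(4) set_integrable_powr_kernel[of "1 - \<rho>" T] assms(2,3)] assms(1)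
    by (simp add: frac_compl_eq_conv)
qed simp

lemma frac_compl_0: "\<rho> \<le> 1 \<Longrightarrow> z 0 = 0 \<Longrightarrow> frac_compl \<rho> z 0 = 0"
  by (cases "\<rho> = 1") (simp_all add: frac_compl_eq_conv)

text \<open>
  The kernel of the composition is \<open>k\<^sub>1\<^sub>-\<^sub>\<rho> * e\<^sub>\<rho> = e\<^sub>1\<close>, in either order.
\<close>

lemma frac_compl_conv_ml_kernel:
  fixes z :: "real \<Rightarrow> 'b::{banach, second_countable_topology}"
  assumes \<rho>: "0 < \<rho>" "\<rho> \<le> 1" and z: "continuous_on {0..T} z" and t: "t \<in> {0..T}"
  shows "frac_compl \<rho> (conv (ml_kernel \<rho> \<rho> c) z) t = conv (ml_kernel \<rho> 1 c) z t"
    and "conv (ml_kernel \<rho> \<rho> c) (frac_compl \<rho> z) t = conv (ml_kernel \<rho> 1 c) z t"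
proof -
  have *: "frac_compl \<rho> (conv (ml_kernel \<rho> \<rho> c) z) t = conv (ml_kernel \<rho> 1 c) z t \<and>
    conv (ml_kernel \<rho> \<rho> c) (frac_compl \<rho> z) t = conv (ml_kernel \<rho> 1 c) z t"
  proof (cases "\<rho> = 1")
    case True
    then have "frac_compl \<rho> z = z" by auto
    then show ?thesis using True by simp
  next
    case False
    then have \<rho>1: "1 - \<rho> > 0" "\<rho> < 1" using \<rho> by auto
    note i = set_integrable_powr_kernel[OF \<rho>1(1), of T] set_integrable_ml_kernel[OF \<rho>(1) \<rho>(1), of T c]
    have k: "conv (powr_kernel (1 - \<rho>)) (ml_kernel \<rho> \<rho> c) s = ml_kernel \<rho> 1 c s" if "0 \<le> s" for s
      using conv_ml_kernel[of \<rho> \<rho> "1 - \<rho>" s c] \<rho> \<rho>1 that by simp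
    have "frac_compl \<rho> z = conv (powr_kernel (1 - \<rho>)) z" using \<rho>1 by (auto simp: frac_compl_eq_conv)
    then show ?thesis
      using conv_assoc[OF i z t] conv_assoc[OF i(2,1) z t]
      by (auto simp: frac_compl_eq_conv \<rho>1 conv_commute[of "ml_kernel \<rho> \<rho> c" "powr_kernel (1 - \<rho>)"] k
          intro!: conv_cong_kernel)
  qed
  then show "frac_compl \<rho> (conv (ml_kernel \<rho> \<rho> c) z) t = conv (ml_kernel \<rho> 1 c) z t"
    and "conv (ml_kernel \<rho> \<rho> c) (frac_compl \<rho> z) t = conv (ml_kernel \<rho> 1 c) z t" by auto
qed

lemma conv_powr_kernel_1_conv_ml_kernel:
  fixes z :: "real \<Rightarrow> 'b::{banach, second_countable_topology}"
  assumes \<rho>: "0 < \<rho>" and z: "continuous_on {0..T} z" and t: "t \<in> {0..T}"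
  shows "conv (powr_kernel 1) (conv (ml_kernel \<rho> \<rho> c) z) t = conv (ml_kernel \<rho> (1 + \<rho>) c) z t" (is ?A)
    and "conv (ml_kernel \<rho> \<rho> c) (conv (powr_kernel 1) z) t = conv (ml_kernel \<rho> (1 + \<rho>) c) z t" (is ?B)
proof -
  note i = set_integrable_powr_kernel[OF zero_less_one, of T] set_integrable_ml_kernel[OF \<rho> \<rho>, of T c]
  have k: "conv (powr_kernel 1) (ml_kernel \<rho> \<rho> c) s = ml_kernel \<rho> (1 + \<rho>) c s" if "0 \<le> s" for s
    using conv_ml_kernel[of \<rho> \<rho> 1 s c] \<rho> that by simp
  show ?A ?B
    unfolding conv_assoc[OF i z t] conv_assoc[OF i(2,1) z t]
    by (auto simp: conv_commute[of "ml_kernel \<rho> \<rho> c" "powr_kernel 1"] k intro!: conv_cong_kernel)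
qed

lemma conv_ml_kernel_1_recurrence:
  fixes z :: "real \<Rightarrow> 'b::{banach, second_countable_topology}"
  assumes \<rho>: "0 < \<rho>" and z: "continuous_on {0..T} z" and t: "t \<in> {0..T}"
  shows "conv (ml_kernel \<rho> 1 c) z t =
    conv (powr_kernel 1) z t + c *\<^sub>R conv (ml_kernel \<rho> (1 + \<rho>) c) z t"
proof -
  have "set_integrable lborel {0..t} (\<lambda>s. powr_kernel 1 (t - s) *\<^sub>R z s)"
    using t by (intro conv_integrable[OF set_integrable_powr_kernel z]) auto
  moreover have "set_integrable lborel {0..t} (\<lambda>s. ml_kernel \<rho> (1 + \<rho>) c (t - s) *\<^sub>R z s)"
    using t \<rho> by (intro conv_integrable[OF set_integrable_ml_kernel z]) auto
  ultimately have "conv (\<lambda>s. powr_kernel 1 s + c * ml_kernel \<rho> (1 + \<rho>) c s) z t =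
      conv (powr_kernel 1) z t + c *\<^sub>R conv (ml_kernel \<rho> (1 + \<rho>) c) z t"
    unfolding conv_def
    by (simp add: scaleR_add_left set_integral_add set_integral_scaleR_right flip: scaleR_scaleR)
  then show ?thesis using ml_kernel_recurrence[OF \<rho>, of c] by (simp add: conv_def)
qed

text \<open>
  Duhamel's formula: \<open>z = e\<^sub>\<rho> * h\<close> solves \<open>D\<^sup>\<rho> z = h + c z\<close> with \<open>z 0 = 0\<close>, in integrated form. Both sides equal
  \<open>e\<^sub>1 * h\<close>: the left one since \<open>k\<^sub>1\<^sub>-\<^sub>\<rho> * e\<^sub>\<rho> = e\<^sub>1\<close>, the right one since \<open>e\<^sub>1 = 1 + c (1 * e\<^sub>\<rho>)\<close>.
\<close>

theorem frac_compl_duhamel: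
  fixes h :: "real \<Rightarrow> 'b::{banach, second_countable_topology}"
  assumes \<rho>: "0 < \<rho>" "\<rho> \<le> 1" and h: "continuous_on {0..T} h" and t: "t \<in> {0..T}"
  shows "frac_compl \<rho> (conv (ml_kernel \<rho> \<rho> c) h) t =
    conv (powr_kernel 1) (\<lambda>s. h s + c *\<^sub>R conv (ml_kernel \<rho> \<rho> c) h s) t"
proof -
  let ?z = "conv (ml_kernel \<rho> \<rho> c) h"
  have z: "continuous_on {0..T} ?z"
    by (rule conv_continuous[OF set_integrable_ml_kernel[OF \<rho>(1) \<rho>(1)] h])
  have "conv (powr_kernel 1) (\<lambda>s. h s + c *\<^sub>R ?z s) t =
      conv (powr_kernel 1) h t + c *\<^sub>R conv (powr_kernel 1) ?z t"
    using t h z by (subst conv_add[OF set_integrable_powr_kernel]) (auto simp: conv_scaleR intro!: continuous_intros)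
  then show ?thesis
    by (simp add: frac_compl_conv_ml_kernel[OF \<rho> h t] conv_ml_kernel_1_recurrence[OF \<rho>(1) h t]
        conv_powr_kernel_1_conv_ml_kernel[OF \<rho>(1) h t])
qed

text \<open>
  Convolving the equation with \<open>e\<^sub>\<rho>\<close> turns its left side into \<open>e\<^sub>1 * z = 1 * z + c (e\<^sub>1\<^sub>+\<^sub>\<rho> * z)\<close> and its right side into
  \<open>e\<^sub>1\<^sub>+\<^sub>\<rho> * h + c (e\<^sub>1\<^sub>+\<^sub>\<rho> * z)\<close>. The terms with \<open>c\<close> cancel, leaving \<open>1 * z = 1 * (e\<^sub>\<rho> * h)\<close>, and
  continuous functions with equal primitives agree.
\<close>

theorem frac_compl_duhamel_unique:
  fixes h z :: "real \<Rightarrow> 'b::euclidean_space"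
  assumes \<rho>: "0 < \<rho>" "\<rho> \<le> 1" and T: "0 < T"
    and h: "continuous_on {0..T} h" and z: "continuous_on {0..T} z"
    and eq: "\<And>t. t \<in> {0..T} \<Longrightarrow> frac_compl \<rho> z t = conv (powr_kernel 1) (\<lambda>s. h s + c *\<^sub>R z s) t"
    and t: "t \<in> {0..T}"
  shows "z t = conv (ml_kernel \<rho> \<rho> c) h t"
proof -
  let ?k = "ml_kernel \<rho> \<rho> c" and ?I = "conv (powr_kernel 1)"
  have ki: "set_integrable lborel {0..T} ?k" by (rule set_integrable_ml_kernel[OF \<rho>(1) \<rho>(1)])
  have kh: "continuous_on {0..T} (conv ?k h)" by (rule conv_continuous[OF ki h])
  have hz: "continuous_on {0..T} (\<lambda>s. h s + c *\<^sub>R z s)" using h z by (intro continuous_intros)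
  have "?I z t = ?I (conv ?k h) t" if t: "t \<in> {0..T}" for t
  proof -
    have "?I z t + c *\<^sub>R conv (ml_kernel \<rho> (1 + \<rho>) c) z t = conv (ml_kernel \<rho> 1 c) z t"
      using conv_ml_kernel_1_recurrence[OF \<rho>(1) z t] by simp
    also have "\<dots> = conv ?k (frac_compl \<rho> z) t" using frac_compl_conv_ml_kernel(2)[OF \<rho> z t] by simp
    also have "\<dots> = conv ?k (?I (\<lambda>s. h s + c *\<^sub>R z s)) t"
      using t by (intro conv_cong eq) auto
    also have "\<dots> = conv (ml_kernel \<rho> (1 + \<rho>) c) (\<lambda>s. h s + c *\<^sub>R z s) t"
      by (rule conv_powr_kernel_1_conv_ml_kernel(2)[OF \<rho>(1) hz t])
    also have "\<dots> = conv (ml_kernel \<rho> (1 + \<rho>) c) h t + c *\<^sub>R conv (ml_kernel \<rho> (1 + \<rho>) c) z t"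
      using t h z \<rho> by (subst conv_add[OF set_integrable_ml_kernel]) (auto simp: conv_scaleR intro!: continuous_intros)
    also have "conv (ml_kernel \<rho> (1 + \<rho>) c) h t = ?I (conv ?k h) t"
      using conv_powr_kernel_1_conv_ml_kernel(1)[OF \<rho>(1) h t] by simp
    finally show ?thesis by simp
  qed
  then have I: "integral {0..t} z = integral {0..t} (conv ?k h)" if "t \<in> {0..T}" for t
    using conv_powr_kernel_1_eq_integral[OF z] conv_powr_kernel_1_eq_integral[OF kh] that by auto
  have 1: "((\<lambda>u. integral {0..u} z) has_vector_derivative z t) (at t within {0..T})"
    by (rule integral_has_vector_derivative[OF z t])
  have 2: "((\<lambda>u. integral {0..u} z) has_vector_derivative conv ?k h t) (at t within {0..T})"
    by (rule has_vector_derivative_transform[OF t I integral_has_vector_derivative[OF kh t]])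
  show ?thesis
    using vector_derivative_unique_within_closed_interval[of 0 T t _ "z t" "conv ?k h t"] T t 1 2
    by (simp add: cbox_interval)
qed

lemma q_coeff_eq_conv: "q_coeff \<rho> g l t = conv (ml_kernel \<rho> \<rho> (- l)) g t"
  by (simp add: q_coeff_def conv_def ml_kernel_def mult.assoc)

lemma p_coeff_eq_conv: "p_coeff \<rho> g l T = conv (ml_kernel \<rho> (1 + \<rho>) (- l)) g T"
  by (simp add: p_coeff_def conv_def ml_kernel_def mult_ac add.commute)

section \<open>Estimates uniform in the eigenvalue\<close>

lemma conv_mono:
  fixes y z :: "real \<Rightarrow> real"
  assumes "set_integrable lborel {0..T} a" "continuous_on {0..T} y" "continuous_on {0..T} z" "t \<le> T"
    and "\<And>s. 0 \<le> s \<Longrightarrow> s \<le> t \<Longrightarrow> a s \<ge> 0" "\<And>s. 0 \<le> s \<Longrightarrow> s \<le> t \<Longrightarrow> y s \<le> z s"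
  shows "conv a y t \<le> conv a z t"
  unfolding conv_def
  using conv_integrable[OF assms(1,2,4)] conv_integrable[OF assms(1,3,4)] assms(5,6)
  by (intro set_integral_mono) (auto intro!: mult_left_mono)

text \<open>
  The identity behind the bounds: \<open>l\<close> times the primitive of \<open>e\<^sub>\<rho>\<close> equals \<open>1 - E\<^sub>\<rho>\<^sub>,\<^sub>1(- l t\<^sup>\<rho>)\<close>, which for
  \<open>\<rho> \<le> 1\<close> lies in \<open>[0, 1]\<close> for all \<open>l > 0\<close> alike.
\<close>

lemma one_minus_relaxation:
  assumes "\<rho> > 0" "t \<ge> 0"
  shows "l * ml_kernel \<rho> (1 + \<rho>) (- l) t = 1 - mittag_leffler \<rho> 1 (- l * t powr \<rho>)"
  using relaxation_recurrence[OF assms, of "- l"] by simp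

lemma relaxation_bounds:
  assumes "0 < \<rho>" "\<rho> \<le> 1" "0 \<le> l"
  shows "0 \<le> mittag_leffler \<rho> 1 (- l * t powr \<rho>)" "mittag_leffler \<rho> 1 (- l * t powr \<rho>) \<le> 1"
  using relaxation_nonneg[of \<rho> "l * t powr \<rho>"] relaxation_le_1[of \<rho> "l * t powr \<rho>"] assms by auto

lemma continuous_on_relaxation:
  assumes "\<rho> > 0"
  shows "continuous_on {0..T} (\<lambda>t. mittag_leffler \<rho> 1 (c * t powr \<rho>))"
  using assms by (intro continuous_intros continuous_on_powr') auto

lemma ml_kernel_primitive_bounds:
  assumes "0 < \<rho>" "\<rho> \<le> 1" "0 < l" "t \<ge> 0"
  shows "0 \<le> ml_kernel \<rho> (1 + \<rho>) (- l) t" "l * ml_kernel \<rho> (1 + \<rho>) (- l) t \<le> 1"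
proof -
  show "l * ml_kernel \<rho> (1 + \<rho>) (- l) t \<le> 1"
    using one_minus_relaxation[of \<rho> t l] relaxation_bounds[of \<rho> l t] assms by simp
  have "0 \<le> l * ml_kernel \<rho> (1 + \<rho>) (- l) t"
    using one_minus_relaxation[of \<rho> t l] relaxation_bounds[of \<rho> l t] assms by simp
  then show "0 \<le> ml_kernel \<rho> (1 + \<rho>) (- l) t" using assms by (simp add: zero_le_mult_iff)
qed

text \<open>
  \<open>q = e\<^sub>\<rho> * g\<close> with \<open>e\<^sub>\<rho> \<ge> 0\<close>, and \<open>l\<close> times the total mass of \<open>e\<^sub>\<rho>\<close> is at most \<open>1\<close>.
\<close>

lemma q_coeff_bound:
  assumes "0 < \<rho>" "\<rho> \<le> 1" "0 < l" and g: "continuous_on {0..T} g"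
    and G: "\<And>s. s \<in> {0..T} \<Longrightarrow> \<bar>g s\<bar> \<le> G" and t: "t \<in> {0..T}"
  shows "l * \<bar>q_coeff \<rho> g l t\<bar> \<le> G"
proof -
  let ?k = "ml_kernel \<rho> \<rho> (- l)"
  have k: "set_integrable lborel {0..T} ?k" by (rule set_integrable_ml_kernel[OF assms(1,1)])
  have kn: "?k s \<ge> 0" for s using ml_kernel_nonneg[of \<rho> "- l" s] assms by simp
  have G0: "G \<ge> 0" using G[OF t] by linarith
  have b: "conv ?k h t \<le> G / l" if "continuous_on {0..T} h" "\<And>s. s \<in> {0..T} \<Longrightarrow> h s \<le> G" for h
  proof -
    have "conv ?k h t \<le> conv ?k (\<lambda>_. G) t"
      using that t kn by (intro conv_mono[OF k]) auto
    also have "\<dots> = ml_kernel \<rho> (1 + \<rho>) (- l) t * G"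
      using conv_ml_kernel_const[of \<rho> \<rho> t "- l" G] assms t by simp
    also have "\<dots> \<le> 1 / l * G"
      using ml_kernel_primitive_bounds(2)[of \<rho> l t] assms t G0
      by (intro mult_right_mono) (auto simp: field_simps)
    finally show ?thesis by simp
  qed
  have "conv ?k g t \<le> G / l" by (rule b[OF g]) (use G in force)
  moreover have "conv ?k (\<lambda>s. (- 1) *\<^sub>R g s) t \<le> G / l"
    by (rule b) (use G in \<open>force intro!: continuous_intros g\<close>)+
  ultimately show ?thesis
    unfolding q_coeff_eq_conv conv_scaleR using assms by (simp add: abs_le_iff field_simps)
qed

lemma relaxation_integral:
  assumes "0 < \<rho>" "t \<ge> 0"
  shows "(LBINT s:{0..t}. mittag_leffler \<rho> 1 (c * s powr \<rho>)) = t * mittag_leffler \<rho> 2 (c * t powr \<rho>)"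
proof -
  have "(LBINT s:{0..t}. mittag_leffler \<rho> 1 (c * s powr \<rho>)) = conv (powr_kernel 1) (\<lambda>s. mittag_leffler \<rho> 1 (c * s powr \<rho>)) t"
    using conv_powr_kernel_1[OF set_borel_measurable_continuous_on[OF continuous_on_relaxation[OF assms(1)] order_refl]] by simp
  also have "\<dots> = conv (powr_kernel 1) (ml_kernel \<rho> 1 c) t"
  proof (rule conv_cong_AE)
    show "set_borel_measurable lborel {0..t} (\<lambda>s. powr_kernel 1 (t - s) *\<^sub>R mittag_leffler \<rho> 1 (c * s powr \<rho>))"
      using borel_measurable_integrable[OF conv_integrable[OF set_integrable_powr_kernel
        continuous_on_relaxation[OF assms(1)] order_refl, of 1 t c, unfolded set_integrable_def]]
      by (simp add: set_borel_measurable_def)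
    show "set_borel_measurable lborel {0..t} (\<lambda>s. powr_kernel 1 (t - s) *\<^sub>R ml_kernel \<rho> 1 c s)"
    proof -
      have "(\<lambda>s. powr_kernel 1 (t - s) * (indicator {0..t} s *\<^sub>R ml_kernel \<rho> 1 c s)) \<in> borel_measurable lborel"
        using set_borel_measurable_ml_kernel[OF assms(1) zero_less_one, of t c]
        unfolding set_borel_measurable_def powr_kernel_def by measurable
      then show ?thesis by (simp add: set_borel_measurable_def mult_ac)
    qed
  qed (auto simp: ml_kernel_1)
  also have "\<dots> = ml_kernel \<rho> 2 c t" using conv_ml_kernel[of \<rho> 1 1 t c] assms by simp
  also have "\<dots> = t * mittag_leffler \<rho> 2 (c * t powr \<rho>)" using assms by (simp add: ml_kernel_def)
  finally show ?thesis .
qed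

text \<open>
  For \<open>\<rho> < 1\<close> the left side is the fractional integral of order \<open>1 - \<rho>\<close> of \<open>l e\<^sub>1\<^sub>+\<^sub>\<rho> \<le> 1\<close>, and the right side is that of the
  constant \<open>1\<close>, represented as \<open>ml_kernel \<rho> 1 0\<close> so that the same convolution identity evaluates it. For \<open>\<rho> = 1\<close> no
  integration is left, and \<open>l e\<^sub>1\<^sub>+\<^sub>\<rho> \<le> 1\<close> is the claim.
\<close>

lemma relaxation_integral_bound:
  assumes "0 < \<rho>" "\<rho> \<le> 1" "0 < l" "t \<ge> 0"
  shows "l * ml_kernel \<rho> 2 (- l) t \<le> powr_kernel (2 - \<rho>) t"
proof (cases "\<rho> = 1")
  case True
  show ?thesis
  proof (cases "t = 0")
    case True then show ?thesis by (simp add: ml_kernel_def powr_kernel_def)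
  next
    case False
    then show ?thesis
      using ml_kernel_primitive_bounds(2)[of \<rho> l t] assms True by (simp add: powr_kernel_def)
  qed
next
  case False
  then have \<rho>1: "1 - \<rho> > 0" using assms by simp
  have i: "integrable lborel (\<lambda>s. indicator {0..t} s * ((t - s) powr ((1 - \<rho>) - 1) * ml_kernel \<rho> \<mu> c s))"
    if "\<mu> > 0" "t > 0" for \<mu> c
    using integrable_beta_ml_kernel[of \<rho> \<mu> "1 - \<rho>" t c] that \<rho>1 assms by simp
  have si: "set_integrable lborel {0..t} (\<lambda>s. powr_kernel (1 - \<rho>) (t - s) *\<^sub>R ml_kernel \<rho> \<mu> c s)"
    if "\<mu> > 0" "t > 0" for \<mu> c
    using integrable_divide[OF i[OF that, of c], of "Gamma (1 - \<rho>)"]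
    by (simp add: set_integrable_def powr_kernel_def mult_ac)
  show ?thesis
  proof (cases "t = 0")
    case True then show ?thesis by (simp add: ml_kernel_def powr_kernel_def)
  next
    case False
    then have t: "t > 0" using assms by simp
    have "l * ml_kernel \<rho> 2 (- l) t = l * conv (powr_kernel (1 - \<rho>)) (ml_kernel \<rho> (1 + \<rho>) (- l)) t"
      using conv_ml_kernel[of \<rho> "1 + \<rho>" "1 - \<rho>" t "- l"] assms \<rho>1 by simp
    also have "\<dots> = conv (powr_kernel (1 - \<rho>)) (\<lambda>s. l *\<^sub>R ml_kernel \<rho> (1 + \<rho>) (- l) s) t"
      unfolding conv_scaleR by simp
    also have "\<dots> \<le> conv (powr_kernel (1 - \<rho>)) (ml_kernel \<rho> 1 0) t"
      unfolding conv_def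
    proof (rule set_integral_mono)
      show "set_integrable lborel {0..t} (\<lambda>s. powr_kernel (1 - \<rho>) (t - s) *\<^sub>R ml_kernel \<rho> 1 0 s)"
        by (rule si) (use t in auto)
      show "set_integrable lborel {0..t} (\<lambda>s. powr_kernel (1 - \<rho>) (t - s) *\<^sub>R l *\<^sub>R ml_kernel \<rho> (1 + \<rho>) (- l) s)"
        using set_integrable_mult_right[OF si[of "1 + \<rho>" "- l"], of l] t assms by (simp add: mult_ac)
      fix s assume s: "s \<in> {0..t}"
      have "l * ml_kernel \<rho> (1 + \<rho>) (- l) s \<le> ml_kernel \<rho> 1 0 s"
        using ml_kernel_primitive_bounds(2)[of \<rho> l s] assms s
        by (cases "s = 0") (auto simp: ml_kernel_1 mittag_leffler_0, simp add: ml_kernel_def)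
      moreover have "powr_kernel (1 - \<rho>) (t - s) \<ge> 0"
        using Gamma_real_pos[OF \<rho>1] by (simp add: powr_kernel_def)
      ultimately show "powr_kernel (1 - \<rho>) (t - s) *\<^sub>R l *\<^sub>R ml_kernel \<rho> (1 + \<rho>) (- l) s \<le>
          powr_kernel (1 - \<rho>) (t - s) *\<^sub>R ml_kernel \<rho> 1 0 s"
        by (simp add: mult_left_mono)
    qed
    also have "\<dots> = ml_kernel \<rho> (2 - \<rho>) 0 t"
      using conv_ml_kernel[of \<rho> 1 "1 - \<rho>" t 0] assms \<rho>1 by simp
    also have "\<dots> = powr_kernel (2 - \<rho>) t" by (simp add: ml_kernel_def powr_kernel_def mittag_leffler_0)
    finally show ?thesis .
  qed
qed

text \<open>
  As \<open>E\<^sub>\<rho>\<^sub>,\<^sub>1(- l t\<^sup>\<rho>)\<close> decreases in \<open>t\<close>, it is at most its own mean over \<open>[0, t]\<close>, to which the bound on the integral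
  applies. The right side is \<open>t\<^sup>-\<^sup>\<rho> / \<Gamma>(2 - \<rho>)\<close>.
\<close>

lemma relaxation_decay:
  assumes "0 < \<rho>" "\<rho> \<le> 1" "0 < l" "t > 0"
  shows "l * mittag_leffler \<rho> 1 (- l * t powr \<rho>) \<le> powr_kernel (2 - \<rho>) t / t"
proof -
  have "t * mittag_leffler \<rho> 1 (- l * t powr \<rho>) = (LBINT s:{0..t}. mittag_leffler \<rho> 1 (- l * t powr \<rho>))"
    using assms by (simp add: set_lebesgue_integral_def)
  also have "\<dots> \<le> (LBINT s:{0..t}. mittag_leffler \<rho> 1 (- l * s powr \<rho>))"
  proof (rule set_integral_mono)
    show "set_integrable lborel {0..t} (\<lambda>s. mittag_leffler \<rho> 1 (- l * s powr \<rho>))"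
      unfolding set_integrable_def by (intro borel_integrable_compact continuous_on_relaxation assms) auto
    show "mittag_leffler \<rho> 1 (- l * t powr \<rho>) \<le> mittag_leffler \<rho> 1 (- l * s powr \<rho>)" if "s \<in> {0..t}" for s
      using relaxation_decreasing[of \<rho> "l * s powr \<rho>" "l * t powr \<rho>"] that assms
      by (simp add: powr_mono2)
  qed (unfold set_integrable_def, intro borel_integrable_compact continuous_intros, simp)
  also have "\<dots> = t * mittag_leffler \<rho> 2 (- l * t powr \<rho>)"
    by (rule relaxation_integral) (use assms in auto)
  finally have "t * mittag_leffler \<rho> 1 (- l * t powr \<rho>) \<le> ml_kernel \<rho> 2 (- l) t"
    using assms by (simp add: ml_kernel_def)
  then have "l * (t * mittag_leffler \<rho> 1 (- l * t powr \<rho>)) \<le> l * ml_kernel \<rho> 2 (- l) t"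
    using assms by (intro mult_left_mono) auto
  also have "\<dots> \<le> powr_kernel (2 - \<rho>) t" by (rule relaxation_integral_bound) (use assms in auto)
  finally show ?thesis using assms by (simp add: field_simps)
qed

text \<open>
  \<open>l p\<close> is the integral of \<open>g(s) (1 - E\<^sub>\<rho>\<^sub>,\<^sub>1(- l (T - s)\<^sup>\<rho>))\<close>. The second factor is nonnegative and increases with \<open>l\<close>, and
  the continuous function \<open>g\<close> has one sign and is bounded away from \<open>0\<close>; so the integral cannot be small for large \<open>l\<close>
  unless it is already small for \<open>l = l0\<close>.
\<close>

lemma p_coeff_lower_bound:
  assumes \<rho>: "0 < \<rho>" "\<rho> \<le> 1" and T: "0 < T" and l0: "0 < l0"
    and g: "continuous_on {0..T} g" and g0: "\<And>t. t \<in> {0..T} \<Longrightarrow> g t \<noteq> 0"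
  obtains \<kappa> where "\<kappa> > 0" "\<And>l. l \<ge> l0 \<Longrightarrow> \<kappa> \<le> l * \<bar>p_coeff \<rho> g l T\<bar>"
proof -
  \<comment> \<open>For \<open>l \<ge> l0\<close> the relaxation function is at most \<open>1\<close> on \<open>[0, T/2]\<close> and at most \<open>E < 1\<close> on \<open>[T/2, T]\<close>.\<close>
  define E where "E = mittag_leffler \<rho> 1 (- (l0 * (T / 2) powr \<rho>))"
  have E: "E < 1"
    using relaxation_strict_decreasing[of \<rho> 0 "l0 * (T / 2) powr \<rho>"] assms
    by (simp add: E_def mittag_leffler_0)
  have "continuous_on {0..T} (\<lambda>s. \<bar>g s\<bar>)" using g by (intro continuous_intros)
  then obtain s0 where s0: "s0 \<in> {0..T}" "\<And>s. s \<in> {0..T} \<Longrightarrow> \<bar>g s0\<bar> \<le> \<bar>g s\<bar>"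
    using continuous_attains_inf[of "{0..T}" "\<lambda>s. \<bar>g s\<bar>"] T by auto
  define m where "m = \<bar>g s0\<bar>"
  have m: "m > 0" using g0[OF s0(1)] by (simp add: m_def)
  have conn: "connected (g ` {0..T})" using g by (intro connected_continuous_image) auto
  have "(\<forall>s\<in>{0..T}. g s > 0) \<or> (\<forall>s\<in>{0..T}. g s < 0)"
  proof (rule ccontr)
    assume "\<not> ?thesis"
    then obtain a b where ab: "a \<in> {0..T}" "b \<in> {0..T}" "g a \<le> 0" "0 \<le> g b" by (auto simp: not_less)
    then have "0 \<in> g ` {0..T}" using conn unfolding connected_iff_interval by blast
    then show False using g0 by force
  qed
  then obtain \<sigma> where \<sigma>: "\<bar>\<sigma>\<bar> = 1" "\<And>s. s \<in> {0..T} \<Longrightarrow> m \<le> \<sigma> * g s"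
  proof
    assume "\<forall>s\<in>{0..T}. g s > 0"
    then show thesis using that[of 1] s0(2) by (fastforce simp: m_def)
  next
    assume "\<forall>s\<in>{0..T}. g s < 0"
    then show thesis using that[of "- 1"] s0(2) by (fastforce simp: m_def)
  qed
  define \<kappa> where "\<kappa> = m * (T / 2 * (1 - E))"
  have "\<kappa> > 0" using m T E by (simp add: \<kappa>_def)
  moreover have "\<kappa> \<le> l * \<bar>p_coeff \<rho> g l T\<bar>" if l: "l \<ge> l0" for l
  proof -
    let ?k = "ml_kernel \<rho> (1 + \<rho>) (- l)"
    have l': "l > 0" using l l0 by simp
    let ?e = "\<lambda>s. mittag_leffler \<rho> 1 (- l * s powr \<rho>)"
    have ei: "set_integrable lborel {0..b} ?e" for b
      unfolding set_integrable_def by (intro borel_integrable_compact continuous_on_relaxation \<rho>) auto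
    have "ml_kernel \<rho> 2 (- l) T = (LBINT s:{0..T}. ?e s)"
      using relaxation_integral[of \<rho> T "- l"] \<rho> T by (simp add: ml_kernel_def)
    also have "\<dots> \<le> (LBINT s:{0..T}. indicator {0..T/2} s + E * indicator {T/2..T} s)"
    proof (rule set_integral_mono[OF ei])
      show "set_integrable lborel {0..T} (\<lambda>s. indicator {0..T/2} s + E * indicator {T/2..T} s)"
        unfolding set_integrable_def
        by (intro integrable_mult_indicator Bochner_Integration.integrable_add integrable_mult_right
            integrable_real_indicator) (auto simp: emeasure_lborel_Icc_eq)
      fix s assume s: "s \<in> {0..T}"
      have E0: "0 \<le> E" using relaxation_nonneg[OF \<rho>, of "l0 * (T / 2) powr \<rho>"] l0 by (simp add: E_def)
      show "?e s \<le> indicator {0..T/2} s + E * indicator {T/2..T} s"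
      proof (cases "s \<le> T/2")
        case True
        then show ?thesis using relaxation_bounds(2)[OF \<rho>, of l s] l' s E0
          by (auto simp: indicator_def)
      next
        case False
        have "l0 * (T / 2) powr \<rho> \<le> l * s powr \<rho>"
          using False T l l0 \<rho> by (intro mult_mono powr_mono2) auto
        then have "?e s \<le> E" using relaxation_decreasing[OF \<rho>, of "l0 * (T / 2) powr \<rho>" "l * s powr \<rho>"] l0
          by (simp add: E_def)
        then show ?thesis using False s by simp
      qed
    qed
    also have "\<dots> = (LBINT s. indicator {0..T/2} s + E * indicator {T/2..T} s)"
      unfolding set_lebesgue_integral_def using T
      by (intro Bochner_Integration.integral_cong) (auto simp: indicator_def)
    also have "\<dots> = T / 2 + E * (T / 2)"
      using T by (subst Bochner_Integration.integral_add) (auto simp: emeasure_lborel_Icc_eq)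
    finally have e2: "ml_kernel \<rho> 2 (- l) T \<le> T / 2 + E * (T / 2)" .
    have "conv (ml_kernel \<rho> 1 (- l)) (\<lambda>_. 1::real) T =
        conv (powr_kernel 1) (\<lambda>_. 1) T + (- l) *\<^sub>R conv ?k (\<lambda>_. 1) T"
      using \<rho> T by (intro conv_ml_kernel_1_recurrence[where T=T]) auto
    then have "ml_kernel \<rho> 2 (- l) T = T - l * ml_kernel \<rho> (2 + \<rho>) (- l) T"
      using \<rho> T conv_ml_kernel_const[of \<rho> 1 T "- l" "1::real"] conv_ml_kernel_const[of \<rho> "1 + \<rho>" T "- l" "1::real"]
        conv_powr_kernel_1_eq_integral[of T "\<lambda>_. 1::real" T]
      by (simp add: add.assoc[symmetric])
    then have "T / 2 * (1 - E) \<le> l * ml_kernel \<rho> (2 + \<rho>) (- l) T" using e2 by (simp add: algebra_simps)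
    then have "\<kappa> \<le> l * (ml_kernel \<rho> (2 + \<rho>) (- l) T * m)"
      using m mult_left_mono[of "T / 2 * (1 - E)" "l * ml_kernel \<rho> (2 + \<rho>) (- l) T" m] by (simp add: \<kappa>_def mult_ac)
    also have "ml_kernel \<rho> (2 + \<rho>) (- l) T * m = conv ?k (\<lambda>_. m) T"
      using conv_ml_kernel_const[of \<rho> "1 + \<rho>" T "- l" m] \<rho> T by (simp add: add.assoc[symmetric])
    also have "l * conv ?k (\<lambda>_. m) T \<le> l * conv ?k (\<lambda>s. \<sigma> *\<^sub>R g s) T"
    proof (rule mult_left_mono)
      show "conv ?k (\<lambda>_. m) T \<le> conv ?k (\<lambda>s. \<sigma> *\<^sub>R g s) T"
        using g \<sigma>(2) ml_kernel_primitive_bounds(1)[OF \<rho> l'] \<rho>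
        by (intro conv_mono[OF set_integrable_ml_kernel, where T=T]) (auto intro!: continuous_intros)
    qed (use l' in simp)
    also have "\<dots> \<le> l * \<bar>p_coeff \<rho> g l T\<bar>"
      unfolding p_coeff_eq_conv conv_scaleR using l' \<sigma>(1)
      by (intro mult_left_mono) (auto simp: abs_mult intro: order_trans[OF abs_ge_self])
    finally show ?thesis .
  qed
  ultimately show thesis by (rule that)
qed

section \<open>Scalar products and orthonormal bases\<close>

text \<open>
  Multiplication by \<open>d\<close> scales the norm by \<open>norm d\<close>; polarisation transfers this to inner products.
\<close>

lemma inner_mult_mult:
  fixes d z w :: "'k::{real_normed_field, euclidean_space}"
  shows "(d * z) \<bullet> (d * w) = (norm d)\<^sup>2 * (z \<bullet> w)"
proof -
  have "(norm (d * (z + w)))\<^sup>2 = (norm d)\<^sup>2 * (norm (z + w))\<^sup>2"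
    by (simp add: norm_mult power_mult_distrib)
  moreover have "(norm (d * z))\<^sup>2 = (norm d)\<^sup>2 * (norm z)\<^sup>2" "(norm (d * w))\<^sup>2 = (norm d)\<^sup>2 * (norm w)\<^sup>2"
    by (simp_all add: norm_mult power_mult_distrib)
  ultimately show ?thesis
    by (simp add: power2_norm_eq_inner algebra_simps inner_simps inner_commute)
qed

text \<open>
  Polarising \<open>inner_mult_mult\<close> in \<open>d\<close> as well, between \<open>d\<close> and \<open>1\<close>, shows that the adjoint of multiplication by \<open>d\<close> is
  multiplication by \<open>scalar_cnj d\<close>. All algebraic laws of the conjugation follow from this, for the real and the complex
  numbers at once.
\<close>

lemma inner_mult_adjoint:
  fixes d z w :: "'k::{real_normed_field, euclidean_space}"
  shows "(d * z) \<bullet> w = z \<bullet> (scalar_cnj d * w)"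
proof -
  have "((d + 1) * z) \<bullet> ((d + 1) * w) = (norm (d + 1))\<^sup>2 * (z \<bullet> w)" by (rule inner_mult_mult)
  moreover have "(norm (d + 1))\<^sup>2 = (norm d)\<^sup>2 + 2 * (d \<bullet> 1) + 1"
    by (simp add: power2_norm_eq_inner inner_simps inner_commute) (simp add: dot_square_norm)
  ultimately have "(d * z) \<bullet> w + z \<bullet> (d * w) = 2 * (d \<bullet> 1) * (z \<bullet> w)"
    using inner_mult_mult[of d z w] by (simp add: algebra_simps inner_simps)
  moreover have "scalar_cnj d * w = (2 * (d \<bullet> 1)) *\<^sub>R w - d * w"
    by (simp add: scalar_cnj_def left_diff_distrib scaleR_conv_of_real)
  ultimately show ?thesis by (simp add: inner_diff_right)
qed

lemma scalar_cnj_mult_self: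
  fixes d :: "'k::{real_normed_field, euclidean_space}"
  shows "scalar_cnj d * d = of_real ((norm d)\<^sup>2)"
proof (rule vector_eq_rdot[THEN iffD1, rule_format])
  fix z :: 'k
  have "(scalar_cnj d * d) \<bullet> z = (d * z) \<bullet> (d * 1)" by (subst inner_mult_adjoint) (simp add: inner_commute)
  also have "\<dots> = of_real ((norm d)\<^sup>2) \<bullet> z"
    unfolding inner_mult_mult by (simp add: of_real_def inner_commute)
  finally show "(scalar_cnj d * d) \<bullet> z = of_real ((norm d)\<^sup>2) \<bullet> z" .
qed

lemma scalar_cnj_mult:
  fixes c d :: "'k::{real_normed_field, euclidean_space}"
  shows "scalar_cnj (c * d) = scalar_cnj c * scalar_cnj d"
proof (rule vector_eq_ldot[THEN iffD1, rule_format])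
  fix z :: 'k
  have "z \<bullet> (scalar_cnj (c * d) * 1) = (c * (d * z)) \<bullet> 1"
    by (simp only: inner_mult_adjoint[symmetric] mult.assoc)
  also have "\<dots> = z \<bullet> (scalar_cnj d * scalar_cnj c)"
    by (simp add: inner_mult_adjoint)
  finally show "z \<bullet> scalar_cnj (c * d) = z \<bullet> (scalar_cnj c * scalar_cnj d)" by (simp add: mult.commute)
qed

lemma scalar_cnj_of_real [simp]:
  "scalar_cnj (of_real r) = (of_real r :: 'k::{real_normed_field, euclidean_space})"
proof -
  have "of_real r \<bullet> (1 :: 'k) = r"
    by (simp add: of_real_def dot_square_norm)
  then show ?thesis by (simp add: scalar_cnj_def)
qed

context hilbert_space
begin

lemma ip_smul_right: "ip x (smul c y) = scalar_cnj c * ip x y"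
proof -
  have "ip x (smul c y) = scalar_cnj (ip (smul c y) x)" by (rule ip_cnj)
  also have "\<dots> = scalar_cnj c * scalar_cnj (ip y x)" by (simp only: ip_smul_left scalar_cnj_mult)
  also have "scalar_cnj (ip y x) = ip x y" by (rule ip_cnj[symmetric])
  finally show ?thesis .
qed

lemma ip_self: "ip x x = of_real ((norm x)\<^sup>2)"
proof -
  have "2 * ip x x = of_real (2 * (ip x x \<bullet> 1))"
    using ip_cnj[of x x] by (metis add.commute diff_add_cancel mult_2 scalar_cnj_def)
  then have "ip x x = of_real (ip x x \<bullet> 1)" by simp
  then show ?thesis by (simp add: power2_norm_eq_inner inner_eq_Re_ip)
qed

lemma norm_smul: "norm (smul c x) = norm c * norm x"
proof -
  have "ip (smul c x) (smul c x) = (scalar_cnj c * c) * ip x x"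
    by (simp add: ip_smul_left ip_smul_right mult_ac)
  also have "\<dots> = of_real ((norm c * norm x)\<^sup>2)"
    unfolding scalar_cnj_mult_self ip_self by (simp add: power_mult_distrib)
  finally have "(norm (smul c x))\<^sup>2 = (norm c * norm x)\<^sup>2"
    unfolding ip_self of_real_eq_iff .
  then show ?thesis by (simp add: power2_eq_iff_nonneg)
qed

text \<open>
  Rotating \<open>x\<close> by a scalar of modulus one makes \<open>ip x y\<close> real and nonnegative, which reduces the claim to the real
  Cauchy-Schwarz inequality.
\<close>

lemma norm_ip_le: "norm (ip x y) \<le> norm x * norm y"
proof (cases "ip x y = 0")
  case False
  define d where "d = of_real (norm (ip x y)) / ip x y"
  have d: "norm d = 1" "d * ip x y = of_real (norm (ip x y))"
    using False by (simp_all add: d_def norm_divide)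
  have "norm (ip x y) = ip (smul d x) y \<bullet> 1"
    using d(2) by (simp add: ip_smul_left of_real_def dot_square_norm)
  also have "\<dots> = smul d x \<bullet> y" by (simp add: inner_eq_Re_ip)
  also have "\<dots> \<le> norm (smul d x) * norm y" by (rule norm_cauchy_schwarz)
  finally show ?thesis using d(1) by (simp add: norm_smul)
qed simp

lemma bounded_linear_ip: "bounded_linear (\<lambda>x. ip x y)"
proof (rule bounded_linear_intro[of _ "norm y"])
  show "ip (r *\<^sub>R x) y = r *\<^sub>R ip x y" for r x
    by (simp add: smul_of_real[symmetric] ip_smul_left scaleR_conv_of_real)
qed (auto simp: ip_add_left norm_ip_le)

lemma bounded_linear_smul_left: "bounded_linear (\<lambda>c. smul c x)"
proof (rule bounded_linear_intro[of _ "norm x"])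
  show "smul (r *\<^sub>R c) x = r *\<^sub>R smul c x" for r c
    by (simp add: scaleR_conv_of_real scale_scale[symmetric] smul_of_real del: scale_scale)
qed (auto simp: scale_left_distrib norm_smul)

sublocale coef: bounded_linear "\<lambda>x. ip x y" for y
  by (rule bounded_linear_ip)

end

locale orthonormal_basis = hilbert_space smul ip
  for smul :: "'k::{real_normed_field, euclidean_space} \<Rightarrow>
      'h::{real_inner, banach, second_countable_topology} \<Rightarrow> 'h"
    and ip :: "'h \<Rightarrow> 'h \<Rightarrow> 'k" +
  fixes v :: "nat \<Rightarrow> 'h"
  assumes complete_orthonormal: "complete_orthonormal ip v"
begin

lemma ip_v: "ip (v j) (v k) = (if j = k then 1 else 0)"
  using complete_orthonormal by (simp add: complete_orthonormal_def)

lemma eq_by_coefs: "(\<And>k. ip x (v k) = ip y (v k)) \<Longrightarrow> x = y"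
  using complete_orthonormal unfolding complete_orthonormal_def
  by (metis coef.diff eq_iff_diff_eq_0)

lemma ip_sum_v:
  assumes "finite I"
  shows "ip (\<Sum>k\<in>I. smul (c k) (v k)) (v j) = (if j \<in> I then c j else 0)"
proof -
  have "ip (\<Sum>k\<in>I. smul (c k) (v k)) (v j) = (\<Sum>k\<in>I. if k = j then c k else 0)"
    unfolding coef.sum by (intro sum.cong) (auto simp: ip_smul_left ip_v)
  then show ?thesis using assms by simp
qed

lemma inner_sum_v: "x \<bullet> (\<Sum>k\<in>I. smul (c k) (v k)) = (\<Sum>k\<in>I. (scalar_cnj (c k) * ip x (v k)) \<bullet> 1)"
  unfolding inner_sum_right by (intro sum.cong) (simp_all add: inner_eq_Re_ip ip_smul_right)

lemma norm_sum_v: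
  assumes "finite I"
  shows "(norm (\<Sum>k\<in>I. smul (c k) (v k)))\<^sup>2 = (\<Sum>k\<in>I. (norm (c k))\<^sup>2)"
proof -
  have "(scalar_cnj (c k) * ip (\<Sum>k\<in>I. smul (c k) (v k)) (v k)) \<bullet> 1 = (norm (c k))\<^sup>2" if "k \<in> I" for k
    using that assms by (simp add: ip_sum_v scalar_cnj_mult_self) (simp add: of_real_def dot_square_norm)
  then show ?thesis unfolding power2_norm_eq_inner[of "sum _ _"] inner_sum_v by simp
qed

lemma bessel_summable: "summable (\<lambda>k. (norm (ip x (v k)))\<^sup>2)"
proof (rule summableI_nonneg_bounded)
  fix n
  let ?s = "\<Sum>k<n. smul (ip x (v k)) (v k)"
  have "(x - ?s) \<bullet> ?s = 0"
    unfolding inner_sum_v by (intro sum.neutral) (auto simp: coef.diff ip_sum_v)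
  then have "x \<bullet> ?s = ?s \<bullet> ?s" by (simp add: inner_diff_left)
  then have "(norm (x - ?s))\<^sup>2 = (norm x)\<^sup>2 - (norm ?s)\<^sup>2"
    by (simp add: power2_norm_eq_inner inner_simps inner_commute)
  then have "(norm ?s)\<^sup>2 \<le> (norm x)\<^sup>2" using zero_le_power2[of "norm (x - ?s)"] by linarith
  then show "(\<Sum>k<n. (norm (ip x (v k)))\<^sup>2) \<le> (norm x)\<^sup>2" by (simp add: norm_sum_v)
qed simp

text \<open>
  A Weierstrass test in \<open>\<ell>\<^sup>2\<close>: by orthogonality the tail of the series is controlled by the sum of the squares of the
  majorants, uniformly in \<open>t\<close>.
  The series itself need not converge absolutely.
\<close>

theorem fourier_series_uniform:
  fixes c :: "nat \<Rightarrow> 't::metric_space \<Rightarrow> 'k" and M :: "nat \<Rightarrow> real"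
  assumes cont: "\<And>k. continuous_on S (c k)"
    and bound: "\<And>k t. t \<in> S \<Longrightarrow> norm (c k t) \<le> M k"
    and M: "summable (\<lambda>k. (M k)\<^sup>2)"
  obtains u where "continuous_on S u" "\<And>t. t \<in> S \<Longrightarrow> (\<lambda>k. smul (c k t) (v k)) sums u t"
    "\<And>t k. t \<in> S \<Longrightarrow> ip (u t) (v k) = c k t"
proof -
  let ?s = "\<lambda>n t. \<Sum>k<n. smul (c k t) (v k)"
  have tail: "norm (?s n t - ?s m t) \<le> sqrt (\<Sum>k=m..<n. (M k)\<^sup>2)" if "t \<in> S" "m \<le> n" for m n t
  proof -
    have "?s n t - ?s m t = (\<Sum>k=m..<n. smul (c k t) (v k))"
      using that(2) by (simp add: lessThan_atLeast0 sum_diff_nat_ivl)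
    then have "(norm (?s n t - ?s m t))\<^sup>2 = (\<Sum>k=m..<n. (norm (c k t))\<^sup>2)" by (simp add: norm_sum_v)
    also have "\<dots> \<le> (\<Sum>k=m..<n. (M k)\<^sup>2)" using bound that(1) by (intro sum_mono power_mono) auto
    finally show ?thesis by (simp add: real_le_rsqrt)
  qed
  have "uniformly_Cauchy_on S ?s"
  proof (rule uniformly_Cauchy_onI')
    fix e :: real assume e: "e > 0"
    then obtain N where N: "\<And>m n. m \<ge> N \<Longrightarrow> norm (\<Sum>k=m..<n. (M k)\<^sup>2) < e\<^sup>2"
      using M unfolding summable_Cauchy by (meson zero_less_power)
    have "dist (?s m t) (?s n t) < e" if "t \<in> S" "m \<ge> N" "n > m" for t m n
    proof -
      have "dist (?s m t) (?s n t) \<le> sqrt (\<Sum>k=m..<n. (M k)\<^sup>2)"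
        using tail[of t m n] that by (simp add: dist_norm norm_minus_commute)
      also have "\<dots> < sqrt (e\<^sup>2)" using N[of m n] that by (intro real_sqrt_less_mono) auto
      finally show ?thesis using e by simp
    qed
    then show "\<exists>N. \<forall>t\<in>S. \<forall>m\<ge>N. \<forall>n>m. dist (?s m t) (?s n t) < e" by blast
  qed
  then have "uniformly_convergent_on S ?s" using Cauchy_uniformly_convergent by blast
  then obtain u where u: "uniform_limit S ?s u sequentially" by (auto simp: uniformly_convergent_on_def)
  have "continuous_on S u"
    by (rule uniform_limit_theorem[OF _ u])
      (auto intro!: always_eventually continuous_intros bounded_linear.continuous_on[OF bounded_linear_smul_left] cont)
  moreover have su: "(\<lambda>k. smul (c k t) (v k)) sums u t" if "t \<in> S" for t
    unfolding sums_def by (rule tendsto_uniform_limitI[OF u that])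
  moreover have "ip (u t) (v k) = c k t" if "t \<in> S" for t k
  proof (rule sums_unique2)
    show "(\<lambda>j. ip (smul (c j t) (v j)) (v k)) sums ip (u t) (v k)"
      by (rule bounded_linear.sums[OF bounded_linear_ip su[OF that]])
    show "(\<lambda>j. ip (smul (c j t) (v j)) (v k)) sums c k t"
      using sums_single[of k "\<lambda>j. c j t"]
      by (rule sums_cong[THEN iffD1, rotated]) (auto simp: ip_smul_left ip_v)
  qed
  ultimately show thesis using that by blast
qed

lemma riesz_fischer:
  assumes "summable (\<lambda>k. (norm (c k))\<^sup>2)"
  obtains x where "(\<lambda>k. smul (c k) (v k)) sums x" "\<And>k. ip x (v k) = c k"
proof (rule fourier_series_uniform[of "{0::real}" "\<lambda>k _. c k" "\<lambda>k. norm (c k)"])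
  fix u assume "\<And>t. t \<in> {0::real} \<Longrightarrow> (\<lambda>k. smul (c k) (v k)) sums u t"
    "\<And>t k. t \<in> {0::real} \<Longrightarrow> ip (u t) (v k) = c k"
  then show thesis using that[of "u 0"] by simp
qed (use assms in auto)

end

section \<open>Fourier modes of the solution\<close>

text \<open>
  The Fourier coefficient of the solution at the eigenvalue \<open>l\<close>, where \<open>a\<close> and \<open>b\<close> are the coefficients of the initial value
  and of the source term.
\<close>

definition fourier_mode :: "real \<Rightarrow> (real \<Rightarrow> real) \<Rightarrow> real \<Rightarrow> 'b \<Rightarrow> 'b \<Rightarrow> real \<Rightarrow> 'b::real_vector" where
  "fourier_mode \<rho> g l a b t =
     mittag_leffler \<rho> 1 (- l * t powr \<rho>) *\<^sub>R a + q_coeff \<rho> g l t *\<^sub>R b"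

lemma continuous_on_q_coeff:
  assumes "0 < \<rho>" "continuous_on {0..T} g"
  shows "continuous_on {0..T} (q_coeff \<rho> g l)"
  unfolding q_coeff_eq_conv using assms by (intro conv_continuous set_integrable_ml_kernel)

lemma continuous_on_fourier_mode:
  fixes a b :: "'b::real_normed_vector"
  assumes "0 < \<rho>" "continuous_on {0..T} g"
  shows "continuous_on {0..T} (fourier_mode \<rho> g l a b)"
  unfolding fourier_mode_def
  by (intro continuous_intros continuous_on_q_coeff continuous_on_relaxation assms)

text \<open>
  Moving the initial value into the right-hand side puts the mode in Duhamel form: \<open>y - a\<close> vanishes at \<open>0\<close> and satisfies
  \<open>D\<^sup>\<rho> (y - a) = (g b - l a) - l (y - a)\<close>.
\<close>

lemma fourier_mode_eq_conv:
  fixes a b :: "'b::{banach, second_countable_topology}"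
  assumes \<rho>: "0 < \<rho>" and g: "continuous_on {0..T} g" and t: "t \<in> {0..T}"
  shows "fourier_mode \<rho> g l a b t = a + conv (ml_kernel \<rho> \<rho> (- l)) (\<lambda>s. g s *\<^sub>R b - l *\<^sub>R a) t"
proof -
  let ?k = "ml_kernel \<rho> \<rho> (- l)"
  have k: "set_integrable lborel {0..T} ?k" by (rule set_integrable_ml_kernel[OF \<rho> \<rho>])
  have "conv ?k (\<lambda>s. g s *\<^sub>R b + (- l) *\<^sub>R a) t = conv ?k (\<lambda>s. g s *\<^sub>R b) t + (- l) *\<^sub>R conv ?k (\<lambda>_. a) t"
    using t by (subst conv_add[OF k]) (auto simp: conv_scaleR[symmetric] intro!: continuous_intros g)
  also have "conv ?k (\<lambda>s. g s *\<^sub>R b) t = q_coeff \<rho> g l t *\<^sub>R b"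
    using conv_bounded_linear[OF bounded_linear_scaleR_left k g, of t b] t by (simp add: q_coeff_eq_conv)
  also have "(- l) *\<^sub>R conv ?k (\<lambda>_. a) t = (mittag_leffler \<rho> 1 (- l * t powr \<rho>) - 1) *\<^sub>R a"
    using conv_ml_kernel_const[OF \<rho> \<rho>, of t "- l" a] relaxation_recurrence[OF \<rho>, of t "- l"] t by simp
  finally show ?thesis by (simp add: fourier_mode_def algebra_simps)
qed

lemma fourier_mode_solves:
  fixes a b :: "'b::{banach, second_countable_topology}"
  assumes \<rho>: "0 < \<rho>" "\<rho> \<le> 1" and g: "continuous_on {0..T} g" and t: "t \<in> {0..T}"
  shows "frac_compl \<rho> (\<lambda>s. fourier_mode \<rho> g l a b s - a) t =
    conv (powr_kernel 1) (\<lambda>s. g s *\<^sub>R b - l *\<^sub>R fourier_mode \<rho> g l a b s) t"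
proof -
  let ?h = "\<lambda>s. g s *\<^sub>R b - l *\<^sub>R a"
  let ?z = "conv (ml_kernel \<rho> \<rho> (- l)) ?h"
  have h: "continuous_on {0..T} ?h" by (intro continuous_intros g)
  have z: "fourier_mode \<rho> g l a b s - a = ?z s" if "s \<in> {0..T}" for s
    using fourier_mode_eq_conv[OF \<rho>(1) g that, of l a b] by simp
  have "frac_compl \<rho> (\<lambda>s. fourier_mode \<rho> g l a b s - a) t = frac_compl \<rho> ?z t"
  proof (cases "\<rho> = 1")
    case False
    then show ?thesis using \<rho> t z by (simp add: frac_compl_eq_conv, intro conv_cong) auto
  qed (use z t in simp)
  also have "\<dots> = conv (powr_kernel 1) (\<lambda>s. ?h s + (- l) *\<^sub>R ?z s) t"
    by (rule frac_compl_duhamel[OF \<rho> h t])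
  also have "\<dots> = conv (powr_kernel 1) (\<lambda>s. g s *\<^sub>R b - l *\<^sub>R fourier_mode \<rho> g l a b s) t"
  proof (rule conv_cong)
    fix s assume "0 \<le> s" "s \<le> t"
    then have "fourier_mode \<rho> g l a b s = a + ?z s" using fourier_mode_eq_conv[OF \<rho>(1) g, of s l a b] t by simp
    then show "?h s + (- l) *\<^sub>R ?z s = g s *\<^sub>R b - l *\<^sub>R fourier_mode \<rho> g l a b s"
      by (simp only: scaleR_add_right) simp
  qed
  finally show ?thesis .
qed

lemma fourier_mode_unique:
  fixes a b :: "'b::euclidean_space"
  assumes \<rho>: "0 < \<rho>" "\<rho> \<le> 1" and T: "0 < T" and g: "continuous_on {0..T} g"
    and z: "continuous_on {0..T} z"
    and eq: "\<And>t. t \<in> {0..T} \<Longrightarrow>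
      frac_compl \<rho> (\<lambda>s. z s - a) t = conv (powr_kernel 1) (\<lambda>s. g s *\<^sub>R b - l *\<^sub>R z s) t"
    and t: "t \<in> {0..T}"
  shows "z t = fourier_mode \<rho> g l a b t"
proof -
  have "z t - a = conv (ml_kernel \<rho> \<rho> (- l)) (\<lambda>s. g s *\<^sub>R b - l *\<^sub>R a) t"
  proof (rule frac_compl_duhamel_unique[OF \<rho> T _ _ _ t])
    fix t assume "t \<in> {0..T}"
    then show "frac_compl \<rho> (\<lambda>s. z s - a) t =
        conv (powr_kernel 1) (\<lambda>s. g s *\<^sub>R b - l *\<^sub>R a + (- l) *\<^sub>R (z s - a)) t"
      using eq by (simp add: algebra_simps)
  qed (intro continuous_intros g z)+
  then show ?thesis using fourier_mode_eq_conv[OF \<rho>(1) g t, of l a b] by (simp add: algebra_simps)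
qed

lemma fourier_mode_integral:
  fixes a b :: "'b::{banach, second_countable_topology}"
  assumes \<rho>: "0 < \<rho>" and T: "0 < T" and g: "continuous_on {0..T} g"
  shows "conv (powr_kernel 1) (fourier_mode \<rho> g l a b) T =
    (T * mittag_leffler \<rho> 2 (- l * T powr \<rho>)) *\<^sub>R a + p_coeff \<rho> g l T *\<^sub>R b"
proof -
  note k = set_integrable_powr_kernel[OF zero_less_one, of T]
  note e = continuous_on_relaxation[OF \<rho>, of T "- l"] and q = continuous_on_q_coeff[OF \<rho> g, of l]
  have "conv (powr_kernel 1) (fourier_mode \<rho> g l a b) T =
      conv (powr_kernel 1) (\<lambda>s. mittag_leffler \<rho> 1 (- l * s powr \<rho>) *\<^sub>R a) T +
      conv (powr_kernel 1) (\<lambda>s. q_coeff \<rho> g l s *\<^sub>R b) T"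
    unfolding fourier_mode_def[abs_def] by (rule conv_add[OF k]) (intro continuous_intros e q order_refl)+
  also have "conv (powr_kernel 1) (\<lambda>s. mittag_leffler \<rho> 1 (- l * s powr \<rho>) *\<^sub>R a) T =
      conv (powr_kernel 1) (\<lambda>s. mittag_leffler \<rho> 1 (- l * s powr \<rho>)) T *\<^sub>R a"
    by (rule conv_bounded_linear[OF bounded_linear_scaleR_left k e order_refl, symmetric])
  also have "conv (powr_kernel 1) (\<lambda>s. mittag_leffler \<rho> 1 (- l * s powr \<rho>)) T =
      T * mittag_leffler \<rho> 2 (- l * T powr \<rho>)"
    using conv_powr_kernel_1[OF set_borel_measurable_continuous_on[OF e order_refl]]
      relaxation_integral[OF \<rho>, of T "- l"] T by simp
  also have "conv (powr_kernel 1) (\<lambda>s. q_coeff \<rho> g l s *\<^sub>R b) T =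
      conv (powr_kernel 1) (q_coeff \<rho> g l) T *\<^sub>R b"
    by (rule conv_bounded_linear[OF bounded_linear_scaleR_left k q order_refl, symmetric])
  also have "conv (powr_kernel 1) (q_coeff \<rho> g l) T = p_coeff \<rho> g l T"
    unfolding q_coeff_eq_conv[abs_def] p_coeff_eq_conv
    using conv_powr_kernel_1_conv_ml_kernel(1)[OF \<rho> g, of T] T by simp
  finally show ?thesis .
qed

lemma fourier_mode_0: "fourier_mode \<rho> g l a b 0 = a"
  by (simp add: fourier_mode_def mittag_leffler_0 q_coeff_eq_conv)

lemma at_within_upper_segment:
  fixes t T c d :: real
  assumes "c < t" "d < t"
  shows "at t within {c..T} = at t within {d..T}" "at t within {c<..T} = at t within {d..T}"
  by (rule at_within_nhd[of _ "{max c d<..}"]; use assms in auto)+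

lemma continuous_on_half_open:
  fixes f :: "real \<Rightarrow> 'b::topological_space"
  assumes "\<And>\<epsilon>. \<epsilon> > 0 \<Longrightarrow> continuous_on {\<epsilon>..T} f"
  shows "continuous_on {0<..T} f"
  unfolding continuous_on_eq_continuous_within
proof
  fix t assume t: "t \<in> {0<..T}"
  then have "continuous (at t within {t/2..T}) f"
    using assms[of "t/2"] by (simp add: continuous_on_eq_continuous_within)
  then show "continuous (at t within {0<..T}) f"
    using at_within_upper_segment(2)[of 0 t "t/2" T] t by simp
qed

lemma lborel_integral_eq_conv:
  fixes u :: "real \<Rightarrow> 'b::{banach, second_countable_topology}"
  assumes "continuous_on {0..T} u"
  shows "(LBINT t:{0..T}. u t) = conv (powr_kernel 1) u T"
  using conv_powr_kernel_1[OF set_borel_measurable_continuous_on[OF assms order_refl]] by simp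

lemma summable_square_of_bound:
  fixes x y z :: "nat \<Rightarrow> real"
  assumes "summable (\<lambda>k. (x k)\<^sup>2)" "summable (\<lambda>k. (y k)\<^sup>2)"
    and "\<And>k. \<bar>z k\<bar> \<le> \<bar>c * x k + d * y k\<bar>"
  shows "summable (\<lambda>k. (z k)\<^sup>2)"
proof (rule summable_comparison_test')
  show "summable (\<lambda>k. 2 * c\<^sup>2 * (x k)\<^sup>2 + 2 * d\<^sup>2 * (y k)\<^sup>2)"
    by (intro summable_add summable_mult assms)
  fix k :: nat assume "0 \<le> k"
  have "(z k)\<^sup>2 \<le> (c * x k + d * y k)\<^sup>2" using assms(3)[of k] by (simp add: abs_le_square_iff)
  also have "\<dots> \<le> 2 * (c * x k)\<^sup>2 + 2 * (d * y k)\<^sup>2"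
    using sum_squares_bound[of "c * x k" "d * y k"] by (simp add: power2_sum)
  finally show "norm ((z k)\<^sup>2) \<le> 2 * c\<^sup>2 * (x k)\<^sup>2 + 2 * d\<^sup>2 * (y k)\<^sup>2"
    by (simp add: power_mult_distrib)
qed

section \<open>The inverse problem for a diagonal operator\<close>

text \<open>
  In the coordinates given by its eigenbasis the operator becomes multiplication by the sequence of eigenvalues, on the
  largest domain where this stays square summable.
\<close>

locale diagonal_operator = orthonormal_basis smul ip v
  for smul :: "'k::{real_normed_field, euclidean_space} \<Rightarrow>
      'h::{real_inner, banach, second_countable_topology} \<Rightarrow> 'h"
    and ip :: "'h \<Rightarrow> 'h \<Rightarrow> 'k" and v :: "nat \<Rightarrow> 'h" +
  fixes D :: "'h set" and A :: "'h \<Rightarrow> 'h" and lam :: "nat \<Rightarrow> real"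
  assumes A_coef: "x \<in> D \<Longrightarrow> ip (A x) (v k) = lam k *\<^sub>R ip x (v k)"
    and D_iff: "x \<in> D \<longleftrightarrow> summable (\<lambda>k. (lam k)\<^sup>2 * (norm (ip x (v k)))\<^sup>2)"
    and lam_ge: "lam k \<ge> lam 0" and lam_0: "lam 0 > 0"
begin

lemma lam_pos: "lam k > 0"
  using lam_ge[of k] lam_0 by linarith

text \<open>
  Taking a coefficient is continuous and linear, so it commutes with the fractional integral and with the Caputo derivative.
  Although \<open>A u\<close> may be unbounded near \<open>0\<close>, each coefficient \<open>lam k * z t\<close> of it is continuous up to \<open>0\<close>; hence the
  equation on \<open>{0<..T}\<close> can be integrated from \<open>0\<close>, and uniqueness for the scalar problem applies.
\<close>

lemma solution_coefs:
  assumes \<rho>: "0 < \<rho>" "\<rho> \<le> 1" and T: "0 < T" and g: "continuous_on {0..T} g"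
    and sol: "inverse_problem_solution D A \<rho> T g \<phi> \<psi> u f"
  shows "t \<in> {0..T} \<Longrightarrow> ip (u t) (v k) = fourier_mode \<rho> g (lam k) (ip \<phi> (v k)) (ip f (v k)) t" (is "_ \<Longrightarrow> ?A t")
    and "ip \<psi> (v k) = (T * mittag_leffler \<rho> 2 (- lam k * T powr \<rho>)) *\<^sub>R ip \<phi> (v k) + p_coeff \<rho> g (lam k) T *\<^sub>R ip f (v k)" (is ?B)
proof -
  from sol obtain w where u: "continuous_on {0..T} u" and uD: "\<And>t. t \<in> {0<..T} \<Longrightarrow> u t \<in> D"
    and w: "\<And>t. t \<in> {0<..T} \<Longrightarrow> has_caputo_deriv \<rho> T u (w t) t"
      "\<And>t. t \<in> {0<..T} \<Longrightarrow> w t + A (u t) = g t *\<^sub>R f"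
    and u0: "u 0 = \<phi>" and \<psi>: "(LBINT t:{0..T}. u t) = \<psi>"
    unfolding inverse_problem_solution_def by blast
  define z where "z t = ip (u t) (v k)" for t
  define h where "h t = g t *\<^sub>R ip f (v k) - lam k *\<^sub>R z t" for t
  have z: "continuous_on {0..T} z"
    unfolding z_def by (rule bounded_linear.continuous_on[OF bounded_linear_ip u])
  have h: "continuous_on {0..T} h" unfolding h_def by (intro continuous_intros g z)
  have wk: "ip (w t) (v k) = h t" if "t \<in> {0<..T}" for t
  proof -
    have "w t = g t *\<^sub>R f - A (u t)" using w(2)[OF that] by (simp add: algebra_simps)
    then show ?thesis using A_coef[OF uD[OF that]] by (simp add: coef.diff coef.scaleR h_def z_def)
  qed
  let ?F = "frac_compl \<rho> (\<lambda>s. z s - ip \<phi> (v k))"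
  have zc: "continuous_on {0..T} (\<lambda>s. z s - ip \<phi> (v k))" by (intro continuous_intros z)
  have F: "ip (frac_compl \<rho> (\<lambda>s. u s - u 0) t) (v k) = ?F t" if "t \<in> {0..T}" for t
    using frac_compl_bounded_linear[OF \<rho>(2) _ _ bounded_linear_ip, of T "\<lambda>s. u s - u 0" t "v k"] that u
    by (simp add: coef.diff z_def u0 continuous_intros)
  have dF: "(?F has_vector_derivative h t) (at t within {0..T})" if t: "t \<in> {0<..T}" for t
  proof (rule has_vector_derivative_transform)
    show "((\<lambda>s. ip (frac_compl \<rho> (\<lambda>s. u s - u 0) s) (v k)) has_vector_derivative h t) (at t within {0..T})"
      using bounded_linear.has_vector_derivative[OF bounded_linear_ip[of "v k"] w(1)[OF t, unfolded has_caputo_deriv_iff]] wk[OF t]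
      by simp
  qed (use t F in auto)
  have eq: "?F t = conv (powr_kernel 1) h t" if t: "t \<in> {0..T}" for t
  proof -
    have "(h has_integral (?F t - ?F 0)) {0..t}"
    proof (rule fundamental_theorem_of_calculus_interior)
      show "continuous_on {0..t} ?F"
        by (rule continuous_on_subset[OF frac_compl_continuous[OF \<rho>(2) zc]]) (use t in auto)
      fix x assume x: "x \<in> {0<..<t}"
      then have "at x within {0..T} = at x" using t by (intro at_within_interior) auto
      then show "(?F has_vector_derivative h x) (at x)" using dF[of x] x t by simp
    qed (use t in auto)
    moreover have "?F 0 = 0" by (rule frac_compl_0[OF \<rho>(2)]) (simp add: z_def u0)
    ultimately have "?F t = integral {0..t} h" by (simp add: integral_unique)
    then show ?thesis using conv_powr_kernel_1_eq_integral[OF h, of t] t by simp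
  qed
  have m: "z t = fourier_mode \<rho> g (lam k) (ip \<phi> (v k)) (ip f (v k)) t" if "t \<in> {0..T}" for t
    using fourier_mode_unique[OF \<rho> T g z eq[unfolded h_def] that] .
  then show "t \<in> {0..T} \<Longrightarrow> ?A t" by (simp add: z_def)
  have "ip \<psi> (v k) = conv (powr_kernel 1) z T"
    unfolding \<psi>[symmetric] lborel_integral_eq_conv[OF u] z_def
    by (rule conv_bounded_linear[OF bounded_linear_ip set_integrable_powr_kernel u]) auto
  also have "\<dots> = conv (powr_kernel 1) (fourier_mode \<rho> g (lam k) (ip \<phi> (v k)) (ip f (v k))) T"
    by (rule conv_cong) (use m in auto)
  finally show ?B by (simp add: fourier_mode_integral[OF \<rho>(1) T g])
qed

text \<open>
  Dividing by \<open>p\<close> costs a factor \<open>lam k\<close>. For the coefficients of \<open>\<psi>\<close> it is absorbed by \<open>\<psi> \<in> D\<close>, for those of \<open>\<phi>\<close> by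
  the decay of \<open>T E\<^sub>\<rho>\<^sub>,\<^sub>2(- lam k T\<^sup>\<rho>)\<close>, so that the candidate coefficients of \<open>f\<close> are square summable.
\<close>

lemma source_term_exists:
  assumes \<rho>: "0 < \<rho>" "\<rho> \<le> 1" and T: "0 < T" and g: "continuous_on {0..T} g"
    and g0: "\<And>t. t \<in> {0..T} \<Longrightarrow> g t \<noteq> 0" and \<psi>: "\<psi> \<in> D"
  obtains f where "\<And>k. p_coeff \<rho> g (lam k) T \<noteq> 0"
    "\<And>k. ip f (v k) = (1 / p_coeff \<rho> g (lam k) T) *\<^sub>R
      (ip \<psi> (v k) - (T * mittag_leffler \<rho> 2 (- lam k * T powr \<rho>)) *\<^sub>R ip \<phi> (v k))"
    "(\<lambda>k. smul (ip f (v k)) (v k)) sums f"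
proof -
  let ?p = "\<lambda>k. p_coeff \<rho> g (lam k) T"
  let ?e = "\<lambda>k. T * mittag_leffler \<rho> 2 (- lam k * T powr \<rho>)"
  let ?b = "\<lambda>k. (1 / ?p k) *\<^sub>R (ip \<psi> (v k) - ?e k *\<^sub>R ip \<phi> (v k))"
  obtain \<kappa> where \<kappa>: "\<kappa> > 0" "\<And>l. l \<ge> lam 0 \<Longrightarrow> \<kappa> \<le> l * \<bar>p_coeff \<rho> g l T\<bar>"
    using p_coeff_lower_bound[OF \<rho> T lam_0 g g0] by metis
  have p: "?p k \<noteq> 0" for k using \<kappa>(1) \<kappa>(2)[OF lam_ge[of k]] by auto
  have inv_p: "\<bar>1 / ?p k\<bar> \<le> lam k / \<kappa>" for k
    using \<kappa>(1) \<kappa>(2)[OF lam_ge[of k]] p[of k] by (simp add: field_simps)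
  let ?P = "powr_kernel (2 - \<rho>) T"
  have e: "0 \<le> ?e k" "lam k * ?e k \<le> ?P" for k
  proof -
    show "lam k * ?e k \<le> ?P"
      using relaxation_integral_bound[OF \<rho> lam_pos[of k], of T] T by (simp add: ml_kernel_def)
    have "0 \<le> (LBINT s:{0..T}. mittag_leffler \<rho> 1 (- lam k * s powr \<rho>))"
      unfolding set_lebesgue_integral_def
      using relaxation_bounds(1)[OF \<rho>, of "lam k"] lam_pos[of k] by (intro integral_nonneg_AE AE_I2) auto
    then show "0 \<le> ?e k" using relaxation_integral[OF \<rho>(1), of T "- lam k"] T by simp
  qed
  have "summable (\<lambda>k. (norm (?b k))\<^sup>2)"
  proof (rule summable_square_of_bound)
    show "summable (\<lambda>k. (lam k * norm (ip \<psi> (v k)))\<^sup>2)" using \<psi> by (simp add: D_iff power_mult_distrib)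
    show "summable (\<lambda>k. (norm (ip \<phi> (v k)))\<^sup>2)" by (rule bessel_summable)
    fix k
    have "norm (?b k) = \<bar>1 / ?p k\<bar> * norm (ip \<psi> (v k) - ?e k *\<^sub>R ip \<phi> (v k))" by simp
    also have "\<dots> \<le> lam k / \<kappa> * (norm (ip \<psi> (v k)) + ?e k * norm (ip \<phi> (v k)))"
      using e(1)[of k] lam_pos[of k] \<kappa>(1)
      by (intro mult_mono inv_p order_trans[OF norm_triangle_ineq4]) auto
    also have "\<dots> = 1 / \<kappa> * (lam k * norm (ip \<psi> (v k))) + (lam k * ?e k) * norm (ip \<phi> (v k)) / \<kappa>"
      using \<kappa>(1) by (simp add: field_simps)
    also have "\<dots> \<le> 1 / \<kappa> * (lam k * norm (ip \<psi> (v k))) + ?P * norm (ip \<phi> (v k)) / \<kappa>"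
      using \<kappa>(1) by (intro add_left_mono divide_right_mono mult_right_mono e) auto
    finally show "\<bar>norm (?b k)\<bar> \<le> \<bar>1 / \<kappa> * (lam k * norm (ip \<psi> (v k))) + ?P / \<kappa> * norm (ip \<phi> (v k))\<bar>"
      by (simp add: abs_le_iff)
  qed
  then obtain f where "(\<lambda>k. smul (?b k) (v k)) sums f" "\<And>k. ip f (v k) = ?b k"
    using riesz_fischer[of ?b] by blast
  then show thesis using that[of f] p by simp
qed

lemma fourier_mode_bounds:
  fixes a b :: 'k
  assumes \<rho>: "0 < \<rho>" "\<rho> \<le> 1" and g: "continuous_on {0..T} g"
    and G: "\<And>s. s \<in> {0..T} \<Longrightarrow> \<bar>g s\<bar> \<le> G"
  shows "t \<in> {0..T} \<Longrightarrow> norm (fourier_mode \<rho> g (lam k) a b t) \<le> norm a + G / lam 0 * norm b"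
    and "0 < \<epsilon> \<Longrightarrow> t \<in> {\<epsilon>..T} \<Longrightarrow> norm (lam k *\<^sub>R fourier_mode \<rho> g (lam k) a b t) \<le>
      powr_kernel (2 - \<rho>) T / \<epsilon> * norm a + G * norm b"
proof -
  let ?e = "\<lambda>t. mittag_leffler \<rho> 1 (- lam k * t powr \<rho>)" and ?q = "q_coeff \<rho> g (lam k)"
  note l = lam_pos[of k]
  have e: "0 \<le> ?e t" "?e t \<le> 1" for t using relaxation_bounds[OF \<rho>, of "lam k" t] l by auto
  have q: "lam k * \<bar>?q t\<bar> \<le> G" if "t \<in> {0..T}" for t by (rule q_coeff_bound[OF \<rho> l g G that])
  have n: "norm (fourier_mode \<rho> g (lam k) a b t) \<le> ?e t * norm a + \<bar>?q t\<bar> * norm b" for t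
    unfolding fourier_mode_def using e(1)[of t] by (intro order_trans[OF norm_triangle_ineq]) simp
  show "norm (fourier_mode \<rho> g (lam k) a b t) \<le> norm a + G / lam 0 * norm b" if t: "t \<in> {0..T}"
  proof -
    have "lam 0 * \<bar>?q t\<bar> \<le> lam k * \<bar>?q t\<bar>" using lam_ge[of k] by (intro mult_right_mono) auto
    then have "\<bar>?q t\<bar> \<le> G / lam 0" using q[OF t] lam_0 by (simp add: field_simps)
    then have "?e t * norm a + \<bar>?q t\<bar> * norm b \<le> 1 * norm a + G / lam 0 * norm b"
      by (intro add_mono mult_right_mono e) auto
    then show ?thesis using n[of t] by simp
  qed
  show "norm (lam k *\<^sub>R fourier_mode \<rho> g (lam k) a b t) \<le> powr_kernel (2 - \<rho>) T / \<epsilon> * norm a + G * norm b"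
    if t: "0 < \<epsilon>" "t \<in> {\<epsilon>..T}"
  proof -
    have G2: "Gamma (2 - \<rho>) > 0" using \<rho> by (intro Gamma_real_pos) auto
    have "lam k * ?e t \<le> powr_kernel (2 - \<rho>) t / t" using relaxation_decay[OF \<rho> l, of t] t by auto
    also have "\<dots> \<le> powr_kernel (2 - \<rho>) T / \<epsilon>"
      using t \<rho> G2 unfolding powr_kernel_def by (intro frac_le divide_right_mono powr_mono2) auto
    finally have 1: "lam k * ?e t \<le> powr_kernel (2 - \<rho>) T / \<epsilon>" .
    have "norm (lam k *\<^sub>R fourier_mode \<rho> g (lam k) a b t) \<le> lam k * (?e t * norm a + \<bar>?q t\<bar> * norm b)"
      using n[of t] l by (simp add: mult_left_mono)
    also have "\<dots> = (lam k * ?e t) * norm a + (lam k * \<bar>?q t\<bar>) * norm b" by (simp add: algebra_simps)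
    also have "\<dots> \<le> powr_kernel (2 - \<rho>) T / \<epsilon> * norm a + G * norm b"
      using 1 q[of t] t by (intro add_mono mult_right_mono) auto
    finally show ?thesis .
  qed
qed

text \<open>
  The modes have square-summable majorants on \<open>{0..T}\<close>, and so have their multiples by the eigenvalues on \<open>{\<epsilon>..T}\<close>; this
  yields \<open>u\<close>, its membership in the domain and the continuity of \<open>A u\<close>. For the Caputo derivative, the increments over
  \<open>[a, s]\<close> of the complementary fractional integral of \<open>u - u 0\<close> are compared with the integral of \<open>g f - A u\<close> coefficient
  by coefficient. Starting at \<open>a > 0\<close> avoids integrating \<open>A u\<close> near \<open>0\<close>, where for \<open>\<rho> = 1\<close> it may fail to be integrable.
\<close>

lemma mode_series_solves:
  assumes \<rho>: "0 < \<rho>" "\<rho> \<le> 1" and T: "0 < T" and g: "continuous_on {0..T} g"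
    and \<psi>: "\<And>k. ip \<psi> (v k) = (T * mittag_leffler \<rho> 2 (- lam k * T powr \<rho>)) *\<^sub>R ip \<phi> (v k) + p_coeff \<rho> g (lam k) T *\<^sub>R ip f (v k)"
  obtains u where "inverse_problem_solution D A \<rho> T g \<phi> \<psi> u f"
    "\<And>t. t \<in> {0..T} \<Longrightarrow>
      (\<lambda>k. smul (fourier_mode \<rho> g (lam k) (ip \<phi> (v k)) (ip f (v k)) t) (v k)) sums u t"
proof -
  define y where "y k = fourier_mode \<rho> g (lam k) (ip \<phi> (v k)) (ip f (v k))" for k
  have y: "continuous_on {0..T} (y k)" for k
    unfolding y_def by (rule continuous_on_fourier_mode[OF \<rho>(1) g])
  obtain G where G: "\<And>s. s \<in> {0..T} \<Longrightarrow> \<bar>g s\<bar> \<le> G"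
    using continuous_cutoff[OF g] by (metis indicator_simps(1) real_norm_def scaleR_one)
  note yb = fourier_mode_bounds[OF \<rho> g G, where a="ip \<phi> (v k)" and b="ip f (v k)" and k=k for k, folded y_def]
  have sq: "summable (\<lambda>k. (c * norm (ip \<phi> (v k)) + d * norm (ip f (v k)))\<^sup>2)" for c d :: real
    by (rule summable_square_of_bound[OF bessel_summable[of \<phi>] bessel_summable[of f] order_refl])
  obtain u where u: "continuous_on {0..T} u" "\<And>t. t \<in> {0..T} \<Longrightarrow> (\<lambda>k. smul (y k t) (v k)) sums u t"
    and uk: "\<And>t k. t \<in> {0..T} \<Longrightarrow> ip (u t) (v k) = y k t"
  proof (rule fourier_series_uniform[of "{0..T}" y])
    show "continuous_on {0..T} (y k)" for k by (rule y)
    show "norm (y k t) \<le> 1 * norm (ip \<phi> (v k)) + G / lam 0 * norm (ip f (v k))" if "t \<in> {0..T}" for k t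
      using yb(1)[OF _ that] by simp
    show "summable (\<lambda>k. (1 * norm (ip \<phi> (v k)) + G / lam 0 * norm (ip f (v k)))\<^sup>2)" by (rule sq)
  qed blast
  have Au: "\<exists>a. continuous_on {\<epsilon>..T} a \<and> (\<forall>t\<in>{\<epsilon>..T}. \<forall>k. ip (a t) (v k) = lam k *\<^sub>R y k t)" if \<epsilon>: "\<epsilon> > 0" for \<epsilon>
  proof (rule fourier_series_uniform[of "{\<epsilon>..T}" "\<lambda>k t. lam k *\<^sub>R y k t"])
    show "continuous_on {\<epsilon>..T} (\<lambda>t. lam k *\<^sub>R y k t)" for k
      by (intro continuous_intros continuous_on_subset[OF y]) (use \<epsilon> in auto)
    show "norm (lam k *\<^sub>R y k t) \<le> powr_kernel (2 - \<rho>) T / \<epsilon> * norm (ip \<phi> (v k)) + G * norm (ip f (v k))"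
      if "t \<in> {\<epsilon>..T}" for k t by (rule yb(2)[OF _ \<epsilon> that])
    show "summable (\<lambda>k. (powr_kernel (2 - \<rho>) T / \<epsilon> * norm (ip \<phi> (v k)) + G * norm (ip f (v k)))\<^sup>2)" by (rule sq)
  qed blast
  have uD: "u t \<in> D" if t: "t \<in> {0<..T}" for t
  proof -
    obtain a where "\<forall>s\<in>{t..T}. \<forall>k. ip (a s) (v k) = lam k *\<^sub>R y k s" using Au[of t] t by auto
    then have a: "ip (a t) (v k) = lam k *\<^sub>R y k t" for k using t by simp
    have "summable (\<lambda>k. (norm (ip (a t) (v k)))\<^sup>2)" by (rule bessel_summable)
    then show ?thesis unfolding D_iff using uk[of t] t by (simp add: a power_mult_distrib)
  qed
  have Auk: "ip (A (u t)) (v k) = lam k *\<^sub>R y k t" if "t \<in> {0<..T}" for t k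
    using A_coef[OF uD[OF that]] uk[of t] that by simp
  have Ac: "continuous_on {0<..T} (\<lambda>t. A (u t))"
  proof (rule continuous_on_half_open)
    fix \<epsilon> :: real assume \<epsilon>: "\<epsilon> > 0"
    obtain a where a: "continuous_on {\<epsilon>..T} a" "\<And>t k. t \<in> {\<epsilon>..T} \<Longrightarrow> ip (a t) (v k) = lam k *\<^sub>R y k t"
      using Au[OF \<epsilon>] by blast
    have "A (u t) = a t" if "t \<in> {\<epsilon>..T}" for t
      by (rule eq_by_coefs) (use a(2) Auk \<epsilon> that in auto)
    then show "continuous_on {\<epsilon>..T} (\<lambda>t. A (u t))"
      by (intro continuous_on_eq[OF a(1)]) simp
  qed
  have u0: "u 0 = \<phi>" by (rule eq_by_coefs) (use uk[of 0] T in \<open>simp add: y_def fourier_mode_0\<close>)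
  define w where "w t = g t *\<^sub>R f - A (u t)" for t
  have wc: "continuous_on {0<..T} w"
    unfolding w_def by (intro continuous_intros Ac continuous_on_subset[OF g]) auto
  define h where "h k t = g t *\<^sub>R ip f (v k) - lam k *\<^sub>R y k t" for k t
  have h: "continuous_on {0..T} (h k)" for k unfolding h_def by (intro continuous_intros g y)
  have wk: "ip (w t) (v k) = h k t" if "t \<in> {0<..T}" for t k
    using Auk[OF that] by (simp add: w_def h_def coef.diff coef.scaleR)
  let ?F = "frac_compl \<rho> (\<lambda>s. u s - u 0)"
  have uc: "continuous_on {0..T} (\<lambda>s. u s - u 0)" by (intro continuous_intros u)
  have Fk: "ip (?F s) (v k) = integral {0..s} (h k)" if s: "s \<in> {0..T}" for s k
  proof -
    have "ip (?F s) (v k) = frac_compl \<rho> (\<lambda>s. ip (u s - u 0) (v k)) s"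
      using s by (intro frac_compl_bounded_linear[OF \<rho>(2) uc _ bounded_linear_ip]) auto
    also have "\<dots> = frac_compl \<rho> (\<lambda>s. y k s - ip \<phi> (v k)) s"
    proof (cases "\<rho> = 1")
      case True then show ?thesis using s uk[of s] by (simp add: coef.diff u0)
    next
      case False
      then show ?thesis using s uk \<rho> by (simp add: frac_compl_eq_conv coef.diff u0, intro conv_cong) auto
    qed
    also have "\<dots> = conv (powr_kernel 1) (h k) s"
      unfolding y_def h_def[abs_def] by (rule fourier_mode_solves[OF \<rho> g s])
    also have "\<dots> = integral {0..s} (h k)" using s by (intro conv_powr_kernel_1_eq_integral[OF h]) auto
    finally show ?thesis .
  qed
  have F: "?F s = ?F a + integral {a..s} w" if a: "0 < a" "a \<le> s" "s \<le> T" for a s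
  proof (rule eq_by_coefs)
    fix k
    have "w integrable_on {a..s}"
      by (rule integrable_continuous_real[OF continuous_on_subset[OF wc]]) (use a in auto)
    then have "ip (integral {a..s} w) (v k) = integral {a..s} (\<lambda>t. ip (w t) (v k))"
      using integral_linear[OF _ bounded_linear_ip, of w "{a..s}" "v k"] by (simp add: o_def)
    also have "\<dots> = integral {a..s} (h k)" using a wk by (intro integral_cong) auto
    finally have "ip (?F a + integral {a..s} w) (v k) = integral {0..a} (h k) + integral {a..s} (h k)"
      using a Fk[of a k] by (simp add: coef.add)
    also have "\<dots> = integral {0..s} (h k)"
      by (rule Henstock_Kurzweil_Integration.integral_combine)
        (use a in \<open>auto intro!: integrable_continuous_real continuous_on_subset[OF h]\<close>)
    finally show "ip (?F s) (v k) = ip (?F a + integral {a..s} w) (v k)" using a Fk[of s k] by simp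
  qed
  have Fd: "(?F has_vector_derivative w t) (at t within {0..T})" if t: "t \<in> {0<..T}" for t
  proof -
    have "continuous_on {t/2..T} w" by (rule continuous_on_subset[OF wc]) (use t in auto)
    then have "((\<lambda>s. integral {t/2..s} w) has_vector_derivative w t) (at t within {t/2..T})"
      by (rule integral_has_vector_derivative) (use t in auto)
    then have "((\<lambda>s. ?F (t/2) + integral {t/2..s} w) has_vector_derivative 0 + w t) (at t within {t/2..T})"
      by (intro has_vector_derivative_add has_vector_derivative_const)
    then have "(?F has_vector_derivative 0 + w t) (at t within {t/2..T})"
    proof (rule has_vector_derivative_transform[rotated 2])
      show "?F s = ?F (t/2) + integral {t/2..s} w" if "s \<in> {t/2..T}" for s
        by (rule F) (use t that in auto)
    qed (use t in auto)
    then show ?thesis using at_within_upper_segment(1)[of "t/2" t 0 T] t by simp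
  qed
  have int: "(LBINT t:{0..T}. u t) = \<psi>"
  proof (rule eq_by_coefs)
    fix k
    have "ip (LBINT t:{0..T}. u t) (v k) = conv (powr_kernel 1) (\<lambda>t. ip (u t) (v k)) T"
      unfolding lborel_integral_eq_conv[OF u(1)]
      by (rule conv_bounded_linear[OF bounded_linear_ip set_integrable_powr_kernel u(1)]) auto
    also have "\<dots> = conv (powr_kernel 1) (y k) T" by (rule conv_cong) (use uk in auto)
    also have "\<dots> = ip \<psi> (v k)" unfolding y_def fourier_mode_integral[OF \<rho>(1) T g] \<psi> ..
    finally show "ip (LBINT t:{0..T}. u t) (v k) = ip \<psi> (v k)" .
  qed
  have "inverse_problem_solution D A \<rho> T g \<phi> \<psi> u f"
    unfolding inverse_problem_solution_def
    using u(1) uD Ac u0 int wc Fd by (auto simp: has_caputo_deriv_iff w_def intro!: exI[of _ w])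
  then show thesis using that u(2) unfolding y_def by blast
qed

end

theorem theorem3p1:
  fixes smul :: "'k::{real_normed_field, euclidean_space} \<Rightarrow>
      'h::{real_inner, banach, second_countable_topology} \<Rightarrow> 'h"
    and ip :: "'h \<Rightarrow> 'h \<Rightarrow> 'k"
    and D :: "'h set" and A :: "'h \<Rightarrow> 'h"
    and v :: "nat \<Rightarrow> 'h" and lam :: "nat \<Rightarrow> real"
    and \<rho> T :: real and \<phi> \<psi> :: 'h and g :: "real \<Rightarrow> real"
  assumes "hilbert_space smul ip"
    and "self_adjoint smul ip D A"
    and "\<exists>C>0. \<forall>h\<in>D. ip (A h) h \<bullet> 1 \<ge> C * (ip h h \<bullet> 1)"
    and "complete_orthonormal ip v"
    and "\<forall>k. v k \<in> D \<and> A (v k) = smul (of_real (lam k)) (v k)"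
    and "0 < lam 0" and "mono lam" and "filterlim lam at_top sequentially"
    and "D = {h. summable (\<lambda>k. (lam k)\<^sup>2 * (norm (ip h (v k)))\<^sup>2)}"
    and "0 < \<rho>" and "\<rho> \<le> 1" and "0 < T"
    and "\<psi> \<in> D"
    and "continuous_on {0..T} g" and "\<forall>t\<in>{0..T}. g t \<noteq> 0"
  defines "c \<equiv> \<lambda>k. ip \<psi> (v k) - ip \<phi> (v k) * of_real (T * mittag_leffler \<rho> 2 (- lam k * T powr \<rho>))"
  shows "\<exists>u f.
    inverse_problem_solution D A \<rho> T g \<phi> \<psi> u f \<and>
    (\<forall>u' f'. inverse_problem_solution D A \<rho> T g \<phi> \<psi> u' f' \<longrightarrow>
       f' = f \<and> (\<forall>t\<in>{0..T}. u' t = u t)) \<and>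
    (\<forall>k. p_coeff \<rho> g (lam k) T \<noteq> 0) \<and>
    (\<lambda>k. smul (of_real (1 / p_coeff \<rho> g (lam k) T) * c k) (v k)) sums f \<and>
    (\<forall>t\<in>{0..T}.
       (\<lambda>k. smul
          (ip \<phi> (v k) * of_real (mittag_leffler \<rho> 1 (- lam k * t powr \<rho>))
            + of_real (q_coeff \<rho> g (lam k) t / p_coeff \<rho> g (lam k) T) * c k) (v k)) sums u t)"
proof -
  interpret orthonormal_basis smul ip v
    by (intro orthonormal_basis.intro orthonormal_basis_axioms.intro assms(1,4))
  interpret diagonal_operator smul ip v D A lam
  proof
    fix x k assume x: "x \<in> D"
    have "(v k, A (v k)) \<in> adjoint_graph ip D A"
      using assms(2,5) unfolding self_adjoint_def by blast
    then have "ip (A x) (v k) = ip x (smul (of_real (lam k)) (v k))"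
      using x assms(5) by (auto simp: adjoint_graph_def)
    then show "ip (A x) (v k) = lam k *\<^sub>R ip x (v k)"
      by (simp add: ip_smul_right scaleR_conv_of_real)
  next
    show "x \<in> D \<longleftrightarrow> summable (\<lambda>k. (lam k)\<^sup>2 * (norm (ip x (v k)))\<^sup>2)" for x
      unfolding assms(9) by simp
    show "lam k \<ge> lam 0" for k using assms(7) by (simp add: monoD)
  qed (rule assms(6))
  note \<rho> = assms(10,11) and T = assms(12) and g = assms(14)
  let ?p = "\<lambda>k. p_coeff \<rho> g (lam k) T"
  have c: "c k = ip \<psi> (v k) - (T * mittag_leffler \<rho> 2 (- lam k * T powr \<rho>)) *\<^sub>R ip \<phi> (v k)" for k
    by (simp add: c_def scaleR_conv_of_real mult.commute)
  obtain f where p: "\<And>k. ?p k \<noteq> 0" and fk: "\<And>k. ip f (v k) = (1 / ?p k) *\<^sub>R c k"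
    and f: "(\<lambda>k. smul (ip f (v k)) (v k)) sums f"
    using source_term_exists[OF \<rho> T g _ assms(13), of \<phi>] assms(15) unfolding c by blast
  have \<psi>: "ip \<psi> (v k) = (T * mittag_leffler \<rho> 2 (- lam k * T powr \<rho>)) *\<^sub>R ip \<phi> (v k) + ?p k *\<^sub>R ip f (v k)" for k
    using p by (simp add: fk c)
  obtain u where sol: "inverse_problem_solution D A \<rho> T g \<phi> \<psi> u f"
    and u: "\<And>t. t \<in> {0..T} \<Longrightarrow>
      (\<lambda>k. smul (fourier_mode \<rho> g (lam k) (ip \<phi> (v k)) (ip f (v k)) t) (v k)) sums u t"
    using mode_series_solves[OF \<rho> T g \<psi>] by blast
  have uniq: "f' = f \<and> (\<forall>t\<in>{0..T}. u' t = u t)"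
    if sol': "inverse_problem_solution D A \<rho> T g \<phi> \<psi> u' f'" for u' f'
  proof -
    have "f' = f"
    proof (rule eq_by_coefs)
      fix k
      have "?p k *\<^sub>R ip f' (v k) = ?p k *\<^sub>R ip f (v k)"
        using solution_coefs(2)[OF \<rho> T g sol', of k] \<psi>[of k] by (metis add_left_cancel)
      then show "ip f' (v k) = ip f (v k)" using p by simp
    qed
    moreover have "u' t = u t" if "t \<in> {0..T}" for t
      by (rule eq_by_coefs)
        (use solution_coefs(1)[OF \<rho> T g sol' that] solution_coefs(1)[OF \<rho> T g sol that] \<open>f' = f\<close> in simp)
    ultimately show ?thesis by blast
  qed
  have "(\<lambda>k. smul (of_real (1 / ?p k) * c k) (v k)) sums f"
    using f by (simp add: fk scaleR_conv_of_real)
  moreover have "(\<lambda>k. smul (ip \<phi> (v k) * of_real (mittag_leffler \<rho> 1 (- lam k * t powr \<rho>))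
      + of_real (q_coeff \<rho> g (lam k) t / ?p k) * c k) (v k)) sums u t" if "t \<in> {0..T}" for t
    using u[OF that] by (simp add: fourier_mode_def fk scaleR_conv_of_real mult_ac)
  ultimately show ?thesis using sol uniq p by blast
qed

end
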